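(* Consider the single-input single-output plant $y=W(s)u$, $W(s)=k_pZ(s)/P(s)$, with unknown coefficients, where $Z,P$ are monic real polynomials, $\deg P=n$, $W$ is minimum phase, the sign of $k_p$ is known, and the relative degree of $W$ is known and equal to $n^*=\deg P-\deg Z=1$. Let the closed-loop reference model be $$\dot x_m=A_mx_m+b_mk_mr+\ell(y-y_m),\qquad y_m=c_m^Tx_m,$$ where $W_m(s)=k_mZ_m(s)/P_m(s)=c_m^T(sI-A_m)^{-1}b_mk_m$ has relative degree one and $W_m'(s)=Z_m(s)/P_m(s)$ is minimum phase, and $r$ is a bounded piecewise continuous reference signal. Suppose the gain $\ell$ is chosen such that $$W_e'(s)=\frac{Z_m(s)}{P_m(s)+k_\ell Z_\ell(s)},\qquad \frac{k_\ell Z_\ell(s)}{P_m(s)}=c_m^T(sI-A_m)^{-1}\ell,$$ is strictly positive real. Let the controller be $$\dot\omega_1=\Lambda\omega_1+b_\lambda u,\quad \dot\omega_2=\Lambda\omega_2+b_\lambda y,\quad \omega=[r,\ \omega_1^T,\ y,\ \omega_2^T]^T,\quad u=\theta^T(t)\omega(t),$$ with adaptive gain $\theta(t)=[k(t),\ \theta_1^T(t),\ \theta_0(t),\ \theta_2^T(t)]^T\in\mathbb R^{2n}$ updated by $$\dot\theta=-\gamma\,\mathrm{sign}(k_p)\,e_y\,\omega,\qquad e_y=y-y_m,\quad \gamma>0.$$ Then the adaptive system is globally stable (for all initial conditions all its signals are bounded), and the model following error $e_y(t)$ converges asymptotically to zero as $t\to\infty$.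
   Context: Transfer functions act as operators on time signals ($s$ is the differential operator), realized by finite-dimensional linear systems. The plant is realized by $\dot x_p=A_px_p+b_pu$, $y=k_pc_p^Tx_p$, with $k_pc_p^T(sI-A_p)^{-1}b_p=W(s)$. Reference model: $k_m$ is a scalar; $Z_m,P_m$ are monic real polynomials, $\deg P_m=m$, $\deg Z_m=m-1$; $(A_m,b_m,c_m^T)$ is an $m$-dimensional system in observer canonical form with $\det(sI-A_m)=P_m(s)$ and $c_m^T=[0\ \cdots\ 0\ 1]$, so that $k_\ell Z_\ell(s)$ is the polynomial of degree at most $m-1$ whose coefficients are the entries of $\ell\in\mathbb R^m$ and is thus free to choose. Controller filters: $\Lambda\in\mathbb R^{(n-1)\times(n-1)}$ is Hurwitz, $b_\lambda\in\mathbb R^{n-1}$, $\omega_1,\omega_2,\theta_1,\theta_2\in\mathbb R^{n-1}$, $k,\theta_0\in\mathbb R$. For simplicity the filter polynomial $\lambda(s)=\det(sI-\Lambda)$ is chosen as $\lambda(s)=Z_m(s)$; this choice is not claimed to be necessary for the stability of the adaptive system. By the Bezout identity there is a constant $\theta^*$ for which the closed loop with $\theta(t)\equiv\theta^*$ has transfer function $W_m(s)$ from $r$ to $y$. A transfer function is minimum phase if all its zeros have negative real part; a matrix is Hurwitz if all its eigenvalues have negative real part. A real rational function $H(s)\not\equiv0$ is positive real if it is analytic in $\mathrm{Re}\,s>0$ with $\mathrm{Re}\,H(s)\ge0$ there, and strictly positive real (SPR) if $H(s-\varepsilon)$ is positive real for some $\varepsilon>0$.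
   Formalization: The formal theorem also assumes that the reference-model matrix A_m is Hurwitz, that Z and P are coprime with the plant realized in dimension n, and that the filter pair (Λ, b_λ) is controllable; without these the claim fails. *)

theory Defs
  imports
    "HOL-Analysis.Analysis"
    "Jordan_Normal_Form.Char_Poly"
    "Jordan_Normal_Form.Gauss_Jordan_Elimination"
begin

unbundle no vec_syntax and no inner_syntax

section \<open>Rational functions\<close>

text \<open>A real rational function is given by a numerator \<open>N\<close> and a denominator \<open>D \<noteq> 0\<close>, which need not
  be coprime. Since \<open>x / 0 = 0\<close> in HOL, the value \<open>rat_eval N D s\<close> is meaningful only if
  \<open>D(s) \<noteq> 0\<close>; the definitions below take this into account.\<close>

definition rat_eval :: "real poly \<Rightarrow> real poly \<Rightarrow> complex \<Rightarrow> complex" where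
  "rat_eval N D s = poly (map_poly complex_of_real N) s / poly (map_poly complex_of_real D) s"

text \<open>A zero of the rational function is a zero of the numerator that is not cancelled by the
  denominator.\<close>

definition rat_zero :: "real poly \<Rightarrow> real poly \<Rightarrow> complex \<Rightarrow> bool" where
  "rat_zero N D s \<longleftrightarrow>
     Polynomial.order s (map_poly complex_of_real N) > Polynomial.order s (map_poly complex_of_real D)"

definition minimum_phase :: "real poly \<Rightarrow> real poly \<Rightarrow> bool" where
  "minimum_phase N D \<longleftrightarrow> (\<forall>s. rat_zero N D s \<longrightarrow> Re s < 0)"

text \<open>Analyticity of \<open>N/D\<close> in the open right half plane is that of the rational function, i.e.
  after removing removable singularities: \<open>h\<close> is its analytic extension.\<close>

definition positive_real :: "real poly \<Rightarrow> real poly \<Rightarrow> bool" where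
  "positive_real N D \<longleftrightarrow> N \<noteq> 0 \<and> D \<noteq> 0 \<and>
     (\<exists>h. h holomorphic_on {s. 0 < Re s} \<and>
          (\<forall>s. 0 < Re s \<and> poly (map_poly complex_of_real D) s \<noteq> 0 \<longrightarrow> h s = rat_eval N D s) \<and>
          (\<forall>s. 0 < Re s \<longrightarrow> 0 \<le> Re (h s)))"

text \<open>\<open>p \<circ>\<^sub>p [:-\<epsilon>, 1:]\<close> is the polynomial \<open>p(s - \<epsilon>)\<close>.\<close>

definition strictly_positive_real :: "real poly \<Rightarrow> real poly \<Rightarrow> bool" where
  "strictly_positive_real N D \<longleftrightarrow>
     (\<exists>\<epsilon>>0. positive_real (N \<circ>\<^sub>p [:-\<epsilon>, 1:]) (D \<circ>\<^sub>p [:-\<epsilon>, 1:]))"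


section \<open>Linear systems\<close>

definition hurwitz :: "real mat \<Rightarrow> bool" where
  "hurwitz A \<longleftrightarrow> (\<forall>s. eigenvalue (map_mat complex_of_real A) s \<longrightarrow> Re s < 0)"

text \<open>\<open>c\<^sup>T (s I - A)\<^sup>-\<^sup>1 b\<close>, meaningful if \<open>s\<close> is not an eigenvalue of \<open>A\<close>.\<close>

definition transfer :: "real mat \<Rightarrow> real vec \<Rightarrow> real vec \<Rightarrow> complex \<Rightarrow> complex" where
  "transfer A b c s =
     map_vec complex_of_real c \<bullet>
       (the (mat_inverse (s \<cdot>\<^sub>m 1\<^sub>m (dim_row A) - map_mat complex_of_real A))
          *\<^sub>v map_vec complex_of_real b)"

text \<open>\<open>c\<^sup>T (s I - A)\<^sup>-\<^sup>1 b = N(s) / D(s)\<close> as rational functions.\<close>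

definition has_transfer_function ::
  "real mat \<Rightarrow> real vec \<Rightarrow> real vec \<Rightarrow> real poly \<Rightarrow> real poly \<Rightarrow> bool" where
  "has_transfer_function A b c N D \<longleftrightarrow>
     (\<forall>s. \<not> eigenvalue (map_mat complex_of_real A) s \<and> poly (map_poly complex_of_real D) s \<noteq> 0 \<longrightarrow>
          transfer A b c s = rat_eval N D s)"

text \<open>Observer canonical form of dimension \<open>m\<close>: the first \<open>m - 1\<close> columns are \<open>e\<^sub>2, \<dots>, e\<^sub>m\<close>, the
  last column is free (it carries the coefficients of the characteristic polynomial), and the
  output is the last state.\<close>

definition observer_canonical :: "nat \<Rightarrow> real mat \<Rightarrow> real vec \<Rightarrow> bool" where
  "observer_canonical m A c \<longleftrightarrow> A \<in> carrier_mat m m \<and>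
     (\<forall>i<m. \<forall>j<m - 1. A $$ (i, j) = (if i = j + 1 then 1 else 0)) \<and>
     c = unit_vec m (m - 1)"

text \<open>Kalman's criterion: \<open>[b, A b, \<dots>, A\<^bsup>k-1\<^esup> b]\<close> is regular, where \<open>A\<close> is \<open>k \<times> k\<close>.\<close>

definition controllable :: "real mat \<Rightarrow> real vec \<Rightarrow> bool" where
  "controllable A b \<longleftrightarrow>
     invertible_mat (mat (dim_row A) (dim_row A) (\<lambda>(i, j). ((A ^\<^sub>m j) *\<^sub>v b) $ i))"


section \<open>Signals on the half line\<close>

text \<open>Signals are functions on \<open>real\<close>, of which only the values on \<open>[0, \<infinity>)\<close> matter.\<close>

definition piecewise_continuous :: "(real \<Rightarrow> real) \<Rightarrow> bool" where
  "piecewise_continuous r \<longleftrightarrow>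
     (\<forall>T. finite {t \<in> {0..T}. \<not> continuous (at t within {0..}) r}) \<and>
     (\<forall>t\<ge>0. \<exists>L. (r \<longlongrightarrow> L) (at_right t)) \<and>
     (\<forall>t>0. \<exists>L. (r \<longlongrightarrow> L) (at_left t))"

definition bounded_signal :: "(real \<Rightarrow> real) \<Rightarrow> bool" where
  "bounded_signal f \<longleftrightarrow> (\<exists>B. \<forall>t\<ge>0. \<bar>f t\<bar> \<le> B)"

definition bounded_vec_signal :: "(real \<Rightarrow> real vec) \<Rightarrow> bool" where
  "bounded_vec_signal x \<longleftrightarrow> (\<exists>B. \<forall>t\<ge>0. \<forall>i<dim_vec (x t). \<bar>x t $ i\<bar> \<le> B)"

text \<open>\<open>x\<close> solves \<open>\<dot>x(t) = f(t)\<close> in dimension \<open>k\<close> from \<open>x0\<close> on all of \<open>[0, \<infinity>)\<close>: it is continuous and satisfies the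
  equation at every time at which the exogenous signal \<open>r\<close> is continuous (one-sidedly at \<open>t = 0\<close>).\<close>

definition solves ::
  "(real \<Rightarrow> real) \<Rightarrow> nat \<Rightarrow> (real \<Rightarrow> real vec) \<Rightarrow> real vec \<Rightarrow> (real \<Rightarrow> real vec) \<Rightarrow> bool" where
  "solves r k x x0 f \<longleftrightarrow> x 0 = x0 \<and>
     (\<forall>t\<ge>0. x t \<in> carrier_vec k) \<and>
     (\<forall>i<k. continuous_on {0..} (\<lambda>t. x t $ i)) \<and>
     (\<forall>t\<ge>0. continuous (at t within {0..}) r \<longrightarrow>
        (\<forall>i<k. ((\<lambda>t. x t $ i) has_real_derivative f t $ i) (at t within {0..})))"


section \<open>The adaptive system\<close>

definition regressor :: "real \<Rightarrow> real vec \<Rightarrow> real \<Rightarrow> real vec \<Rightarrow> real vec" where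
  "regressor r w1 y w2 = vec 1 (\<lambda>_. r) @\<^sub>v w1 @\<^sub>v vec 1 (\<lambda>_. y) @\<^sub>v w2"

text \<open>Plant \<open>(Ap, bp, kp cp)\<close> of order \<open>n\<close>, closed-loop reference model \<open>(Am, km bm, cm)\<close> of order \<open>m\<close>
  with gain \<open>lm\<close>, filters \<open>(\<Lambda>, bl)\<close> of order \<open>n - 1\<close>, and adaptation gain \<open>\<gamma>\<close>, driven by \<open>r\<close> and started
  from \<open>(xp0, xm0, w10, w20, \<theta>0)\<close>.\<close>

definition adaptive_system ::
  "nat \<Rightarrow> real mat \<Rightarrow> real vec \<Rightarrow> real vec \<Rightarrow> real \<Rightarrow>
   nat \<Rightarrow> real mat \<Rightarrow> real vec \<Rightarrow> real vec \<Rightarrow> real \<Rightarrow> real vec \<Rightarrow>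
   real mat \<Rightarrow> real vec \<Rightarrow> real \<Rightarrow> (real \<Rightarrow> real) \<Rightarrow>
   real vec \<Rightarrow> real vec \<Rightarrow> real vec \<Rightarrow> real vec \<Rightarrow> real vec \<Rightarrow>
   (real \<Rightarrow> real vec) \<Rightarrow> (real \<Rightarrow> real vec) \<Rightarrow> (real \<Rightarrow> real vec) \<Rightarrow> (real \<Rightarrow> real vec) \<Rightarrow> (real \<Rightarrow> real vec) \<Rightarrow>
   (real \<Rightarrow> real vec) \<Rightarrow> (real \<Rightarrow> real) \<Rightarrow> (real \<Rightarrow> real) \<Rightarrow> (real \<Rightarrow> real) \<Rightarrow> (real \<Rightarrow> real) \<Rightarrow> bool" where
  "adaptive_system n Ap bp cp kp m Am bm cm km lm \<Lambda> bl \<gamma> r xp0 xm0 w10 w20 \<theta>0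
       xp xm w1 w2 \<theta> \<omega> u y ym ey \<longleftrightarrow>
     (\<forall>t\<ge>0. y t = kp * (cp \<bullet> xp t)) \<and>
     (\<forall>t\<ge>0. ym t = cm \<bullet> xm t) \<and>
     (\<forall>t\<ge>0. ey t = y t - ym t) \<and>
     (\<forall>t\<ge>0. \<omega> t = regressor (r t) (w1 t) (y t) (w2 t)) \<and>
     (\<forall>t\<ge>0. u t = \<theta> t \<bullet> \<omega> t) \<and>
     solves r n xp xp0 (\<lambda>t. Ap *\<^sub>v xp t + u t \<cdot>\<^sub>v bp) \<and>
     solves r m xm xm0 (\<lambda>t. Am *\<^sub>v xm t + (km * r t) \<cdot>\<^sub>v bm + ey t \<cdot>\<^sub>v lm) \<and>
     solves r (n - 1) w1 w10 (\<lambda>t. \<Lambda> *\<^sub>v w1 t + u t \<cdot>\<^sub>v bl) \<and>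
     solves r (n - 1) w2 w20 (\<lambda>t. \<Lambda> *\<^sub>v w2 t + y t \<cdot>\<^sub>v bl) \<and>
     solves r (2 * n) \<theta> \<theta>0 (\<lambda>t. (- \<gamma> * sgn kp * ey t) \<cdot>\<^sub>v \<omega> t)"

end

theory Submission
  imports Defs "HOL-Complex_Analysis.Conformal_Mappings" "HOL-Computational_Algebra.Field_as_Ring"
    "Jordan_Normal_Form.Schur_Decomposition"
begin

unbundle no vec_syntax and no inner_syntax

text \<open>Because \<open>\<lambda> = Z\<^sub>m\<close>, the ideal gain can be written down from \<open>Z\<^sub>m - Z\<close> and \<open>P - P\<^sub>m\<close> without solving a
  Bezout equation, and there is a linear function of plant and filter state whose difference \<open>\<epsilon>\<close> from
  the model state satisfies \<open>\<epsilon>' = A\<^sub>e \<epsilon> + k\<^sub>p b (\<theta> - \<theta>\<^sup>*)\<^sup>T \<omega>\<close>, \<open>e\<^sub>y = c\<^sup>T \<epsilon>\<close> exactly, where \<open>(A\<^sub>e, b, c)\<close> is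
  the observer form realization of \<open>W\<^sub>e'\<close>. The Kalman-Yakubovich-Popov lemma for \<open>W\<^sub>e'\<close> gives \<open>W\<close> with \<open>W b = c\<close>,
  so \<open>V = \<epsilon>\<^sup>T W \<epsilon> + |k\<^sub>p| |\<theta> - \<theta>\<^sup>*|\<^sup>2 / \<gamma>\<close> decreases at least at the rate \<open>\<kappa> e\<^sub>y\<^sup>2\<close>. Hence \<open>e\<^sub>y\<close> and \<open>\<theta>\<close> are
  bounded; then so are the model state, \<open>y\<close>, the second filter, the plant state (through the zero
  dynamics) and the first filter. These bounds do not depend on the length of the time interval, which
  yields global existence by truncating the vector field, and \<open>e\<^sub>y\<close> is square integrable and Lipschitz,
  hence tends to 0.\<close>


section \<open>Differential inequalities and linear systems on the half line\<close>

text \<open>Written out in full, the closed loop has order \<open>3 * n - 2\<close>, and modes that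
  cancel in its transfer function obstruct a direct use of the KYP lemma. Each block is therefore
  read in the coefficients of \<open>M(s) x\<close>, where the polynomial row \<open>M\<close>
  satisfies \<open>M(s) (s I - A) = d(s) c\<close>. There plant and filters are shifts with output
  injection, matching is a comparison of coefficients, and the filters have no coefficient of index
  \<open>n - 1\<close>, which makes the output error exact, initial states included. The KYP matrix
  is the inverse of an explicit one, the quotient by x + y of N(x) D(y) + D(x) N(y) minus a sum of
  squares from a spectral factorization. It is shown to be positive semidefinite by following its
  quadratic form along the adjoint flow; strictness of positive realness enters as a multiple of the
  identity among the squares. The control u is bounded late, since it contains the first filter,
  which u itself drives. Relative degree one breaks the circle: u enters the derivative of y with
  the constant factor \<open>kp\<close>, so that multiples of y eliminate u from the plant and
  filter equations.\<close>

lemma norm_increment_le: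
  fixes f :: "real \<Rightarrow> 'a::banach" and g :: "real \<Rightarrow> real"
  assumes fin: "finite S" and ab: "a \<le> b"
    and f: "continuous_on {a..b} f" "\<And>t. t \<in> {a<..<b} - S \<Longrightarrow> (f has_vector_derivative f' t) (at t)"
    and g: "continuous_on {a..b} g" "\<And>t. t \<in> {a<..<b} - S \<Longrightarrow> (g has_real_derivative g' t) (at t)"
    and le: "\<And>t. t \<in> {a<..<b} - S \<Longrightarrow> norm (f' t) \<le> g' t"
  shows "norm (f b - f a) \<le> g b - g a"
proof -
  \<comment> \<open>Extending by 0 to the finite exceptional set costs nothing in the integral, and
    the fundamental theorem of calculus then yields integrability without any continuity of
    \<open>f'\<close>.\<close>
  define f2 where "f2 t = (if t \<in> {a<..<b} - S then f' t else 0)" for t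
  define g2 where "g2 t = (if t \<in> {a<..<b} - S then g' t else 0)" for t
  have 1: "(f2 has_integral (f b - f a)) {a..b}"
    by (rule fundamental_theorem_of_calculus_interior_strong[OF fin ab _ f(1)]) (use f(2) in \<open>auto simp: f2_def\<close>)
  have 2: "(g2 has_integral (g b - g a)) {a..b}"
    by (rule fundamental_theorem_of_calculus_interior_strong[OF fin ab _ g(1)])
      (use g(2) in \<open>auto simp: g2_def has_real_derivative_iff_has_vector_derivative\<close>)
  have "norm (integral {a..b} f2) \<le> integral {a..b} g2"
    by (rule integral_norm_bound_integral) (use 1 2 le in \<open>auto simp: f2_def g2_def has_integral_integrable\<close>)
  then show ?thesis using 1 2 by (simp add: integral_unique)
qed

text \<open>The finite set \<open>S\<close> stands for the jumps of \<open>r\<close>, where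
  solutions need not be differentiable.\<close>

lemma increment_le:
  fixes f g :: "real \<Rightarrow> real"
  assumes fin: "finite S" and ab: "a \<le> b"
    and f: "continuous_on {a..b} f" "\<And>t. t \<in> {a<..<b} - S \<Longrightarrow> (f has_real_derivative f' t) (at t)"
    and g: "continuous_on {a..b} g" "\<And>t. t \<in> {a<..<b} - S \<Longrightarrow> (g has_real_derivative g' t) (at t)"
    and le: "\<And>t. t \<in> {a<..<b} - S \<Longrightarrow> f' t \<le> g' t"
  shows "f b - f a \<le> g b - g a"
proof -
  define f2 where "f2 t = (if t \<in> {a<..<b} - S then f' t else 0)" for t
  define g2 where "g2 t = (if t \<in> {a<..<b} - S then g' t else 0)" for t
  have 1: "(f2 has_integral (f b - f a)) {a..b}"
    by (rule fundamental_theorem_of_calculus_interior_strong[OF fin ab _ f(1)])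
      (use f(2) in \<open>auto simp: f2_def has_real_derivative_iff_has_vector_derivative\<close>)
  have 2: "(g2 has_integral (g b - g a)) {a..b}"
    by (rule fundamental_theorem_of_calculus_interior_strong[OF fin ab _ g(1)])
      (use g(2) in \<open>auto simp: g2_def has_real_derivative_iff_has_vector_derivative\<close>)
  show ?thesis
    by (rule has_integral_le[OF 1 2]) (use le in \<open>auto simp: f2_def g2_def\<close>)
qed

lemma integral_has_real_derivative_interior:
  fixes g :: "real \<Rightarrow> real"
  assumes "continuous_on {a..b} g" "t \<in> {a<..<b}"
  shows "((\<lambda>t. integral {a..t} g) has_real_derivative g t) (at t)"
proof -
  have "((\<lambda>t. integral {a..t} g) has_vector_derivative g t) (at t within {a..b})"
    using assms by (intro integral_has_vector_derivative) auto
  moreover have "at t within {a..b} = at t" using assms by (intro at_within_interior) auto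
  ultimately show ?thesis by (simp add: has_real_derivative_iff_has_vector_derivative)
qed

lemma increment_le_integral:
  fixes f g :: "real \<Rightarrow> real"
  assumes fin: "finite S" and ab: "a \<le> b"
    and f: "continuous_on {a..b} f" "\<And>t. t \<in> {a<..<b} - S \<Longrightarrow> (f has_real_derivative f' t) (at t)"
    and g: "continuous_on {a..b} g"
    and le: "\<And>t. t \<in> {a<..<b} - S \<Longrightarrow> f' t \<le> g t"
  shows "f b - f a \<le> integral {a..b} g"
proof -
  have "f b - f a \<le> integral {a..b} g - integral {a..a} g"
    by (rule increment_le[OF fin ab f, where g' = g])
      (use le in \<open>auto intro!: integral_has_real_derivative_interior[OF g] indefinite_integral_continuous_1 
        integrable_continuous_real g\<close>)
  then show ?thesis by simp
qed

text \<open>With the integrating factor \<open>exp (- l t)\<close> only the input \<open>h\<close>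
  drives \<open>w\<close>, at a rate of at most \<open>H * exp (\<rho> t)\<close>, whose primitive
  is \<open>H / \<rho> * exp (\<rho> t)\<close>. The resulting bound is free of
  \<open>T\<close>.\<close>

lemma scalar_ode_bound:
  fixes z h :: "real \<Rightarrow> complex"
  assumes fin: "finite S" and z: "continuous_on {0..T} z"
    "\<And>t. t \<in> {0<..<T} - S \<Longrightarrow> (z has_vector_derivative (l * z t + h t)) (at t)"
    and h: "\<And>t. t \<in> {0..T} \<Longrightarrow> norm (h t) \<le> H" and l: "Re l < 0" and t: "t \<in> {0..T}"
  shows "norm (z t) \<le> norm (z 0) + H / (- Re l)"
proof -
  define \<rho> where "\<rho> = - Re l"
  have \<rho>: "\<rho> > 0" using l by (simp add: \<rho>_def)
  have H: "H \<ge> 0" using order_trans[OF norm_ge_zero h[of t]] t by auto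
  define w where "w s = exp (- (of_real s * l)) * z s" for s
  have nexp: "norm (exp (- (complex_of_real s * l))) = exp (\<rho> * s)" for s
    by (simp add: \<rho>_def mult.commute)
  have wd: "(w has_vector_derivative exp (- (of_real s * l)) * h s) (at s)" if "s \<in> {0<..<t} - S" for s
  proof -
    have "((\<lambda>s. exp (- (of_real s * l))) has_vector_derivative - l * exp (- (of_real s * l))) (at s)"
    proof -
      have "((\<lambda>s. exp (- (s * l))) has_field_derivative - l * exp (- (of_real s * l))) (at (of_real s))"
        by (auto intro!: derivative_eq_intros)
      from has_vector_derivative_real_field[OF this] show ?thesis .
    qed
    moreover have "(z has_vector_derivative (l * z s + h s)) (at s)"
      using that t by (intro z(2)) auto
    ultimately show ?thesis unfolding w_def
      by (auto intro!: derivative_eq_intros simp: algebra_simps)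
  qed
  have "norm (w t - w 0) \<le> H / \<rho> * exp (\<rho> * t) - H / \<rho> * exp (\<rho> * 0)"
  proof (rule norm_increment_le[OF fin])
    show "0 \<le> t" using t by simp
    show "continuous_on {0..t} w" unfolding w_def using t
      by (intro continuous_intros continuous_on_subset[OF z(1)]) auto
    show "(w has_vector_derivative exp (- (of_real s * l)) * h s) (at s)" if "s \<in> {0<..<t} - S" for s
      using wd that .
    show "continuous_on {0..t} (\<lambda>t. H / \<rho> * exp (\<rho> * t))" by (intro continuous_intros)
    show "((\<lambda>t. H / \<rho> * exp (\<rho> * t)) has_real_derivative H * exp (\<rho> * s)) (at s)" for s
      using \<rho> by (auto intro!: derivative_eq_intros)
    show "norm (exp (- (of_real s * l)) * h s) \<le> H * exp (\<rho> * s)" if "s \<in> {0<..<t} - S" for s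
      unfolding norm_mult nexp using h[of s] that t by (simp add: mult.commute)
  qed
  also have "\<dots> \<le> H / \<rho> * exp (\<rho> * t)" using H \<rho> by simp
  finally have "norm (w t) \<le> norm (w 0) + H / \<rho> * exp (\<rho> * t)"
    using norm_triangle_sub[of "w t" "w 0"] by linarith
  also have "\<dots> \<le> (norm (z 0) + H / \<rho>) * exp (\<rho> * t)"
  proof -
    have "1 \<le> exp (\<rho> * t)" using \<rho> t by simp
    then have "norm (z 0) * 1 \<le> norm (z 0) * exp (\<rho> * t)" by (intro mult_left_mono) auto
    then show ?thesis by (simp add: w_def algebra_simps)
  qed
  finally have "norm (z t) * exp (\<rho> * t) \<le> (norm (z 0) + H / \<rho>) * exp (\<rho> * t)"
    unfolding w_def norm_mult nexp by (simp add: mult.commute)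
  then show ?thesis by (simp add: \<rho>_def)
qed

text \<open>Barbalat's lemma in quantitative form. After time t the function needs a time of at
  least \<open>|f t| / (2 L')\<close> to fall to half its size, so the square integral
  \<open>F\<close> still has to grow by at least \<open>|f t|^3 / (8 L')\<close>; but the growth
  left, \<open>M - F t\<close>, tends to 0.\<close>

lemma lipschitz_square_integrable_tendsto_0:
  fixes f :: "real \<Rightarrow> real"
  assumes cont: "continuous_on {0..} f"
    and lip: "\<And>s t. 0 \<le> s \<Longrightarrow> s \<le> t \<Longrightarrow> \<bar>f t - f s\<bar> \<le> L * (t - s)"
    and int: "\<And>T. 0 \<le> T \<Longrightarrow> integral {0..T} (\<lambda>t. (f t)\<^sup>2) \<le> C"
  shows "(f \<longlongrightarrow> 0) at_top"
proof -
  \<comment> \<open>A positive Lipschitz constant: \<open>L'\<close> occurs as a divisor in the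
    window length \<open>h\<close>.\<close>
  define L' where "L' = max L 1"
  have L': "L' > 0" "\<And>s t. 0 \<le> s \<Longrightarrow> s \<le> t \<Longrightarrow> \<bar>f t - f s\<bar> \<le> L' * (t - s)"
  proof -
    show "L' > 0" by (simp add: L'_def)
    show "\<bar>f t - f s\<bar> \<le> L' * (t - s)" if "0 \<le> s" "s \<le> t" for s t
      using lip[OF that] mult_right_mono[of L L' "t - s"] that by (simp add: L'_def)
  qed
  define F where "F T = integral {0..T} (\<lambda>t. (f t)\<^sup>2)" for T
  have ii: "(\<lambda>t. (f t)\<^sup>2) integrable_on {a..b}" if "0 \<le> a" for a b
    using that by (intro integrable_continuous_real continuous_intros continuous_on_subset[OF cont]) auto
  have Fadd: "F b - F a = integral {a..b} (\<lambda>t. (f t)\<^sup>2)" if "0 \<le> a" "a \<le> b" for a b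
    unfolding F_def using Henstock_Kurzweil_Integration.integral_combine[OF that ii[of 0]] by simp
  have mono: "F a \<le> F b" if "0 \<le> a" "a \<le> b" for a b
    using Fadd[OF that] integral_nonneg[OF ii[OF that(1)], of b] by simp
  have bdd: "bdd_above (F ` {0..})" using int by (intro bdd_aboveI[of _ C]) (auto simp: F_def)
  define M where "M = (SUP T\<in>{0..}. F T)"
  have FM: "F T \<le> M" if "0 \<le> T" for T unfolding M_def using that by (intro cSUP_upper bdd) auto
  have lim: "(F \<longlongrightarrow> M) at_top"
  proof (rule increasing_tendsto)
    show "eventually (\<lambda>T. F T \<le> M) at_top" using eventually_ge_at_top[of 0] by eventually_elim (rule FM)
    fix x assume "x < M"
    then obtain T where T: "T \<ge> 0" "x < F T" unfolding M_def using less_cSUP_iff[OF _ bdd] by auto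
    show "eventually (\<lambda>T. x < F T) at_top"
      using eventually_ge_at_top[of T] by eventually_elim (use T mono in \<open>force\<close>)
  qed
  have key: "\<bar>f t\<bar> ^ 3 \<le> 8 * L' * (M - F t)" if t: "t \<ge> 0" for t
  proof -
    define h where "h = \<bar>f t\<bar> / (2 * L')"
    have h: "h \<ge> 0" using L' by (simp add: h_def)
    have "(\<bar>f t\<bar> / 2)\<^sup>2 \<le> (f s)\<^sup>2" if "s \<in> {t..t+h}" for s
    proof -
      have "\<bar>f s - f t\<bar> \<le> L' * (s - t)" using L'(2)[of t s] that t by auto
      also have "\<dots> \<le> L' * h" using that L'(1) by (intro mult_left_mono) auto
      finally have "\<bar>f s - f t\<bar> \<le> L' * h" .
      moreover have "L' * h = \<bar>f t\<bar> / 2" using L' by (simp add: h_def)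
      ultimately have "\<bar>f t\<bar> / 2 \<le> \<bar>f s\<bar>" by linarith
      then show ?thesis by (metis abs_ge_zero power2_abs power_mono divide_nonneg_nonneg zero_le_numeral)
    qed
    then have "integral {t..t+h} (\<lambda>_. (\<bar>f t\<bar> / 2)\<^sup>2) \<le> integral {t..t+h} (\<lambda>t. (f t)\<^sup>2)"
      by (intro integral_le ii t) auto
    then have "h * (\<bar>f t\<bar> / 2)\<^sup>2 \<le> F (t + h) - F t" using Fadd[of t "t + h"] t h by simp
    also have "\<dots> \<le> M - F t" using FM[of "t + h"] t h by simp
    finally show ?thesis using L'(1) by (simp add: h_def field_simps power2_eq_square power3_eq_cube)
  qed
  have "((\<lambda>t. \<bar>f t\<bar> ^ 3) \<longlongrightarrow> 0) at_top"
  proof (rule tendsto_sandwich[OF _ _ tendsto_const])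
    show "eventually (\<lambda>t. 0 \<le> \<bar>f t\<bar> ^ 3) at_top" by simp
    show "eventually (\<lambda>t. \<bar>f t\<bar> ^ 3 \<le> 8 * L' * (M - F t)) at_top"
      using eventually_ge_at_top[of 0] by eventually_elim (rule key)
    show "((\<lambda>t. 8 * L' * (M - F t)) \<longlongrightarrow> 0) at_top"
      by (rule tendsto_eq_intros lim refl | simp)+
  qed
  then have "((\<lambda>t. root 3 (\<bar>f t\<bar> ^ 3)) \<longlongrightarrow> root 3 0) at_top" by (rule tendsto_real_root)
  then have "((\<lambda>t. \<bar>f t\<bar>) \<longlongrightarrow> 0) at_top" by (simp add: real_root_power_cancel)
  then show ?thesis by (simp add: tendsto_rabs_zero_iff)
qed

section \<open>Global solutions of Lipschitz systems with a piecewise continuous right hand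
  side\<close>

lemma integrable_bounded_finite_discontinuities:
  fixes f :: "real \<Rightarrow> real"
  assumes fin: "finite S" and cont: "continuous_on ({a..b} - S) f" and B: "\<And>t. t \<in> {a..b} \<Longrightarrow> \<bar>f t\<bar> \<le> B"
  shows "f integrable_on {a..b}"
proof -
  let ?A = "{a..b} - S"
  have A: "?A \<in> sets lebesgue" using fin by (intro sets.Diff) (auto simp: negligible_finite negligible_imp_sets)
  have "f integrable_on ?A"
  proof (rule measurable_bounded_by_integrable_imp_integrable)
    show "f \<in> borel_measurable (lebesgue_on ?A)"
      by (rule continuous_imp_measurable_on_sets_lebesgue[OF cont A])
    have "(\<lambda>_. B) integrable_on {a..b}" by auto
    then show "(\<lambda>_. B) integrable_on ?A"
      by (rule integrable_spike_set) (auto intro!: negligible_subset[OF negligible_finite[OF fin]])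
    show "\<And>x. x \<in> ?A \<Longrightarrow> norm (f x) \<le> B" using B by auto
  qed (rule A)
  then show ?thesis
    by (rule integrable_spike_set) (auto intro!: negligible_subset[OF negligible_finite[OF fin]])
qed

lemma at_within_atLeast_eq:
  fixes t :: real
  assumes "0 \<le> t" "t < T"
  shows "at t within {0..} = at t within {0..T}"
proof (rule at_within_nhd[of t "{..<T}"])
  show "{0..} \<inter> {..<T} - {t} = {0..T} \<inter> {..<T} - {t}" by auto
qed (use assms in auto)

lemma continuous_on_atLeastI:
  fixes f :: "real \<Rightarrow> 'a::topological_space"
  assumes "\<And>T. T \<ge> 0 \<Longrightarrow> continuous_on {0..T} f"
  shows "continuous_on {0..} f"
  unfolding continuous_on_eq_continuous_within
proof
  fix t :: real assume t: "t \<in> {0..}"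
  have "continuous (at t within {0..t+1}) f"
    using assms[of "t+1"] t by (auto simp: continuous_on_eq_continuous_within)
  then show "continuous (at t within {0..}) f"
    using at_within_atLeast_eq[of t "t+1"] t by simp
qed

text \<open>The right hand side is only required to be continuous along continuous curves and off
  \<open>E\<close>, which admits the jumps of \<open>r\<close>. The differences of the Picard
  iterates are measured against the weight \<open>exp (\<kappa> t)\<close>; in this weight each
  iteration gains the factor 1/2 on the whole half line at once, so no continuation of local
  solutions occurs.\<close>

theorem picard_lindeloef_global:
  fixes f :: "real \<Rightarrow> ('i \<Rightarrow> real) \<Rightarrow> 'i \<Rightarrow> real"
  assumes fin: "finite I" and L: "0 \<le> L"
    and lip: "\<And>t x y i. t \<ge> 0 \<Longrightarrow> i \<in> I \<Longrightarrow> \<bar>f t x i - f t y i\<bar> \<le> L * (\<Sum>j\<in>I. \<bar>x j - y j\<bar>)"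
    and bdd: "\<And>t i. t \<ge> 0 \<Longrightarrow> i \<in> I \<Longrightarrow> \<bar>f t x0 i\<bar> \<le> B"
    and E: "\<And>T. finite (E \<inter> {0..T})"
    and cont: "\<And>X i t. (\<And>j. j \<in> I \<Longrightarrow> continuous_on {0..} (\<lambda>t. X t j)) \<Longrightarrow> i \<in> I \<Longrightarrow> t \<ge> 0 \<Longrightarrow> t \<notin> E \<Longrightarrow>
        continuous (at t within {0..}) (\<lambda>t. f t (X t) i)"
  obtains X where "\<And>i. i \<in> I \<Longrightarrow> X 0 i = x0 i"
    and "\<And>i. i \<in> I \<Longrightarrow> continuous_on {0..} (\<lambda>t. X t i)"
    and "\<And>t i. t \<ge> 0 \<Longrightarrow> t \<notin> E \<Longrightarrow> i \<in> I \<Longrightarrow>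
        ((\<lambda>t. X t i) has_real_derivative f t (X t) i) (at t within {0..})"
proof -
  define N where "N = real (card I)"
  have N: "N \<ge> 0" by (simp add: N_def)
  \<comment> \<open>The integral of \<open>exp (\<kappa> s)\<close> over \<open>{0..t}\<close> is at
    most \<open>exp (\<kappa> t) / \<kappa>\<close>, so an iteration multiplies the weighted
    difference by \<open>N * L / \<kappa>\<close>; this choice makes that at most 1/2, and the
    summand 1 keeps \<kappa> positive when \<open>N * L\<close> is 0.\<close>
  define \<kappa> where "\<kappa> = 2 * N * L + 1"
  have \<kappa>: "\<kappa> > 0" using N L by (simp add: \<kappa>_def add_nonneg_pos)
  define B' where "B' = max B 0"
  have B': "B' \<ge> 0" "\<And>t i. t \<ge> 0 \<Longrightarrow> i \<in> I \<Longrightarrow> \<bar>f t x0 i\<bar> \<le> B'" using bdd by (force simp: B'_def)+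
  let ?cont = "\<lambda>X. \<forall>j\<in>I. continuous_on {0..} (\<lambda>t. X t j)"
  have int: "(\<lambda>s. f s (X s) i) integrable_on {0..T}" if X: "?cont X" and i: "i \<in> I" for X T i
  proof -
    \<comment> \<open>\<open>lip\<close> and \<open>B'\<close> together bound the right hand side
      along \<open>X\<close> by this continuous function, hence by a constant on
      \<open>{0..T}\<close>.\<close>
    have "continuous_on {0..T} (\<lambda>s. B' + L * (\<Sum>j\<in>I. \<bar>X s j - x0 j\<bar>))"
      by (intro continuous_intros) (use X continuous_on_subset in \<open>force\<close>)
    then have "bounded ((\<lambda>s. B' + L * (\<Sum>j\<in>I. \<bar>X s j - x0 j\<bar>)) ` {0..T})"
      by (intro compact_imp_bounded compact_continuous_image) auto
    then obtain C where C: "\<forall>s\<in>{0..T}. \<bar>B' + L * (\<Sum>j\<in>I. \<bar>X s j - x0 j\<bar>)\<bar> \<le> C"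
      by (auto simp: bounded_iff)
    show ?thesis
    proof (rule integrable_bounded_finite_discontinuities[OF E[of T], where B = C])
      show "continuous_on ({0..T} - E \<inter> {0..T}) (\<lambda>s. f s (X s) i)"
        unfolding continuous_on_eq_continuous_within
      proof
        fix t assume t: "t \<in> {0..T} - E \<inter> {0..T}"
        have "continuous (at t within {0..}) (\<lambda>s. f s (X s) i)" using X i t by (intro cont) auto
        then show "continuous (at t within {0..T} - E \<inter> {0..T}) (\<lambda>s. f s (X s) i)"
          by (rule continuous_within_subset) auto
      qed
      show "\<bar>f t (X t) i\<bar> \<le> C" if "t \<in> {0..T}" for t
        using lip[of t i "X t" x0] B'(2)[of t i] bspec[OF C that] that i by auto
    qed
  qed
  define Y where "Y = rec_nat (\<lambda>t. x0) (\<lambda>k Yk t i. x0 i + integral {0..t} (\<lambda>s. f s (Yk s) i))"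
  have Y0: "Y 0 t i = x0 i" and YS: "Y (Suc k) t i = x0 i + integral {0..t} (\<lambda>s. f s (Y k s) i)" for k t i
    by (simp_all add: Y_def)
  have Y00: "Y 0 t = x0" for t by (simp add: Y_def)
  have Yc: "?cont (Y k)" for k
  proof (induction k)
    case 0 show ?case by (simp add: Y0)
  next
    case (Suc k)
    show ?case unfolding YS
      by (intro ballI continuous_on_atLeastI continuous_intros indefinite_integral_continuous_1 int[OF Suc])
  qed
  define D where "D k t = (\<Sum>i\<in>I. \<bar>Y (Suc k) t i - Y k t i\<bar>)" for k t
  define C where "C = N * B' / \<kappa>"
  have C: "C \<ge> 0" using N B' \<kappa> by (simp add: C_def)
  have intexp: "integral {0..t} (\<lambda>s. exp (\<kappa> * s)) \<le> exp (\<kappa> * t) / \<kappa>" if "t \<ge> 0" for t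
  proof -
    have "((\<lambda>s. exp (\<kappa> * s)) has_integral (exp (\<kappa> * t) / \<kappa> - exp (\<kappa> * 0) / \<kappa>)) {0..t}"
      using \<kappa> that by (intro fundamental_theorem_of_calculus)
        (auto intro!: derivative_eq_intros simp: has_real_derivative_iff_has_vector_derivative[symmetric])
    then show ?thesis using \<kappa> by (simp add: integral_unique)
  qed
  have D: "D k t \<le> C * (1/2)^k * exp (\<kappa> * t)" if "t \<ge> 0" for k t
    using that
  proof (induction k arbitrary: t)
    case 0
    have "\<bar>Y (Suc 0) t i - Y 0 t i\<bar> \<le> B' / \<kappa> * exp (\<kappa> * t)" if i: "i \<in> I" for i
    proof -
      have "\<bar>integral {0..t} (\<lambda>s. f s x0 i)\<bar> \<le> integral {0..t} (\<lambda>s. B')"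
        using int[of "\<lambda>_. x0" i t] i B'(2)
        by (intro integral_norm_bound_integral[where 'a = real, simplified]) auto
      also have "\<dots> = B' * t" using 0 by simp
      also have "\<dots> \<le> B' * (exp (\<kappa> * t) / \<kappa>)"
      proof (intro mult_left_mono B')
        have "\<kappa> * t \<le> exp (\<kappa> * t)" using exp_ge_add_one_self[of "\<kappa> * t"] by linarith
        then show "t \<le> exp (\<kappa> * t) / \<kappa>" using \<kappa> by (simp add: field_simps)
      qed
      finally show ?thesis by (simp add: YS Y00)
    qed
    then have "D 0 t \<le> (\<Sum>i\<in>I. B' / \<kappa> * exp (\<kappa> * t))" unfolding D_def by (intro sum_mono) auto
    then show ?case by (simp add: C_def N_def)
  next
    case (Suc k)
    let ?c = "C * (1/2)^k"
    have c: "?c \<ge> 0" using C by simp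
    have "\<bar>Y (Suc (Suc k)) t i - Y (Suc k) t i\<bar> \<le> L * (?c * (exp (\<kappa> * t) / \<kappa>))" if i: "i \<in> I" for i
    proof -
      have "Y (Suc (Suc k)) t i - Y (Suc k) t i = integral {0..t} (\<lambda>s. f s (Y (Suc k) s) i - f s (Y k s) i)"
        unfolding YS[of "Suc k"] YS[of k t] using int[OF Yc i] by (simp add: Henstock_Kurzweil_Integration.integral_diff)
      also have "\<bar>\<dots>\<bar> \<le> integral {0..t} (\<lambda>s. L * (?c * exp (\<kappa> * s)))"
      proof (rule integral_norm_bound_integral[where 'a = real, simplified])
        show "(\<lambda>s. f s (Y (Suc k) s) i - f s (Y k s) i) integrable_on {0..t}"
          by (intro Henstock_Kurzweil_Integration.integrable_diff int[OF Yc i])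
        show "(\<lambda>s. L * (?c * exp (\<kappa> * s))) integrable_on {0..t}"
          by (intro integrable_continuous_real continuous_intros)
        fix s assume s: "s \<in> {0..t}"
        have "\<bar>f s (Y (Suc k) s) i - f s (Y k s) i\<bar> \<le> L * D k s"
          unfolding D_def using s i by (intro lip) auto
        also have "\<dots> \<le> L * (?c * exp (\<kappa> * s))" using Suc.IH[of s] s L by (intro mult_left_mono) auto
        finally show "\<bar>f s (Y (Suc k) s) i - f s (Y k s) i\<bar> \<le> L * (?c * exp (\<kappa> * s))" .
      qed
      also have "\<dots> = L * (?c * integral {0..t} (\<lambda>s. exp (\<kappa> * s)))" by simp
      also have "\<dots> \<le> L * (?c * (exp (\<kappa> * t) / \<kappa>))"
        using intexp[OF Suc.prems] L c by (intro mult_left_mono) auto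
      finally show ?thesis .
    qed
    then have "D (Suc k) t \<le> (\<Sum>i\<in>I. L * (?c * (exp (\<kappa> * t) / \<kappa>)))" unfolding D_def by (intro sum_mono) auto
    also have "\<dots> = (N * L / \<kappa>) * (?c * exp (\<kappa> * t))" by (simp add: N_def)
    also have "\<dots> \<le> (1/2) * (?c * exp (\<kappa> * t))"
    proof (rule mult_right_mono)
      show "N * L / \<kappa> \<le> 1/2" using \<kappa> by (simp add: \<kappa>_def field_simps)
    qed (use c in simp)
    finally show ?case by simp
  qed
  define X where "X t i = x0 i + (\<Sum>k. Y (Suc k) t i - Y k t i)" for t i
  have Ysum: "Y n t i = x0 i + (\<Sum>k<n. Y (Suc k) t i - Y k t i)" for n t i
    by (induction n) (simp_all add: Y0)
  have unif: "uniform_limit {0..T} (\<lambda>n t. Y n t i) (\<lambda>t. X t i) sequentially" if i: "i \<in> I" for i T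
  proof -
    have "uniform_limit {0..T} (\<lambda>n t. \<Sum>k<n. Y (Suc k) t i - Y k t i) (\<lambda>t. \<Sum>k. Y (Suc k) t i - Y k t i) sequentially"
    proof (rule Weierstrass_m_test)
      show "summable (\<lambda>k. C * (1/2)^k * exp (\<kappa> * T))"
        by (intro summable_mult summable_mult2 summable_geometric) auto
      fix k t assume t: "t \<in> {0..T}"
      have "\<bar>Y (Suc k) t i - Y k t i\<bar> \<le> D k t"
        unfolding D_def by (rule member_le_sum[OF i _ fin]) auto
      also have "\<dots> \<le> C * (1/2)^k * exp (\<kappa> * t)" using D t by auto
      also have "\<dots> \<le> C * (1/2)^k * exp (\<kappa> * T)" using t \<kappa> C by (intro mult_left_mono) auto
      finally show "norm (Y (Suc k) t i - Y k t i) \<le> C * (1/2)^k * exp (\<kappa> * T)" by simp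
    qed
    from uniform_limit_add[OF uniform_limit_const this, of "\<lambda>_. x0 i"]
    have "uniform_limit {0..T} (\<lambda>n t. x0 i + (\<Sum>k<n. Y (Suc k) t i - Y k t i)) (\<lambda>t. X t i) sequentially"
      unfolding X_def .
    moreover have "(\<lambda>n t. x0 i + (\<Sum>k<n. Y (Suc k) t i - Y k t i)) = (\<lambda>n t. Y n t i)"
      by (intro ext) (rule Ysum[symmetric])
    ultimately show ?thesis by simp
  qed
  have Xc: "?cont X"
  proof (intro ballI continuous_on_atLeastI)
    fix i T assume i: "i \<in> I"
    show "continuous_on {0..T} (\<lambda>t. X t i)"
    proof (rule uniform_limit_theorem[OF _ unif[OF i]])
      have "continuous_on {0..T} (\<lambda>t. Y n t i)" for n
        by (rule continuous_on_subset[OF bspec[OF Yc i]]) auto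
      then show "\<forall>\<^sub>F n in sequentially. continuous_on {0..T} (\<lambda>t. Y n t i)" by simp
    qed simp
  qed
  have fix_eq: "X t i = x0 i + integral {0..t} (\<lambda>s. f s (X s) i)" if t: "t \<ge> 0" and i: "i \<in> I" for t i
  proof (rule LIMSEQ_unique)
    show "(\<lambda>n. Y (Suc n) t i) \<longlonglongrightarrow> X t i"
      using LIMSEQ_Suc[OF tendsto_uniform_limitI[OF unif[OF i, of t], of t]] t by auto
    show "(\<lambda>n. Y (Suc n) t i) \<longlonglongrightarrow> x0 i + integral {0..t} (\<lambda>s. f s (X s) i)"
    proof (rule metric_LIMSEQ_I)
      fix e :: real assume e: "e > 0"
      \<comment> \<open>Closeness of the iterates within \<open>e'\<close> on \<open>{0..t}\<close>
        changes the integral by at most \<open>L * N * t * e'\<close>; the summand 1 avoids a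
        division by 0 and the factor 2 leaves room for the strict inequality.\<close>
      define e' where "e' = e / (2 * (L * (N * t) + 1))"
      have pos: "L * (N * t) + 1 > 0" using L N t by (simp add: add_nonneg_pos)
      have e': "e' > 0" using e pos by (simp add: e'_def)
      have "\<forall>\<^sub>F n in sequentially. \<forall>j\<in>I. \<forall>s\<in>{0..t}. dist (Y n s j) (X s j) < e'"
        using fin uniform_limitD[OF unif e', of _ t] by (simp add: eventually_ball_finite_distrib)
      then obtain n0 where n0: "\<forall>n\<ge>n0. \<forall>j\<in>I. \<forall>s\<in>{0..t}. \<bar>Y n s j - X s j\<bar> < e'"
        by (auto simp: eventually_sequentially dist_real_def)
      show "\<exists>n0. \<forall>n\<ge>n0. dist (Y (Suc n) t i) (x0 i + integral {0..t} (\<lambda>s. f s (X s) i)) < e"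
      proof (intro exI allI impI)
        fix n assume n: "n \<ge> n0"
        have "\<bar>Y (Suc n) t i - (x0 i + integral {0..t} (\<lambda>s. f s (X s) i))\<bar>
            = \<bar>integral {0..t} (\<lambda>s. f s (Y n s) i - f s (X s) i)\<bar>"
          unfolding YS using int[OF Yc i] int[OF Xc i] by (simp add: Henstock_Kurzweil_Integration.integral_diff)
        also have "\<dots> \<le> integral {0..t} (\<lambda>s. L * (N * e'))"
        proof (rule integral_norm_bound_integral[where 'a = real, simplified])
          show "(\<lambda>s. f s (Y n s) i - f s (X s) i) integrable_on {0..t}"
            by (intro Henstock_Kurzweil_Integration.integrable_diff int[OF Yc i] int[OF Xc i])
          fix s assume s: "s \<in> {0..t}"
          have "\<bar>f s (Y n s) i - f s (X s) i\<bar> \<le> L * (\<Sum>j\<in>I. \<bar>Y n s j - X s j\<bar>)"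
            using s i by (intro lip) auto
          also have "\<dots> \<le> L * (\<Sum>j\<in>I. e')"
            using n0 n s by (intro mult_left_mono[OF _ L] sum_mono less_imp_le) auto
          finally show "\<bar>f s (Y n s) i - f s (X s) i\<bar> \<le> L * (N * e')" by (simp add: N_def)
        qed auto
        also have "\<dots> = (L * (N * t)) * e'" using t by simp
        also have "\<dots> \<le> (L * (N * t) + 1) * e'" using e' by (intro mult_right_mono) auto
        also have "\<dots> = e / 2"
        proof -
          have "c * (e / (2 * c)) = e / 2" if "c > 0" for c :: real using that by simp
          from this[OF pos] show ?thesis by (simp only: e'_def)
        qed
        finally show "dist (Y (Suc n) t i) (x0 i + integral {0..t} (\<lambda>s. f s (X s) i)) < e"
          using e by (simp add: dist_real_def)
      qed
    qed
  qed
  show thesis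
  proof (rule that)
    show "X 0 i = x0 i" if "i \<in> I" for i using fix_eq[of 0 i] that by simp
    show "continuous_on {0..} (\<lambda>t. X t i)" if "i \<in> I" for i using Xc that by auto
    fix t i assume t: "t \<ge> 0" "t \<notin> E" and i: "i \<in> I"
    have ct: "continuous (at t within {0..t+1}) (\<lambda>s. f s (X s) i)"
      using cont[of X i t] Xc i t at_within_atLeast_eq[of t "t+1"] by auto
    have "((\<lambda>u. integral {0..u} (\<lambda>s. f s (X s) i)) has_vector_derivative f t (X t) i) (at t within {0..t+1} - {})"
      by (rule integral_has_vector_derivative_continuous_at) (use t ct int[OF Xc i] in auto)
    then have d: "((\<lambda>u. x0 i + integral {0..u} (\<lambda>s. f s (X s) i)) has_real_derivative f t (X t) i) (at t within {0..t+1})"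
      by (auto intro!: derivative_eq_intros simp: has_real_derivative_iff_has_vector_derivative[symmetric])
    have "((\<lambda>u. X u i) has_real_derivative f t (X t) i) (at t within {0..t+1})"
      by (rule has_field_derivative_transform_within[OF d, of 1]) (use t i fix_eq in auto)
    then show "((\<lambda>t. X t i) has_real_derivative f t (X t) i) (at t within {0..})"
      using at_within_atLeast_eq[of t "t+1"] t by simp
  qed
qed

section \<open>Bounded states of Hurwitz systems under bounded inputs\<close>

definition linear_traj ::
  "(nat \<Rightarrow> nat \<Rightarrow> 'a::real_normed_field) \<Rightarrow> nat \<Rightarrow> real \<Rightarrow> real \<Rightarrow> (real \<Rightarrow> nat \<Rightarrow> 'a) \<Rightarrow> (real \<Rightarrow> nat \<Rightarrow> 'a) \<Rightarrow> bool" where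
  "linear_traj B k T M x g \<longleftrightarrow>
     (\<exists>S. finite S \<and> (\<forall>t\<in>{0<..<T} - S. \<forall>i<k.
        ((\<lambda>t. x t i) has_vector_derivative (\<Sum>j<k. B i j * x t j) + g t i) (at t))) \<and>
     (\<forall>i<k. continuous_on {0..T} (\<lambda>t. x t i)) \<and>
     (\<forall>i<k. norm (x 0 i) \<le> M) \<and> (\<forall>t\<in>{0..T}. \<forall>i<k. norm (g t i) \<le> M)"

lemma linear_traj_derivative:
  assumes "linear_traj B k T M x g"
  obtains S where "finite S" "\<And>t i. t \<in> {0<..<T} - S \<Longrightarrow> i < k \<Longrightarrow>
    ((\<lambda>t. x t i) has_vector_derivative (\<Sum>j<k. B i j * x t j) + g t i) (at t)"
proof -
  from assms have "\<exists>S. finite S \<and> (\<forall>t\<in>{0<..<T} - S. \<forall>i<k.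
        ((\<lambda>t. x t i) has_vector_derivative (\<Sum>j<k. B i j * x t j) + g t i) (at t))"
    unfolding linear_traj_def by (rule conjunct1)
  then obtain S where S: "finite S \<and> (\<forall>t\<in>{0<..<T} - S. \<forall>i<k.
        ((\<lambda>t. x t i) has_vector_derivative (\<Sum>j<k. B i j * x t j) + g t i) (at t))" by (rule exE)
  show thesis by (rule that[of S]) (use S in auto)
qed

text \<open>Induction on the number \<open>d\<close> of rows bounded so far, counted from the
  bottom: row i of an upper triangular system involves only its own state and the later ones, which
  join \<open>g\<close> as a bounded input of a scalar equation. One constant \<open>M\<close>
  bounds initial values and input alike, so that all estimates are linear in \<open>M\<close> and
  \<open>K\<close> depends on the matrix only.\<close>

lemma triangular_traj_bound:
  fixes B :: "nat \<Rightarrow> nat \<Rightarrow> complex"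
  assumes tri: "\<And>i j. i < k \<Longrightarrow> j < i \<Longrightarrow> B i j = 0" and diag: "\<And>i. i < k \<Longrightarrow> Re (B i i) < 0" and "d \<le> k"
  shows "\<exists>K\<ge>0. \<forall>T M x g. linear_traj B k T M x g \<longrightarrow> (\<forall>t\<in>{0..T}. \<forall>i\<in>{k-d..<k}. norm (x t i) \<le> K * M)"
  using \<open>d \<le> k\<close>
proof (induction d)
  case 0
  show ?case by (intro exI[of _ 0]) auto
next
  case (Suc d)
  then obtain K where K: "K \<ge> 0" and IH: "\<And>T M x g t i. linear_traj B k T M x g \<Longrightarrow> t \<in> {0..T} \<Longrightarrow> i \<in> {k-d..<k} \<Longrightarrow>
      norm (x t i) \<le> K * M" by fastforce
  define i where "i = k - Suc d"
  have i: "i < k" "k - d = Suc i" using Suc.prems by (auto simp: i_def)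
  \<comment> \<open>Input of row \<open>i\<close> per unit of \<open>M\<close>: the later states are
    at most \<open>K * M\<close> each, and the summand 1 accounts for \<open>g\<close>.\<close>
  define R where "R = (\<Sum>j\<in>{i<..<k}. norm (B i j)) * K + 1"
  have R: "R \<ge> 0" unfolding R_def using K by (intro add_nonneg_nonneg mult_nonneg_nonneg sum_nonneg) auto
  define K' where "K' = max K (1 + R / (- Re (B i i)))"
  have K': "K' \<ge> K" "K' \<ge> 1 + R / (- Re (B i i))" "K' \<ge> 0" using K by (auto simp: K'_def)
  show ?case
  proof (intro exI conjI allI impI ballI)
    show "K' \<ge> 0" by fact
    fix T M x g t l
    assume tr: "linear_traj B k T M x g" and t: "t \<in> {0..T}" and l: "l \<in> {k - Suc d..<k}"
    have "norm (g t i) \<le> M" using tr t i by (auto simp: linear_traj_def)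
    then have M: "M \<ge> 0" by (rule order_trans[OF norm_ge_zero])
    show "norm (x t l) \<le> K' * M"
    proof (cases "l = i")
      case False
      then have "l \<in> {k-d..<k}" using l i by (auto simp: i_def)
      from IH[OF tr t this] show ?thesis using mult_right_mono[OF K'(1) M] by linarith
    next
      case True
      define h where "h s = (\<Sum>j\<in>{i<..<k}. B i j * x s j) + g s i" for s
      obtain S where S: "finite S" "\<And>s. s \<in> {0<..<T} - S \<Longrightarrow>
          ((\<lambda>t. x t i) has_vector_derivative (\<Sum>j<k. B i j * x s j) + g s i) (at s)"
        using linear_traj_derivative[OF tr] i by metis
      have sp: "{..<k} = {..<i} \<union> insert i {i<..<k}" using i by auto
      have split: "(\<Sum>j<k. B i j * x s j) = B i i * x s i + (\<Sum>j\<in>{i<..<k}. B i j * x s j)" for s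
        unfolding sp by (subst sum.union_disjoint) (use tri[OF i(1)] in auto)
      have "norm (x t i) \<le> norm (x 0 i) + R * M / (- Re (B i i))"
      proof (rule scalar_ode_bound[OF S(1), where h = h])
        show "continuous_on {0..T} (\<lambda>t. x t i)" using tr i by (auto simp: linear_traj_def)
        show "((\<lambda>t. x t i) has_vector_derivative B i i * x s i + h s) (at s)" if "s \<in> {0<..<T} - S" for s
          using S(2)[OF that] unfolding split h_def by (simp add: add.assoc)
        show "norm (h s) \<le> R * M" if s: "s \<in> {0..T}" for s
        proof -
          have "norm (h s) \<le> (\<Sum>j\<in>{i<..<k}. norm (B i j) * (K * M)) + M"
            unfolding h_def using tr s i IH[OF tr s]
            by (intro norm_triangle_mono sum_norm_le) (auto simp: linear_traj_def norm_mult intro!: mult_left_mono)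
          also have "\<dots> = R * M" by (simp add: R_def sum_distrib_right sum_distrib_left algebra_simps)
          finally show ?thesis .
        qed
      qed (use diag i t in auto)
      also have "\<dots> \<le> M + R * M / (- Re (B i i))" using tr i by (auto simp: linear_traj_def)
      also have "\<dots> = (1 + R / (- Re (B i i))) * M" by (simp add: algebra_simps)
      also have "\<dots> \<le> K' * M" using K' M by (intro mult_right_mono) auto
      finally show ?thesis using True by simp
    qed
  qed
qed

text \<open>A complex Schur decomposition \<open>A = P B Q\<close>, with \<open>Q\<close> the
  inverse of \<open>P\<close>, makes \<open>z = Q x\<close> a solution of a triangular system, whose
  diagonal consists of eigenvalues of \<open>A\<close> and so lies in the open left half plane.
  Transforming back yields a constant independent of \<open>T\<close>.\<close>

theorem hurwitz_bounded_input_bounded_state: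
  assumes A: "A \<in> carrier_mat k k" and hur: "hurwitz A"
  shows "\<exists>K\<ge>0. \<forall>T M x g. linear_traj (\<lambda>i j. A $$ (i, j)) k T M x g \<longrightarrow>
    (\<forall>t\<in>{0..T}. \<forall>i<k. \<bar>x t i\<bar> \<le> K * M)"
proof -
  let ?A = "map_mat complex_of_real A"
  have A': "?A \<in> carrier_mat k k" using A by simp
  obtain es where "char_poly ?A = (\<Prod>a\<leftarrow>es. [:- a, 1:])" using char_poly_factorized[OF A'] by auto
  from schur_decomposition_exists[OF A' this] obtain B where
    B: "B \<in> carrier_mat k k" "upper_triangular B" "similar_mat ?A B" by auto
  from B(3) obtain P Q where "similar_mat_wit ?A B P Q" by (auto simp: similar_mat_def)
  from similar_mat_witD2[OF A' this] have PQ: "P \<in> carrier_mat k k" "Q \<in> carrier_mat k k"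
    "P * Q = 1\<^sub>m k" "Q * P = 1\<^sub>m k" "?A = P * B * Q" by auto
  have QA: "Q * ?A = B * Q"
  proof -
    have "P * B * Q = P * (B * Q)" by (rule assoc_mult_mat[OF PQ(1) B(1) PQ(2)])
    then have "Q * ?A = Q * (P * (B * Q))" by (simp only: PQ(5))
    also have "\<dots> = (Q * P) * (B * Q)" by (rule assoc_mult_mat[symmetric]) (use PQ B in auto)
    also have "\<dots> = B * Q" unfolding PQ(4) by (rule left_mult_one_mat) (use PQ B in auto)
    finally show ?thesis .
  qed
  have diag: "Re (B $$ (i, i)) < 0" if "i < k" for i
  proof -
    have "char_poly B = (\<Prod>a\<leftarrow>diag_mat B. [:- a, 1:])" by (rule char_poly_upper_triangular[OF B(1,2)])
    then have "poly (char_poly B) (B $$ (i, i)) = 0"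
      using that B(1) by (auto simp: poly_prod_list prod_list_zero_iff diag_mat_def)
    then have "eigenvalue ?A (B $$ (i, i))"
      using eigenvalue_root_char_poly[OF A'] char_poly_similar[OF B(3)] by simp
    then show ?thesis using hur by (auto simp: hurwitz_def)
  qed
  have tri: "B $$ (i, j) = 0" if "i < k" "j < i" for i j
    using B that by (auto simp: upper_triangular_def)
  from triangular_traj_bound[of k "\<lambda>i j. B $$ (i, j)" k, OF tri diag order_refl]
  obtain K where K0: "K \<ge> 0 \<and> (\<forall>T M x g. linear_traj (\<lambda>i j. B $$ (i, j)) k T M x g \<longrightarrow>
    (\<forall>t\<in>{0..T}. \<forall>i\<in>{k-k..<k}. norm (x t i) \<le> K * M))" by (rule exE)
  have K: "K \<ge> 0" using K0 by (rule conjunct1)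
  have bound: "norm (x t i) \<le> K * M"
    if "linear_traj (\<lambda>i j. B $$ (i, j)) k T M x g" "t \<in> {0..T}" "i < k" for T M x g t i
    using K0[THEN conjunct2, rule_format, OF that(1,2), of i] that(3) by simp
  \<comment> \<open>The sums \<open>q\<close> and \<open>p\<close> of all entries in modulus
    dominate every row sum of \<open>Q\<close> and \<open>P\<close>, so passing to \<open>z\<close>
    and back costs these factors.\<close>
  define q where "q = (\<Sum>i<k. \<Sum>j<k. norm (Q $$ (i, j)))"
  define p where "p = (\<Sum>i<k. \<Sum>j<k. norm (P $$ (i, j)))"
  have rowle: "(\<Sum>j<k. norm (X $$ (i, j))) \<le> (\<Sum>i<k. \<Sum>j<k. norm (X $$ (i, j)))" if "i < k" for X :: "complex mat" and i
    using that by (intro member_le_sum[of i "{..<k}" "\<lambda>i. \<Sum>j<k. norm (X $$ (i, j))"] sum_nonneg) auto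
  have pq: "p \<ge> 0" "q \<ge> 0" unfolding p_def q_def by (auto intro!: sum_nonneg)
  have mat_sum: "(X * Y) $$ (i, j) = (\<Sum>l<k. X $$ (i, l) * Y $$ (l, j))"
    if "X \<in> carrier_mat k k" "Y \<in> carrier_mat k k" "i < k" "j < k" for X Y :: "complex mat" and i j
    using that by (auto simp: scalar_prod_def lessThan_atLeast0)
  show ?thesis
  proof (intro exI conjI allI impI ballI)
    show "p * K * q \<ge> 0" using K pq by simp
    fix T M x g t i
    assume tr: "linear_traj (\<lambda>i j. A $$ (i, j)) k T M x g" and t: "t \<in> {0..T}" and i: "i < k"
    have "norm (g t i) \<le> M" using tr t i by (auto simp: linear_traj_def)
    then have M: "M \<ge> 0" by (rule order_trans[OF norm_ge_zero])
    define z where "z t i = (\<Sum>j<k. Q $$ (i, j) * of_real (x t j))" for t i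
    define g' where "g' t i = (\<Sum>j<k. Q $$ (i, j) * of_real (g t j))" for t i
    have bq: "norm (\<Sum>j<k. Q $$ (i, j) * of_real (v j)) \<le> q * M" if "\<And>j. j < k \<Longrightarrow> \<bar>v j\<bar> \<le> M" "i < k" for v :: "nat \<Rightarrow> real" and i
    proof -
      have "norm (\<Sum>j<k. Q $$ (i, j) * of_real (v j)) \<le> (\<Sum>j<k. norm (Q $$ (i, j)) * M)"
        using that by (intro sum_norm_le) (auto simp: norm_mult intro!: mult_left_mono)
      also have "\<dots> \<le> q * M" unfolding q_def sum_distrib_right[symmetric] using M rowle[OF that(2)] by (intro mult_right_mono)
      finally show ?thesis .
    qed
    have "linear_traj (\<lambda>i j. B $$ (i, j)) k T (q * M) z g'"
      unfolding linear_traj_def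
    proof (intro conjI ballI allI impI)
      obtain S where S: "finite S" "\<And>s i. s \<in> {0<..<T} - S \<Longrightarrow> i < k \<Longrightarrow>
          ((\<lambda>t. x t i) has_vector_derivative (\<Sum>j<k. A $$ (i, j) * x s j) + g s i) (at s)"
        using linear_traj_derivative[OF tr] by metis
      have "((\<lambda>t. z t l) has_vector_derivative (\<Sum>j<k. B $$ (l, j) * z s j) + g' s l) (at s)"
        if s: "s \<in> {0<..<T} - S" and l: "l < k" for s l
      proof -
        have "((\<lambda>t. z t l) has_vector_derivative
            (\<Sum>j<k. Q $$ (l, j) * of_real ((\<Sum>m<k. A $$ (j, m) * x s m) + g s j))) (at s)"
          unfolding z_def
          by (rule has_vector_derivative_sum has_vector_derivative_mult_right
              bounded_linear.has_vector_derivative[OF bounded_linear_of_real] S(2)[OF s] | simp)+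
        also have "(\<Sum>j<k. Q $$ (l, j) * of_real ((\<Sum>m<k. A $$ (j, m) * x s m) + g s j)) =
            (\<Sum>m<k. (\<Sum>j<k. Q $$ (l, j) * of_real (A $$ (j, m))) * of_real (x s m)) + g' s l"
          unfolding g'_def by (simp add: algebra_simps sum.distrib sum_distrib_left sum_distrib_right)
            (subst sum.swap, simp)
        also have "(\<Sum>m<k. (\<Sum>j<k. Q $$ (l, j) * of_real (A $$ (j, m))) * of_real (x s m)) =
            (\<Sum>m<k. (\<Sum>j<k. B $$ (l, j) * Q $$ (j, m)) * of_real (x s m))"
        proof (rule sum.cong[OF refl])
          fix m assume m: "m \<in> {..<k}"
          have "(\<Sum>j<k. Q $$ (l, j) * of_real (A $$ (j, m))) = (Q * ?A) $$ (l, m)"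
            unfolding mat_sum[OF PQ(2) A' l m[simplified]] using A m by auto
          also have "\<dots> = (\<Sum>j<k. B $$ (l, j) * Q $$ (j, m))"
            unfolding QA using mat_sum[OF B(1) PQ(2) l m[simplified]] .
          finally show "(\<Sum>j<k. Q $$ (l, j) * of_real (A $$ (j, m))) * complex_of_real (x s m) =
            (\<Sum>j<k. B $$ (l, j) * Q $$ (j, m)) * of_real (x s m)" by simp
        qed
        also have "\<dots> = (\<Sum>j<k. B $$ (l, j) * z s j)"
          unfolding z_def by (simp add: sum_distrib_left sum_distrib_right algebra_simps) (subst sum.swap, simp)
        finally show ?thesis .
      qed
      with S(1) show "\<exists>S. finite S \<and> (\<forall>t\<in>{0<..<T} - S. \<forall>i<k.
        ((\<lambda>t. z t i) has_vector_derivative (\<Sum>j<k. B $$ (i, j) * z t j) + g' t i) (at t))" by blast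
      show "continuous_on {0..T} (\<lambda>t. z t l)" for l
        unfolding z_def using tr by (intro continuous_intros) (auto simp: linear_traj_def)
      show "norm (z 0 l) \<le> q * M" if "l < k" for l
        unfolding z_def using tr that by (intro bq) (auto simp: linear_traj_def)
      show "norm (g' s l) \<le> q * M" if "s \<in> {0..T}" "l < k" for s l
        unfolding g'_def using tr that by (intro bq) (auto simp: linear_traj_def)
    qed
    from bound[OF this t] have zb: "\<And>l. l < k \<Longrightarrow> norm (z t l) \<le> K * (q * M)" .
    have "complex_of_real (x t i) = (\<Sum>j<k. P $$ (i, j) * z t j)"
    proof -
      have "(\<Sum>j<k. P $$ (i, j) * z t j) = (\<Sum>m<k. (\<Sum>j<k. P $$ (i, j) * Q $$ (j, m)) * of_real (x t m))"
        unfolding z_def by (simp add: sum_distrib_left sum_distrib_right algebra_simps) (subst sum.swap, simp)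
      also have "\<dots> = (\<Sum>m<k. (if m = i then 1 else 0) * of_real (x t m))"
        using mat_sum[OF PQ(1,2) i, symmetric] i by (intro sum.cong) (auto simp: PQ(3))
      also have "\<dots> = of_real (x t i)" using i by (simp add: if_distrib[of "\<lambda>u. u * _"] cong: if_cong)
      finally show ?thesis ..
    qed
    then have "\<bar>x t i\<bar> = norm (\<Sum>j<k. P $$ (i, j) * z t j)" by (metis norm_of_real)
    also have "\<dots> \<le> (\<Sum>j<k. norm (P $$ (i, j)) * (K * (q * M)))"
      using zb by (intro sum_norm_le) (auto simp: norm_mult intro!: mult_left_mono)
    also have "\<dots> \<le> p * (K * (q * M))"
      unfolding p_def sum_distrib_right[symmetric] using rowle[OF i] K pq M by (intro mult_right_mono) auto
    finally show "\<bar>x t i\<bar> \<le> p * K * q * M" by (simp add: mult.assoc)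
  qed
qed


section \<open>Strictly positive real functions\<close>

abbreviation cpoly :: "real poly \<Rightarrow> complex poly" where
  "cpoly \<equiv> map_poly complex_of_real"

lemma poly_cpoly_of_real [simp]: "poly (cpoly p) (of_real x) = of_real (poly p x)"
  by (induction p) (auto simp: map_poly_pCons)

lemma poly_cpoly_cnj: "poly (cpoly p) (cnj s) = cnj (poly (cpoly p) s)"
  by (induction p) (auto simp: map_poly_pCons)

lemma degree_cpoly [simp]: "degree (cpoly p) = degree p"
  by (simp add: degree_map_poly)

lemma coeff_cpoly [simp]: "coeff (cpoly p) i = of_real (coeff p i)"
  by (simp add: coeff_map_poly)

lemma poly_cpoly_pCons [simp]: "poly (cpoly (pCons a p)) s = of_real a + s * poly (cpoly p) s"
  by (cases "a = 0 \<and> p = 0") (auto simp: map_poly_pCons)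

lemma poly_cpoly_add [simp]: "poly (cpoly (p + q)) s = poly (cpoly p) s + poly (cpoly q) s"
  by (induction p q rule: poly_induct2) (simp_all add: algebra_simps)

lemma poly_cpoly_smult [simp]: "poly (cpoly (Polynomial.smult a p)) s = of_real a * poly (cpoly p) s"
  by (induction p) (simp_all add: algebra_simps)

lemma poly_cpoly_mult [simp]: "poly (cpoly (p * q)) s = poly (cpoly p) s * poly (cpoly q) s"
  by (induction p) (simp_all add: algebra_simps)

lemma poly_cpoly_pcompose: "poly (cpoly (p \<circ>\<^sub>p q)) s = poly (cpoly p) (poly (cpoly q) s)"
  by (induction p) (simp_all add: pcompose_pCons)

text \<open>The roots are not real and come in conjugate pairs; a pair contributes the quadratic
  factor \<open>|x - z|^2\<close>, and \<open>F\<close> collects one root of each pair.\<close>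

lemma positive_poly_eq_norm_square:
  fixes p :: "real poly"
  assumes "\<And>x. poly p x > 0"
  shows "\<exists>F::complex poly. 2 * degree F = degree p \<and> (\<forall>x. poly p x = (cmod (poly F (of_real x)))\<^sup>2)"
  using assms
proof (induction "degree p" arbitrary: p rule: less_induct)
  case less
  show ?case
  proof (cases "degree p = 0")
    case True
    then obtain c where c: "p = [:c:]" by (meson degree_eq_zeroE)
    then have "c > 0" using less.prems[of 0] by simp
    then show ?thesis using c by (intro exI[of _ "[:of_real (sqrt c):]"]) (auto simp: norm_of_real)
  next
    case False
    then have "\<not> constant (poly (cpoly p))" by (simp add: constant_degree)
    from Fundamental_Theorem_Algebra.fundamental_theorem_of_algebra[OF this] obtain z where z: "poly (cpoly p) z = 0" by auto
    have Im: "Im z \<noteq> 0"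
    proof
      assume "Im z = 0"
      then have "z = of_real (Re z)" by (simp add: complex_eq_iff)
      then show False using z less.prems[of "Re z"] by (metis poly_cpoly_of_real of_real_eq_0_iff less_irrefl)
    qed
    define q where "q = [:(cmod z)\<^sup>2, - 2 * Re z, 1:]"
    have qz: "poly (cpoly q) z = 0"
      by (simp add: q_def map_poly_pCons complex_eq_iff cmod_def power2_eq_square algebra_simps)
    have qx: "poly q x = (cmod (of_real x - z))\<^sup>2" for x
      unfolding q_def cmod_power2 by (simp add: power2_eq_square algebra_simps)
    have dq: "degree q = 2" by (simp add: q_def)
    \<comment> \<open>A remainder of degree at most 1 with real coefficients that vanishes at the
      nonreal \<open>z\<close> is 0, so the quadratic factor divides \<open>p\<close>; what is left
      is again positive because \<open>q\<close> is.\<close>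
    define r where "r = p mod q"
    have p: "p = q * (p div q) + r" by (simp add: r_def)
    have dr: "degree r < 2" using degree_mod_less[of q p] dq by (auto simp: r_def q_def)
    have rz: "poly (cpoly r) z = 0"
      using z qz by (subst (asm) p) (simp add: poly_cpoly_add poly_cpoly_mult)
    have r_eq: "r = [:coeff r 0, coeff r 1:]"
      using dr by (intro poly_eqI) (auto simp: coeff_pCons coeff_eq_0 split: nat.split)
    have "poly (cpoly r) z = of_real (coeff r 0) + z * of_real (coeff r 1)"
      by (subst r_eq) (simp add: map_poly_pCons)
    then have "coeff r 1 = 0 \<and> coeff r 0 = 0" using rz Im by (auto simp: complex_eq_iff)
    then have "r = 0" using r_eq by simp
    then have pq: "p = q * (p div q)" using p by simp
    have pos: "poly (p div q) x > 0" for x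
    proof -
      have "poly q x > 0" using Im by (auto simp: qx complex_eq_iff)
      moreover have "poly q x * poly (p div q) x > 0" using less.prems[of x] pq by (metis poly_mult)
      ultimately show ?thesis by (simp add: zero_less_mult_iff)
    qed
    then have "p div q \<noteq> 0" by (metis poly_0 less_irrefl)
    then have deg: "degree p = 2 + degree (p div q)"
      using pq dq degree_mult_eq[of q "p div q"] by force
    from less.hyps[OF _ pos] deg obtain F where F: "2 * degree F = degree (p div q)"
      "\<And>x. poly (p div q) x = (cmod (poly F (of_real x)))\<^sup>2" by auto
    have "F \<noteq> 0" using F(2)[of 0] pos[of 0] by auto
    then have "2 * degree ([:-z, 1:] * F) = degree p" using F(1) deg degree_mult_eq[of "[:-z,1:]" F] by simp
    moreover have "poly p x = (cmod (poly ([:-z, 1:] * F) (of_real x)))\<^sup>2" for x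
    proof -
      have "poly p x = poly q x * poly (p div q) x" using pq by (metis poly_mult)
      then show ?thesis unfolding qx F(2) poly_mult norm_mult power_mult_distrib by simp
    qed
    ultimately show ?thesis by blast
  qed
qed

lemma infinite_Re_pos: "infinite {s::complex. 0 < Re s}"
proof
  assume "finite {s::complex. 0 < Re s}"
  then have "finite (range (\<lambda>n. complex_of_nat (Suc n)))" by (rule finite_subset[rotated]) auto
  moreover have "inj (\<lambda>n. complex_of_nat (Suc n))" by (intro injI) (metis of_nat_eq_iff Suc_inject)
  ultimately show False using finite_imageD by blast
qed

text \<open>The equation is stated without a quotient, so that it also holds at zeros of
  \<open>D\<close>. The real part is strictly positive because a nonconstant holomorphic function is
  open: a value on the imaginary axis would have neighbours of negative real part among the values
  of \<open>h\<close>.\<close>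

lemma strictly_positive_real_extension:
  assumes spr: "strictly_positive_real N D" and deg: "degree D = degree N + 1"
  obtains \<epsilon> h where "\<epsilon> > 0"
    "\<And>s. - \<epsilon> < Re s \<Longrightarrow> h s * poly (cpoly D) s = poly (cpoly N) s"
    "\<And>s. - \<epsilon> < Re s \<Longrightarrow> 0 < Re (h s)"
proof -
  obtain \<epsilon> where \<epsilon>: "\<epsilon> > 0" "positive_real (N \<circ>\<^sub>p [:-\<epsilon>, 1:]) (D \<circ>\<^sub>p [:-\<epsilon>, 1:])"
    using spr by (auto simp: strictly_positive_real_def)
  define N' where "N' = cpoly (N \<circ>\<^sub>p [:-\<epsilon>, 1:])"
  define D' where "D' = cpoly (D \<circ>\<^sub>p [:-\<epsilon>, 1:])"
  let ?H = "{s::complex. 0 < Re s}"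
  have oH: "open ?H" by (simp add: open_halfspace_Re_gt)
  have cH: "connected ?H" by (simp add: convex_connected convex_halfspace_Re_gt)
  from \<epsilon>(2) obtain h where h: "h holomorphic_on ?H" "N' \<noteq> 0" "D' \<noteq> 0"
    "\<And>s. 0 < Re s \<Longrightarrow> poly D' s \<noteq> 0 \<Longrightarrow> h s = poly N' s / poly D' s"
    "\<And>s. 0 < Re s \<Longrightarrow> 0 \<le> Re (h s)"
    by (auto simp: positive_real_def N'_def D'_def rat_eval_def)
  have deg': "degree D' = degree N' + 1" unfolding D'_def N'_def using deg by simp
  \<comment> \<open>At a zero of \<open>D'\<close> the quotient does not determine \<open>h\<close>;
    the equation follows there by continuity, the zeros being isolated.\<close>
  have eq: "h s * poly D' s = poly N' s" if s: "0 < Re s" for s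
  proof -
    have "isCont h s" using holomorphic_on_imp_continuous_on[OF h(1)] s by (simp add: continuous_on_eq_continuous_at[OF oH])
    then have "isCont (\<lambda>s. h s * poly D' s - poly N' s) s" by (intro continuous_intros)
    then have "((\<lambda>s. h s * poly D' s - poly N' s) \<longlongrightarrow> h s * poly D' s - poly N' s) (at s)"
      by (simp add: isCont_def)
    moreover have "eventually (\<lambda>s. h s * poly D' s - poly N' s = 0) (at s)"
    proof -
      have "\<not> s islimpt {x. poly D' x = 0}" using poly_roots_finite[OF h(3)] by (rule islimpt_finite)
      then have "eventually (\<lambda>x. x \<notin> {x. poly D' x = 0}) (at s)" by (simp add: islimpt_iff_eventually)
      moreover have "eventually (\<lambda>x. x \<in> ?H) (at s)" using oH s by (intro eventually_at_in_open') auto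
      ultimately show ?thesis by eventually_elim (use h(4) in auto)
    qed
    then have "((\<lambda>s. h s * poly D' s - poly N' s) \<longlongrightarrow> 0) (at s)"
      by (rule tendsto_eventually)
    ultimately have "h s * poly D' s - poly N' s = 0" by (rule tendsto_unique[OF at_neq_bot])
    then show ?thesis by simp
  qed
  \<comment> \<open>If \<open>h\<close> were constant, \<open>N'\<close> would be a multiple of
    \<open>D'\<close>, against the degrees.\<close>
  have nonconst: "\<not> h constant_on ?H"
  proof
    assume "h constant_on ?H"
    then obtain c where c: "\<And>s. 0 < Re s \<Longrightarrow> h s = c" by (auto simp: constant_on_def)
    have "{s. 0 < Re s} \<subseteq> {s. poly (Polynomial.smult c D' - N') s = 0}" using eq c by auto
    then have "infinite {s. poly (Polynomial.smult c D' - N') s = 0}" using infinite_Re_pos infinite_super by blast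
    then have "Polynomial.smult c D' - N' = 0" using poly_roots_finite by blast
    then have "N' = Polynomial.smult c D'" by simp
    then show False using deg' h(2) by (cases "c = 0") (auto simp: degree_smult_eq)
  qed
  have pos: "0 < Re (h s)" if s: "0 < Re s" for s
  proof (rule ccontr)
    assume "\<not> 0 < Re (h s)"
    then have 0: "Re (h s) = 0" using h(5)[OF s] by simp
    have "open (h ` ?H)" by (rule open_mapping_thm[OF h(1) oH cH oH order_refl nonconst])
    moreover have "h s \<in> h ` ?H" using s by blast
    ultimately obtain e where e: "e > 0" "ball (h s) e \<subseteq> h ` ?H" by (rule openE)
    have "h s - of_real (e/2) \<in> ball (h s) e" using e by (simp add: dist_norm)
    then have "h s - of_real (e/2) \<in> h ` ?H" using e(2) by blast
    then obtain s' where "0 < Re s'" "h s' = h s - of_real (e/2)" by (metis (no_types, lifting) imageE mem_Collect_eq)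
    then show False using h(5)[of s'] 0 e by simp
  qed
  show thesis
  proof (rule that[of \<epsilon> "\<lambda>s. h (s + of_real \<epsilon>)"])
    fix s assume s: "- \<epsilon> < Re s"
    show "h (s + of_real \<epsilon>) * poly (cpoly D) s = poly (cpoly N) s"
      using eq[of "s + of_real \<epsilon>"] s by (simp add: N'_def D'_def poly_cpoly_pcompose map_poly_pCons)
    show "0 < Re (h (s + of_real \<epsilon>))" using pos[of "s + of_real \<epsilon>"] s by simp
  qed (use \<epsilon> in simp)
qed

text \<open>Division with remainder gives \<open>D / N = s + \<alpha> + \<rho>(s)\<close> with
  \<rho> tending to 0, so at high frequencies the real part is about \<open>\<alpha> |N|^2\<close>
  and grows like the top power in the sum; on a compact interval a positive minimum suffices. The
  crux is \<open>\<alpha> > 0\<close>, which comes from the shift in strict positive realness: for a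
  function that is only positive real, \<alpha> may be 0.\<close>

lemma strictly_positive_real_margin:
  fixes N D :: "real poly"
  assumes monic: "lead_coeff N = 1" "lead_coeff D = 1" and deg: "degree D = degree N + 1"
    and N0: "\<And>s. poly (cpoly N) s = 0 \<Longrightarrow> Re s < 0" and spr: "strictly_positive_real N D"
  obtains \<delta> where "\<delta> > 0"
    "\<And>w. Re (poly (cpoly N) (\<i> * of_real w) * cnj (poly (cpoly D) (\<i> * of_real w))) \<ge> \<delta> * (\<Sum>k\<le>degree N. w ^ (2 * k))"
proof -
  define d where "d = degree N"
  obtain \<epsilon> h where \<epsilon>: "\<epsilon> > 0" and h: "\<And>s. - \<epsilon> < Re s \<Longrightarrow> h s * poly (cpoly D) s = poly (cpoly N) s"
    "\<And>s. - \<epsilon> < Re s \<Longrightarrow> 0 < Re (h s)"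
    using strictly_positive_real_extension[OF spr deg] by blast
  have Nz: "N \<noteq> 0" and Dz: "D \<noteq> 0" using monic by auto
  define q where "q = D div N"
  define R where "R = D mod N"
  have DqR: "D = N * q + R" by (simp add: q_def R_def)
  have R: "R = 0 \<or> degree R < degree N" using degree_mod_less[OF Nz, of D] by (auto simp: R_def)
  have dNq: "D - R = N * q" using DqR by simp
  have dR: "degree R < degree D" using R deg by auto
  have "degree (D + - R) = degree D" using dR by (intro degree_add_eq_left) simp
  then have dDR: "degree (N * q) = degree N + 1" "lead_coeff (N * q) = 1"
    using monic(2) dR deg unfolding dNq[symmetric] by (simp_all add: coeff_eq_0)
  then have "q \<noteq> 0" by auto
  then have "degree q = 1" using dDR by (simp add: degree_mult_eq[OF Nz])
  have "lead_coeff q = 1" using dDR(2) monic(1) by (simp only: lead_coeff_mult mult_1)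
  define \<alpha> where "\<alpha> = coeff q 0"
  have q: "q = [:\<alpha>, 1:]"
    using \<open>degree q = 1\<close> \<open>lead_coeff q = 1\<close> unfolding \<alpha>_def
    by (intro poly_eqI) (auto simp: coeff_pCons coeff_eq_0 split: nat.split)
  define \<rho> where "\<rho> s = poly (cpoly R) s / poly (cpoly N) s" for s
  have \<rho>: "(\<rho> \<longlongrightarrow> 0) at_infinity"
  proof (cases "R = 0")
    case True then show ?thesis by (simp add: \<rho>_def[abs_def])
  next
    case False
    then show ?thesis unfolding \<rho>_def using R by (intro poly_divide_tendsto_0_at_infinity) auto
  qed
  have ND: "poly (cpoly D) s / poly (cpoly N) s = s + of_real \<alpha> + \<rho> s" if "poly (cpoly N) s \<noteq> 0" for s
  proof -
    have "poly (cpoly D) s = poly (cpoly N) s * (s + of_real \<alpha>) + poly (cpoly R) s"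
      by (subst DqR) (simp add: q algebra_simps)
    then show ?thesis using that by (simp add: \<rho>_def add_divide_distrib)
  qed
  have "((\<lambda>s. poly (cpoly N) s / s ^ d) \<longlongrightarrow> 1) at_infinity"
    using poly_divide_tendsto_aux[of "cpoly N"] monic(1) by (simp add: d_def)
  then have "eventually (\<lambda>s. dist (poly (cpoly N) s / s ^ d) 1 < 1/2) at_infinity"
    by (rule tendstoD) simp
  \<comment> \<open>\<open>N\<close> is monic, so \<open>N(s) / s^d\<close> tends to 1. The lower
    bound is used twice: to see that \<open>N(s)\<close> is not 0 and to compare with powers of the
    frequency.\<close>
  then have Nlow: "eventually (\<lambda>s. cmod (poly (cpoly N) s) \<ge> cmod s ^ d / 2 \<and> cmod s \<ge> 1) at_infinity"
  proof (rule eventually_elim2)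
    show "eventually (\<lambda>s::complex. cmod s \<ge> 1) at_infinity" unfolding eventually_at_infinity by blast
    fix s :: complex assume s: "dist (poly (cpoly N) s / s ^ d) 1 < 1/2" "cmod s \<ge> 1"
    have "1 \<le> cmod (poly (cpoly N) s / s ^ d) + dist (poly (cpoly N) s / s ^ d) 1"
      using norm_triangle_sub[of 1 "poly (cpoly N) s / s ^ d"] by (simp add: dist_norm norm_minus_commute)
    then have "1/2 \<le> cmod (poly (cpoly N) s / s ^ d)" using s by linarith
    moreover have "0 < cmod s ^ d" using s(2) by (intro zero_less_power) auto
    ultimately have "1/2 \<le> cmod (poly (cpoly N) s) / cmod s ^ d" "0 < cmod s ^ d" by (simp_all only: norm_divide norm_power)
    then show "cmod (poly (cpoly N) s) \<ge> cmod s ^ d / 2 \<and> cmod s \<ge> 1"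
      using s(2) \<open>0 < cmod s ^ d\<close> by (simp add: field_simps)
  qed
  have \<alpha>: "\<alpha> > 0"
  proof (rule ccontr)
    assume "\<not> \<alpha> > 0"
    then have "eventually (\<lambda>s. dist (\<rho> s) 0 < \<epsilon> / 2 - \<alpha>) at_infinity" using \<epsilon> by (intro tendstoD[OF \<rho>]) simp
    with Nlow have "eventually (\<lambda>s. (cmod (poly (cpoly N) s) \<ge> cmod s ^ d / 2 \<and> cmod s \<ge> 1) \<and> dist (\<rho> s) 0 < \<epsilon> / 2 - \<alpha>) at_infinity"
      by (rule eventually_conj)
    then obtain M where M: "\<And>s. cmod s \<ge> M \<Longrightarrow> cmod (poly (cpoly N) s) \<ge> cmod s ^ d / 2 \<and> cmod s \<ge> 1 \<and> dist (\<rho> s) 0 < \<epsilon> / 2 - \<alpha>"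
      unfolding eventually_at_infinity by blast
    \<comment> \<open>A point far up on the line \<open>Re s = - \<epsilon> / 2\<close>, inside the
      extended half plane: there \<open>1 / h\<close> has positive real part, while
      \<open>s + \<alpha> + \<rho>(s)\<close> would have negative real part if \<alpha> were not
      positive.\<close>
    define s where "s = Complex (- \<epsilon> / 2) \<bar>M\<bar>"
    have "cmod s \<ge> M" using abs_Im_le_cmod[of s] by (simp add: s_def)
    note Ms = M[OF this]
    have "0 < cmod s ^ d / 2" using Ms by (intro divide_pos_pos zero_less_power) auto
    then have Ns: "poly (cpoly N) s \<noteq> 0" using Ms by auto
    have res: "- \<epsilon> < Re s" using \<epsilon> by (simp add: s_def)
    have "poly (cpoly D) s / poly (cpoly N) s = 1 / h s"
    proof -
      have "h s \<noteq> 0" "poly (cpoly D) s \<noteq> 0" using h(1)[OF res] Ns by auto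
      then show ?thesis unfolding h(1)[OF res, symmetric] by simp
    qed
    then have "Re (s + of_real \<alpha> + \<rho> s) > 0"
      unfolding ND[OF Ns, symmetric] using h(2)[OF res] by (simp add: Re_divide_of_real Re_divide add_pos_nonneg)
    then have "- \<epsilon> / 2 + \<alpha> + Re (\<rho> s) > 0" by (simp add: s_def)
    moreover have "Re (\<rho> s) < \<epsilon> / 2 - \<alpha>" using Ms complex_Re_le_cmod[of "\<rho> s"] by (simp add: dist_norm)
    ultimately show False by linarith
  qed
  let ?I = "\<lambda>w::real. \<i> * complex_of_real w"
  define f where "f w = Re (poly (cpoly N) (?I w) * cnj (poly (cpoly D) (?I w)))" for w
  define g where "g w = (\<Sum>k\<le>d. w ^ (2 * k))" for w :: real
  have g1: "g w \<ge> 1" for w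
  proof -
    have "(\<Sum>k\<in>{0}. w ^ (2 * k)) \<le> g w" unfolding g_def by (rule sum_mono2) (auto simp: power_mult)
    then show ?thesis by simp
  qed
  have fpos: "f w > 0" for w
  proof -
    have res: "- \<epsilon> < Re (?I w)" using \<epsilon> by simp
    have Ns: "poly (cpoly N) (?I w) \<noteq> 0" using N0[of "?I w"] by auto
    have D: "poly (cpoly D) (?I w) \<noteq> 0" using h(1)[OF res] Ns by auto
    have "f w = Re (h (?I w) * (poly (cpoly D) (?I w) * cnj (poly (cpoly D) (?I w))))"
      unfolding f_def h(1)[OF res, symmetric] by (simp only: mult.assoc)
    also have "\<dots> = Re (h (?I w)) * (cmod (poly (cpoly D) (?I w)))\<^sup>2"
      by (subst complex_norm_square[symmetric]) simp
    also have "\<dots> > 0" using h(2)[OF res] D by simp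
    finally show ?thesis .
  qed
  have "eventually (\<lambda>s. dist (\<rho> s) 0 < \<alpha> / 2) at_infinity" using \<alpha> by (intro tendstoD[OF \<rho>]) simp
  with Nlow have "eventually (\<lambda>s. (cmod (poly (cpoly N) s) \<ge> cmod s ^ d / 2 \<and> cmod s \<ge> 1) \<and> dist (\<rho> s) 0 < \<alpha> / 2) at_infinity"
    by (rule eventually_conj)
  then obtain M where M: "\<And>s. cmod s \<ge> M \<Longrightarrow> cmod (poly (cpoly N) s) \<ge> cmod s ^ d / 2 \<and> cmod s \<ge> 1 \<and> dist (\<rho> s) 0 < \<alpha> / 2"
    unfolding eventually_at_infinity by blast
  \<comment> \<open>The factor 8 comes from squaring the bound \<open>|w|^d / 2\<close> of
    \<open>|N|\<close> and from \<open>\<alpha> / 2\<close>; the sum \<open>g w\<close> has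
    \<open>d + 1\<close> terms, each at most \<open>|w| ^ (2 * d)\<close>.\<close>
  define \<delta>1 where "\<delta>1 = \<alpha> / (8 * real (d + 1))"
  have \<delta>1: "\<delta>1 > 0" using \<alpha> by (simp add: \<delta>1_def)
  have far: "f w \<ge> \<delta>1 * g w" if w: "\<bar>w\<bar> \<ge> M" for w
  proof -
    have "cmod (?I w) = \<bar>w\<bar>" by (simp add: norm_mult)
    note Mw = M[of "?I w", unfolded this, OF w]
    have Ns: "poly (cpoly N) (?I w) \<noteq> 0" using N0[of "?I w"] by auto
    have f1: "f w = (cmod (poly (cpoly N) (?I w)))\<^sup>2 * Re (poly (cpoly D) (?I w) / poly (cpoly N) (?I w))"
    proof -
      have "poly (cpoly N) (?I w) * cnj (poly (cpoly D) (?I w)) =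
        of_real ((cmod (poly (cpoly N) (?I w)))\<^sup>2) * cnj (poly (cpoly D) (?I w) / poly (cpoly N) (?I w))"
        unfolding complex_norm_square using Ns by simp
      moreover have "Re (complex_of_real r * cnj z) = r * Re z" for r z by simp
      ultimately show ?thesis unfolding f_def by (simp only:)
    qed
    have f2: "Re (poly (cpoly D) (?I w) / poly (cpoly N) (?I w)) \<ge> \<alpha> / 2"
    proof -
      have "cmod (\<rho> (?I w)) < \<alpha> / 2" using Mw by (simp add: dist_norm)
      then have "Re (\<rho> (?I w)) \<ge> - \<alpha> / 2" using abs_Re_le_cmod[of "\<rho> (?I w)"] by linarith
      then show ?thesis unfolding ND[OF Ns] by simp
    qed
    have f3: "(cmod (poly (cpoly N) (?I w)))\<^sup>2 \<ge> (\<bar>w\<bar> ^ d / 2)\<^sup>2"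
      using Mw by (intro power_mono) auto
    have "f w \<ge> (\<bar>w\<bar> ^ d / 2)\<^sup>2 * (\<alpha> / 2)"
      unfolding f1 by (rule mult_mono[OF f3 f2]) (use \<alpha> in auto)
    also have "(\<bar>w\<bar> ^ d / 2)\<^sup>2 * (\<alpha> / 2) = \<delta>1 * (real (d + 1) * \<bar>w\<bar> ^ (2 * d))"
    proof -
      have "x * \<alpha> / 8 = \<alpha> / (8 * e) * (e * x)" if "e \<noteq> 0" for x e :: real using that by simp
      note eq = this[of "real (d + 1)" "\<bar>w\<bar> ^ (2 * d)"]
      have "(\<bar>w\<bar> ^ d / 2)\<^sup>2 * (\<alpha> / 2) = \<bar>w\<bar> ^ (2 * d) * \<alpha> / 8"
        by (simp add: power_divide power_mult[symmetric] mult.commute)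
      then show ?thesis unfolding \<delta>1_def using eq by (simp only: of_nat_eq_0_iff)
    qed
    finally have "f w \<ge> \<delta>1 * (real (d + 1) * \<bar>w\<bar> ^ (2 * d))" .
    moreover have "g w \<le> real (d + 1) * \<bar>w\<bar> ^ (2 * d)"
    proof -
      have "w ^ (2 * k) \<le> \<bar>w\<bar> ^ (2 * d)" if "k \<le> d" for k
      proof -
        have "w ^ (2 * k) = \<bar>w\<bar> ^ (2 * k)" by (simp add: power_mult)
        also have "\<dots> \<le> \<bar>w\<bar> ^ (2 * d)" using that Mw by (intro power_increasing) auto
        finally show ?thesis .
      qed
      then have "g w \<le> (\<Sum>k\<le>d. \<bar>w\<bar> ^ (2 * d))" unfolding g_def by (intro sum_mono) auto
      then show ?thesis by simp
    qed
    then have "\<delta>1 * g w \<le> \<delta>1 * (real (d + 1) * \<bar>w\<bar> ^ (2 * d))" using \<delta>1 by (intro mult_left_mono) auto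
    ultimately show ?thesis by linarith
  qed
  have "continuous_on {-\<bar>M\<bar>..\<bar>M\<bar>} (\<lambda>w. f w / g w)"
  proof -
    have "(\<Sum>k\<le>d. w ^ (2 * k)) \<noteq> 0" for w :: real using g1[of w] unfolding g_def by linarith
    then show ?thesis unfolding f_def g_def by (intro continuous_intros) blast
  qed
  then obtain w0 where w0: "\<forall>w\<in>{-\<bar>M\<bar>..\<bar>M\<bar>}. f w0 / g w0 \<le> f w / g w"
    using continuous_attains_inf[of "{-\<bar>M\<bar>..\<bar>M\<bar>}" "\<lambda>w. f w / g w"] by auto
  define \<delta> where "\<delta> = min \<delta>1 (f w0 / g w0)"
  have gpos: "g w > 0" for w using g1[of w] by simp
  show thesis
  proof (rule that)
    show "\<delta> > 0" using \<delta>1 fpos[of w0] gpos[of w0] by (simp add: \<delta>_def)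
    fix w
    have "f w \<ge> \<delta> * g w"
    proof (cases "\<bar>w\<bar> \<ge> M")
      case True
      have "\<delta> * g w \<le> \<delta>1 * g w" using gpos[of w] by (intro mult_right_mono) (auto simp: \<delta>_def)
      then show ?thesis using far[OF True] by linarith
    next
      case False
      then have "w \<in> {-\<bar>M\<bar>..\<bar>M\<bar>}" by auto
      then have "\<delta> \<le> f w / g w" using w0 unfolding \<delta>_def by (intro min.coboundedI2) blast
      then show ?thesis using gpos[of w] by (simp add: field_simps)
    qed
    then show "Re (poly (cpoly N) (\<i> * of_real w) * cnj (poly (cpoly D) (\<i> * of_real w))) \<ge> \<delta> * (\<Sum>k\<le>degree N. w ^ (2 * k))"
      by (simp add: f_def g_def d_def)
  qed
qed

section \<open>Spectral factorization on the imaginary axis\<close>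

definition reflect :: "real poly \<Rightarrow> real poly" where
  "reflect p = p \<circ>\<^sub>p [:0, -1:]"

lemma poly_reflect_imaginary_axis:
  "poly (cpoly (reflect p)) (\<i> * of_real w) = cnj (poly (cpoly p) (\<i> * of_real w))"
  using poly_cpoly_cnj[of p "\<i> * of_real w"] by (simp add: reflect_def poly_cpoly_pcompose)

lemma coeff_mult_reflect: "coeff (p * reflect q) m = (\<Sum>l\<le>m. (- 1) ^ l * (coeff p (m - l) * coeff q l))"
  unfolding reflect_def mult.commute[of p] coeff_mult coeff_pcompose_linear by (simp add: ac_simps)

lemma poly_map_Re: "poly (map_poly Re C) x = Re (poly C (of_real x))"
  by (induction C) (auto simp: map_poly_pCons)

text \<open>Coefficient form of N(s) D(-s) + D(s) N(-s) = a(s) a(-s) + b(s) b(-s) + \<delta> times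
  the sum of s^k (-s)^k over k up to \<open>degree N\<close>. On the imaginary axis -s is the
  conjugate of s, which turns this into an identity between squared moduli; since the axis is
  infinite, equality there is equality of polynomials.\<close>

lemma spectral_factorization:
  fixes N D :: "real poly"
  assumes monic: "lead_coeff N = 1" "lead_coeff D = 1" and deg: "degree D = degree N + 1"
    and N0: "\<And>s. poly (cpoly N) s = 0 \<Longrightarrow> Re s < 0" and spr: "strictly_positive_real N D"
  obtains \<delta> a b where "\<delta> > 0" "degree a \<le> degree N" "degree b \<le> degree N"
    "\<And>m. (\<Sum>l\<le>m. (- 1) ^ l * (coeff N (m - l) * coeff D l + coeff D (m - l) * coeff N l - coeff a (m - l) * coeff a l
        - coeff b (m - l) * coeff b l - (if m - l = l \<and> l \<le> degree N then \<delta> else 0))) = 0"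
proof -
  define d where "d = degree N"
  let ?I = "\<lambda>w::real. \<i> * complex_of_real w"
  let ?f = "\<lambda>w. Re (poly (cpoly N) (?I w) * cnj (poly (cpoly D) (?I w)))"
  obtain \<delta> where \<delta>: "\<delta> > 0" and f: "\<And>w. ?f w \<ge> \<delta> * (\<Sum>k\<le>d. w ^ (2 * k))"
    using strictly_positive_real_margin[OF assms] unfolding d_def by blast
  \<comment> \<open>On the real axis the real part of a complex polynomial is the polynomial of the
    real parts of its coefficients; this makes the frequency response a real polynomial in
    \<open>w\<close>.\<close>
  define C where "C = (cpoly N \<circ>\<^sub>p [:0, \<i>:]) * (cpoly D \<circ>\<^sub>p [:0, -\<i>:])"
  have C: "Re (poly C (of_real w)) = ?f w" for w
    using poly_cpoly_cnj[of D "?I w"] by (simp add: C_def poly_pcompose mult.commute)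
  \<comment> \<open>By \<open>f\<close>, twice the frequency response is at least twice \<delta>
    times the power sum, so \<open>p\<close> is strictly positive, as the factorization as a squared
    modulus requires.\<close>
  define p where "p = Polynomial.smult 2 (map_poly Re C) - (\<Sum>k\<le>d. monom \<delta> (2 * k))"
  have p: "poly p w = 2 * ?f w - \<delta> * (\<Sum>k\<le>d. w ^ (2 * k))" for w
    unfolding p_def poly_diff poly_smult poly_map_Re C by (simp add: poly_sum poly_monom sum_distrib_left)
  have ppos: "poly p w > 0" for w
  proof -
    have "(\<Sum>k\<in>{0}. w ^ (2 * k)) \<le> (\<Sum>k\<le>d. w ^ (2 * k))" by (rule sum_mono2) (auto simp: power_mult)
    then have "0 < \<delta> * (\<Sum>k\<le>d. w ^ (2 * k))" using \<delta> by simp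
    then show ?thesis unfolding p using f[of w] by linarith
  qed
  have even: "poly p (- w) = poly p w" for w
  proof -
    have "?f (- w) = Re (cnj (poly (cpoly N) (?I w)) * poly (cpoly D) (?I w))"
      using poly_cpoly_cnj[of D "?I w"] poly_cpoly_cnj[of N "?I w"] by simp
    also have "\<dots> = ?f w" by simp
    finally show ?thesis unfolding p by simp
  qed
  have degp: "degree p \<le> 2 * d + 1"
    unfolding p_def
  proof (rule degree_diff_le)
    have "degree C \<le> d + (d + 1)"
      unfolding C_def by (rule order_trans[OF degree_mult_le]) (use deg in \<open>simp add: degree_pcompose d_def\<close>)
    then have "degree (map_poly Re C) \<le> 2 * d + 1"
      using map_poly_degree_leq[of Re C] by simp
    then show "degree (Polynomial.smult 2 (map_poly Re C)) \<le> 2 * d + 1" by simp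
    show "degree (\<Sum>k\<le>d. monom \<delta> (2 * k)) \<le> 2 * d + 1"
      by (rule degree_sum_le) (auto intro: order_trans[OF degree_monom_le])
  qed
  obtain F where F: "2 * degree F = degree p" "\<And>w. poly p w = (cmod (poly F (of_real w)))\<^sup>2"
    using positive_poly_eq_norm_square[OF ppos] by blast
  have dF: "degree F \<le> d" using F(1) degp by linarith
  \<comment> \<open>The substitution moves the factor from the real variable \<open>w\<close> to the
    point of the imaginary axis. \<open>F\<close> picks an arbitrary root of every conjugate pair,
    so \<open>G\<close> has complex coefficients in general and is split into the real polynomials
    \<open>a\<close> and \<open>b\<close>.\<close>
  define G where "G = F \<circ>\<^sub>p [:0, -\<i>:]"
  have dG: "degree G \<le> d" using dF by (simp add: G_def degree_pcompose)
  define a where "a = map_poly Re G"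
  define b where "b = map_poly Im G"
  have "G = cpoly a + Polynomial.smult \<i> (cpoly b)"
    by (rule poly_eqI) (simp add: a_def b_def coeff_map_poly complex_eq_iff)
  then have G: "poly G s = poly (cpoly a) s + \<i> * poly (cpoly b) s" for s by simp
  \<comment> \<open>Adding the squared moduli of \<open>G\<close> at the frequencies
    \<open>w\<close> and \<open>- w\<close> removes the mixed terms of \<open>a\<close> and
    \<open>b\<close>; both are equal to \<open>poly p w\<close> because \<open>p\<close> is
    even.\<close>
  have key: "poly p w = (cmod (poly (cpoly a) (?I w)))\<^sup>2 + (cmod (poly (cpoly b) (?I w)))\<^sup>2" for w
  proof -
    let ?a = "poly (cpoly a) (?I w)" and ?b = "poly (cpoly b) (?I w)"
    have FG: "poly F (of_real w) = poly G (?I w)" for w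
    proof -
      have "- (\<i> * complex_of_real w * \<i>) = of_real w" by (simp add: complex_eq_iff)
      then show ?thesis by (simp add: G_def poly_pcompose)
    qed
    have "poly G (?I (- w)) = cnj ?a + \<i> * cnj ?b"
      unfolding G using poly_cpoly_cnj[of a "?I w"] poly_cpoly_cnj[of b "?I w"] by simp
    then have "poly p (- w) = (cmod (cnj ?a + \<i> * cnj ?b))\<^sup>2" unfolding F(2) FG by simp
    moreover have "poly p w = (cmod (?a + \<i> * ?b))\<^sup>2" unfolding F(2) FG G ..
    moreover have "(cmod (?a + \<i> * ?b))\<^sup>2 + (cmod (cnj ?a + \<i> * cnj ?b))\<^sup>2 = 2 * (cmod ?a)\<^sup>2 + 2 * (cmod ?b)\<^sup>2"
      unfolding cmod_power2 by (simp add: power2_eq_square algebra_simps)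
    ultimately show ?thesis using even[of w] by linarith
  qed
  define E where "E = N * reflect D + D * reflect N - a * reflect a - b * reflect b
    - (\<Sum>k\<le>d. Polynomial.smult \<delta> (monom 1 k * reflect (monom 1 k)))"
  have "poly (cpoly E) (?I w) = 0" for w
  proof -
    have cdiff: "poly (cpoly (p - q)) s = poly (cpoly p) s - poly (cpoly q) s" for p q s
      using poly_cpoly_add[of p "- q" s] poly_cpoly_smult[of "-1" q s] by simp
    have csum: "poly (cpoly (\<Sum>k\<le>(d::nat). u k)) s = (\<Sum>k\<le>d. poly (cpoly (u k)) s)" for u s
      by (induction d) auto
    have cmon: "poly (cpoly (monom 1 k)) s * cnj (poly (cpoly (monom 1 k)) s) = of_real ((cmod s) ^ (2 * k))" for k s
      by (simp add: map_poly_monom poly_monom power_mult_distrib[symmetric] complex_norm_square[symmetric] power_mult)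
    have 1: "N1 * cnj D1 + D1 * cnj N1 = of_real (2 * Re (N1 * cnj D1))" for N1 D1 by (simp add: complex_eq_iff)
    have "poly (cpoly E) (?I w) = of_real (2 * ?f w - (cmod (poly (cpoly a) (?I w)))\<^sup>2 - (cmod (poly (cpoly b) (?I w)))\<^sup>2
        - (\<Sum>k\<le>d. \<delta> * (cmod (?I w)) ^ (2 * k)))"
      unfolding E_def cdiff csum poly_cpoly_add poly_cpoly_mult poly_cpoly_smult poly_reflect_imaginary_axis cmon 1
      by (simp only: of_real_diff of_real_mult of_real_sum complex_norm_square)
    also have "\<dots> = of_real (2 * ?f w - \<delta> * (\<Sum>k\<le>d. w ^ (2 * k)) - poly p w)"
      unfolding key by (simp add: norm_mult power_mult sum_distrib_left)
    also have "\<dots> = 0" unfolding p by simp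
    finally show ?thesis .
  qed
  then have "range ?I \<subseteq> {s. poly (cpoly E) s = 0}" by auto
  moreover have "infinite (range ?I)"
    using infinite_UNIV_char_0[where 'a = real] by (simp add: finite_image_iff inj_def)
  ultimately have "infinite {s. poly (cpoly E) s = 0}" using infinite_super by blast
  then have "cpoly E = 0" using poly_roots_finite by blast
  then have "E = 0" by (metis coeff_cpoly coeff_0 of_real_eq_0_iff poly_eqI)
  show thesis
  proof (rule that[OF \<delta>])
    show "degree a \<le> degree N" "degree b \<le> degree N"
      using dG map_poly_degree_leq[of Re G] map_poly_degree_leq[of Im G] by (auto simp: a_def b_def d_def)
    fix m
    have mon: "(\<Sum>k\<le>d. \<delta> * (\<Sum>l\<le>m. (- 1) ^ l * (coeff (monom 1 k) (m - l) * coeff (monom 1 k) l))) =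
       (\<Sum>l\<le>m. (- 1) ^ l * (if m - l = l \<and> l \<le> d then \<delta> else 0))" (is "?L = ?R")
    proof -
      have "?L = (\<Sum>l\<le>m. \<Sum>k\<le>d. \<delta> * ((- 1) ^ l * (coeff (monom 1 k) (m - l) * coeff (monom 1 k) l)))"
        unfolding sum_distrib_left by (rule sum.swap)
      also have "\<dots> = ?R"
      proof (rule sum.cong[OF refl])
        fix l
        have "(\<Sum>k\<le>d. \<delta> * ((- 1) ^ l * (coeff (monom 1 k) (m - l) * coeff (monom 1 k) l)))
          = (\<Sum>k\<le>d. if k = l then (if m - l = l then \<delta> * (- 1) ^ l else 0) else 0)"
          by (rule sum.cong) auto
        also have "\<dots> = (- 1) ^ l * (if m - l = l \<and> l \<le> d then \<delta> else 0)" by (simp add: sum.delta)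
        finally show "(\<Sum>k\<le>d. \<delta> * ((- 1) ^ l * (coeff (monom 1 k) (m - l) * coeff (monom 1 k) l))) = \<dots>" .
      qed
      finally show ?thesis .
    qed
    have "0 = coeff E m" using \<open>E = 0\<close> by simp
    also have "coeff E m = (\<Sum>l\<le>m. (- 1) ^ l * (coeff N (m - l) * coeff D l + coeff D (m - l) * coeff N l - coeff a (m - l) * coeff a l
        - coeff b (m - l) * coeff b l - (if m - l = l \<and> l \<le> d then \<delta> else 0)))"
      unfolding E_def coeff_diff coeff_add coeff_sum coeff_smult coeff_mult_reflect mon
      by (simp add: right_diff_distrib distrib_left sum.distrib sum_subtractf)
    finally show "(\<Sum>l\<le>m. (- 1) ^ l * (coeff N (m - l) * coeff D l + coeff D (m - l) * coeff N l - coeff a (m - l) * coeff a l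
        - coeff b (m - l) * coeff b l - (if m - l = l \<and> l \<le> degree N then \<delta> else 0))) = 0"
      by (simp add: d_def)
  qed
qed


section \<open>The Kalman-Yakubovich-Popov lemma\<close>

text \<open>The observer form with denominator \<open>p\<close>: for monic \<open>p\<close> of
  degree \<open>n\<close> its characteristic polynomial is \<open>p\<close>.\<close>

definition companion :: "nat \<Rightarrow> 'a::comm_ring_1 poly \<Rightarrow> 'a mat" where
  "companion n p = mat n n (\<lambda>(i, j). (if i = j + 1 then 1 else 0) - (if j = n - 1 then coeff p i else 0))"

lemma companion_carrier [simp]: "companion n p \<in> carrier_mat n n"
  by (simp add: companion_def)

lemma companion_row_sum:
  fixes f :: "'a::comm_ring_1 \<Rightarrow> 'b::comm_ring_1"
  assumes "i < n" and f: "\<And>x y. f (x - y) = f x - f y" "f 0 = 0" "f 1 = 1"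
  shows "(\<Sum>j<n. f (companion n p $$ (i, j)) * x j) = (if i = 0 then 0 else x (i - 1)) - f (coeff p i) * x (n - 1)"
proof -
  have "(\<Sum>j<n. f (companion n p $$ (i, j)) * x j) =
      (\<Sum>j<n. (if i = j + 1 then x j else 0)) - (\<Sum>j<n. if j = n - 1 then f (coeff p i) * x j else 0)"
    using assms(1) unfolding sum_subtractf[symmetric]
    by (intro sum.cong) (auto simp: companion_def f left_diff_distrib)
  also have "(\<Sum>j<n. if i = j + 1 then x j else 0) = (if i = 0 then 0 else x (i - 1))"
  proof (cases i)
    case (Suc k)
    then have "(\<Sum>j<n. if i = j + 1 then x j else 0) = (\<Sum>j<n. if k = j then x j else 0)" by simp
    then show ?thesis using Suc assms(1) by simp
  qed simp
  also have "(\<Sum>j<n. if j = n - 1 then f (coeff p i) * x j else 0) = f (coeff p i) * x (n - 1)"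
    using assms(1) by simp
  finally show ?thesis .
qed

lemma companion_column_sum:
  assumes "j < n"
  shows "(\<Sum>i<n. companion n p $$ (i, j) * x i) =
    (if j + 1 < n then x (j + 1) else 0) - (if j = n - 1 then (\<Sum>i<n. coeff p i * x i) else 0)"
proof -
  have "(\<Sum>i<n. companion n p $$ (i, j) * x i) =
      (\<Sum>i<n. (if i = j + 1 then x i else 0)) - (\<Sum>i<n. if j = n - 1 then coeff p i * x i else 0)"
    using assms(1) unfolding sum_subtractf[symmetric]
    by (intro sum.cong) (auto simp: companion_def left_diff_distrib)
  then show ?thesis by simp
qed

text \<open>Weighting row i of the eigenvector equation by s^i and summing telescopes to p(s) times
  the last entry. This entry cannot vanish: the rows, read from the last one up, would make all
  other entries 0 as well.\<close>

lemma hurwitz_companion: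
  assumes deg: "degree p = n" and monic: "lead_coeff p = 1" and roots: "\<And>s. poly (cpoly p) s = 0 \<Longrightarrow> Re s < 0"
  shows "hurwitz (companion n p)"
  unfolding hurwitz_def
proof (intro allI impI)
  fix s assume "eigenvalue (map_mat complex_of_real (companion n p)) s"
  then obtain v where v: "v \<in> carrier_vec n" "v \<noteq> 0\<^sub>v n"
    "map_mat complex_of_real (companion n p) *\<^sub>v v = s \<cdot>\<^sub>v v"
    by (auto simp: eigenvalue_def eigenvector_def companion_def)
  have eq: "(if i = 0 then 0 else v $ (i - 1)) - of_real (coeff p i) * v $ (n - 1) = s * v $ i" if "i < n" for i
  proof -
    have "(map_mat complex_of_real (companion n p) *\<^sub>v v) $ i = (\<Sum>j<n. complex_of_real (companion n p $$ (i, j)) * v $ j)"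
      using that v(1) by (auto simp: scalar_prod_def lessThan_atLeast0 carrier_matD[OF companion_carrier])
    then show ?thesis using companion_row_sum[OF that, of complex_of_real p "\<lambda>j. v $ j"] v that by simp
  qed
  have "poly (cpoly p) s * v $ (n - 1) = 0"
  proof (cases "n = 0")
    case True
    then have "v = 0\<^sub>v n" using v(1) by auto
    then show ?thesis using v by simp
  next
    case False
    have "(\<Sum>i<n. s ^ i * ((if i = 0 then 0 else v $ (i - 1)) - of_real (coeff p i) * v $ (n - 1)))
      = (\<Sum>i<n. s ^ i * (s * v $ i))" using eq by (intro sum.cong) auto
    moreover have "(\<Sum>i<n. s ^ i * (if i = 0 then 0 else v $ (i - 1))) = (\<Sum>i<n. s ^ i * (s * v $ i)) - s ^ n * v $ (n - 1)"
    proof -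
      obtain k where k: "n = Suc k" using False by (cases n) auto
      have "(\<Sum>i<n. s ^ i * (if i = 0 then 0 else v $ (i - 1))) = (\<Sum>i<k. s ^ Suc i * v $ i)"
        unfolding k by (subst sum.lessThan_Suc_shift) simp
      then show ?thesis unfolding k by (simp add: algebra_simps)
    qed
    ultimately have "s ^ n * v $ (n - 1) + (\<Sum>i<n. s ^ i * of_real (coeff p i)) * v $ (n - 1) = 0"
      by (simp add: right_diff_distrib sum_subtractf sum_distrib_right mult.assoc add_eq_0_iff)
    moreover have "poly (cpoly p) s = s ^ n + (\<Sum>i<n. s ^ i * of_real (coeff p i))"
      using deg monic by (simp add: poly_altdef lessThan_Suc_atMost[symmetric] mult.commute)
    ultimately show ?thesis by (simp add: distrib_right)
  qed
  moreover have "v $ (n - 1) \<noteq> 0"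
  proof
    assume 0: "v $ (n - 1) = 0"
    have "v $ (n - 1 - k) = 0" if "k < n" for k
      using that
    proof (induction k)
      case (Suc k)
      then show ?case using eq[of "n - 1 - k"] 0 by (auto split: if_splits)
    qed (use 0 in simp)
    then have "v $ i = 0" if "i < n" for i
      using that diff_diff_cancel[of i "n - 1"] by (metis Suc_diff_1 diff_less_Suc less_imp_Suc_add not_less_eq zero_less_Suc less_Suc_eq_le)
    then show False using v by auto
  qed
  ultimately show "Re s < 0" using roots by simp
qed

lemma hurwitz_transpose:
  assumes A: "A \<in> carrier_mat n n" and "hurwitz A"
  shows "hurwitz (transpose_mat A)"
proof -
  have A': "map_mat complex_of_real A \<in> carrier_mat n n" using A by simp
  have T: "map_mat complex_of_real (transpose_mat A) = transpose_mat (map_mat complex_of_real A)" using A by auto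
  show ?thesis
    using assms(2) eigenvalue_root_char_poly[OF A'] eigenvalue_root_char_poly[OF transpose_carrier_mat[THEN iffD2, OF A']]
      char_poly_transpose_mat[OF A']
    unfolding hurwitz_def T by simp
qed

text \<open>\<open>antidiag\<close> is the spectral factorization compared at the power m.
  Alternating antidiagonal sums of a coefficient matrix vanish exactly if its polynomial in x and y
  is 0 at y = -x.\<close>

locale kyp_kernel =
  fixes n :: nat and N D a b :: "real poly" and \<delta> :: real
  assumes monic: "lead_coeff N = 1" "lead_coeff D = 1" and deg: "degree D = n" "degree D = degree N + 1"
    and D0: "\<And>s. poly (cpoly D) s = 0 \<Longrightarrow> Re s < 0"
    and \<delta>: "\<delta> > 0" and ab: "degree a < n" "degree b < n"
    and antidiag: "\<And>m. (\<Sum>l\<le>m. (- 1) ^ l * (coeff N (m - l) * coeff D l + coeff D (m - l) * coeff N l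
        - coeff a (m - l) * coeff a l - coeff b (m - l) * coeff b l - (if m - l = l \<and> l < n then \<delta> else 0))) = 0"
begin

text \<open>\<open>S\<close> is two squares plus \<delta> times the identity on the indices below
  \<open>n\<close>, hence positive definite there; it becomes the right hand side of the Lyapunov
  equation.\<close>

definition "S i j = coeff a i * coeff a j + coeff b i * coeff b j + (if i = j \<and> j < n then \<delta> else 0)"
definition "K i j = coeff N i * coeff D j + coeff D i * coeff N j - S i j"

text \<open>\<open>G\<close> holds the coefficients of the quotient of \<open>\<Sum>\<^sub>i\<^sub>j K i j x\<^sup>i y\<^sup>j\<close> by \<open>x + y\<close>; the division is exact because
  \<open>antidiag\<close> says that the dividend vanishes at \<open>y = - x\<close>.\<close>

definition "G i j = (\<Sum>k\<le>i. (- 1) ^ k * K (i - k) (j + 1 + k))"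

lemma n: "n > 0" and dN: "degree N = n - 1" using deg by auto

lemma K_sym: "K i j = K j i" by (auto simp: K_def S_def)

lemma K_0: "j > n \<Longrightarrow> K i j = 0"
  using deg ab by (simp add: K_def S_def coeff_eq_0)

lemma K_antidiag: "(\<Sum>l\<le>m. (- 1) ^ l * K (m - l) l) = 0"
  using antidiag[of m] by (simp add: K_def S_def algebra_simps)

lemma G_rec: "G i j + (if i = 0 then 0 else G (i - 1) (j + 1)) = K i (j + 1)"
proof (cases i)
  case (Suc i')
  have "G i j = K i (j + 1) + (\<Sum>k\<le>i'. (- 1) ^ Suc k * K (i' - k) (j + 1 + Suc k))"
    unfolding G_def Suc by (subst sum.atMost_Suc_shift) simp
  also have "(\<Sum>k\<le>i'. (- 1) ^ Suc k * K (i' - k) (j + 1 + Suc k)) = - G i' (j + 1)"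
    unfolding G_def sum_negf[symmetric] by (intro sum.cong) auto
  finally show ?thesis by (simp add: Suc)
qed (simp add: G_def)

text \<open>The quotient of a symmetric polynomial by x + y is symmetric. On coefficients, the
  alternating sum of \<open>K\<close> over the antidiagonal \<open>i + j + 1\<close> is cut after
  \<open>l = j\<close>: its two parts are \<open>G j i\<close> and \<open>G i j\<close> with
  opposite signs.\<close>

lemma G_sym: "G i j = G j i"
proof -
  let ?f = "\<lambda>l. (- 1) ^ l * K (i + j + 1 - l) l"
  have "{..i+j+1} = {..j} \<union> {j+1..i+j+1}" by auto
  then have "0 = (\<Sum>l\<le>j. ?f l) + (\<Sum>l=j+1..i+j+1. ?f l)"
    using K_antidiag[of "i+j+1"] by (simp add: sum.union_disjoint ivl_disj_int)
  also have "(\<Sum>l=j+1..i+j+1. ?f l) = (\<Sum>k\<le>i. ?f (j + 1 + k))"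
    by (rule sum.reindex_bij_witness[of _ "\<lambda>k. j + 1 + k" "\<lambda>l. l - (j + 1)"]) auto
  also have "\<dots> = (- 1) ^ (j + 1) * G i j"
    unfolding G_def sum_distrib_left by (intro sum.cong) (auto simp: power_add)
  also have "(\<Sum>l\<le>j. ?f l) = (\<Sum>k\<le>j. ?f (j - k))"
    by (rule sum.reindex_bij_witness[of _ "\<lambda>k. j - k" "\<lambda>l. j - l"]) auto
  also have "\<dots> = (- 1) ^ j * G j i"
    unfolding G_def sum_distrib_left
  proof (intro sum.cong refl)
    fix k assume k: "k \<in> {..j}"
    then have "i + j + 1 - (j - k) = i + 1 + k" by auto
    moreover have "(- 1 :: real) ^ (j - k) = (- 1) ^ j * (- 1) ^ k"
      using k by (simp add: power_diff_conv_inverse power_inverse)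
    ultimately show "?f (j - k) = (- 1) ^ j * ((- 1) ^ k * K (j - k) (i + 1 + k))"
      using K_sym by simp
  qed
  finally have "(- 1) ^ j * (G j i - G i j) = 0" by (simp add: algebra_simps)
  then show ?thesis by simp
qed

text \<open>Only the summand \<open>k = 0\<close> survives, as \<open>K\<close> vanishes beyond
  column \<open>n\<close>, and \<open>K i n\<close> reduces to \<open>coeff N i\<close> because
  \<open>D\<close> is monic of degree \<open>n\<close> while \<open>N\<close>, \<open>a\<close>,
  \<open>b\<close> have smaller degree. For the inverse matrix this becomes the KYP condition that
  it maps the input vector to the output vector.\<close>

lemma G_last: assumes "i < n" shows "G i (n - 1) = coeff N i"
proof -
  have "G i (n - 1) = (\<Sum>k\<le>i. if k = 0 then K i n else 0)"
    unfolding G_def using n by (intro sum.cong) (auto simp: K_0)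
  also have "\<dots> = K i n" by simp
  also have "\<dots> = coeff N i"
    using assms monic deg dN n ab by (simp add: K_def S_def coeff_eq_0)
  finally show ?thesis .
qed

text \<open>Multiplication of the quotient by x + y restores the dividend; multiplication by x or y
  is the shift part of the companion matrix.\<close>

lemma G_lyapunov:
  assumes "i < n" "j < n"
  shows "(if i = 0 then 0 else G (i - 1) j) + (if j = 0 then 0 else G i (j - 1)) = K i j"
proof (cases j)
  case (Suc j')
  then show ?thesis using G_rec[of i j'] by (auto simp: add.commute)
next
  case 0
  show ?thesis
  proof (cases i)
    case 0
    then show ?thesis using \<open>j = 0\<close> K_antidiag[of 0] by simp
  next
    case (Suc i')
    have "G i' 0 = G 0 i'" by (rule G_sym)
    also have "\<dots> = K 0 i" using G_rec[of 0 i'] Suc by simp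
    finally show ?thesis using \<open>j = 0\<close> Suc K_sym[of 0 i] by simp
  qed
qed

text \<open>The form of \<open>G\<close>, the inverse of the matrix sought, and therefore a Lyapunov
  function of the transposed system, whose vector field is \<open>adj\<close>.\<close>

definition W :: "(nat \<Rightarrow> real) \<Rightarrow> real" where
  "W y = (\<Sum>i<n. \<Sum>j<n. G i j * y i * y j)"

definition adj :: "(nat \<Rightarrow> real) \<Rightarrow> nat \<Rightarrow> real" where
  "adj y j = (\<Sum>i<n. companion n D $$ (i, j) * y i)"

lemma S_quadratic: "(\<Sum>i<n. \<Sum>j<n. S i j * y i * y j) \<ge> \<delta> * (\<Sum>i<n. (y i)\<^sup>2)"
proof -
  have sq: "(\<Sum>i<n. \<Sum>j<n. u i * u j * y i * y j) = (\<Sum>i<n. u i * y i)\<^sup>2" for u :: "nat \<Rightarrow> real"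
    by (simp add: power2_eq_square sum_product algebra_simps)
  have "(\<Sum>i<n. \<Sum>j<n. S i j * y i * y j) = (\<Sum>i<n. coeff a i * y i)\<^sup>2 + (\<Sum>i<n. coeff b i * y i)\<^sup>2
     + (\<Sum>i<n. \<Sum>j<n. if i = j then \<delta> * y i * y j else 0)"
    unfolding sq[symmetric] sum.distrib[symmetric] by (intro sum.cong refl) (auto simp: S_def algebra_simps)
  also have "(\<Sum>i<n. \<Sum>j<n. if i = j then \<delta> * y i * y j else 0) = \<delta> * (\<Sum>i<n. (y i)\<^sup>2)"
    by (simp add: sum_distrib_left power2_eq_square mult.assoc)
  finally show ?thesis by simp
qed

lemma adj_eq:
  "j < n \<Longrightarrow> adj y j = (if j + 1 < n then y (j + 1) else 0) - (if j = n - 1 then (\<Sum>i<n. coeff D i * y i) else 0)"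
  by (simp add: adj_def companion_column_sum)

lemma G_adj:
  assumes "i < n"
  shows "(\<Sum>j<n. G i j * adj y j) = (\<Sum>j<n. ((if j = 0 then 0 else G i (j - 1)) - coeff N i * coeff D j) * y j)"
proof -
  have "(\<Sum>j<n. G i j * adj y j) = (\<Sum>j<n. G i j * (if j + 1 < n then y (j + 1) else 0))
      - (\<Sum>j<n. if j = n - 1 then G i j * (\<Sum>k<n. coeff D k * y k) else 0)"
    unfolding sum_subtractf[symmetric] by (intro sum.cong) (auto simp: adj_eq algebra_simps)
  also have "(\<Sum>j<n. if j = n - 1 then G i j * (\<Sum>k<n. coeff D k * y k) else 0) = coeff N i * (\<Sum>k<n. coeff D k * y k)"
    using n G_last[OF assms] by simp
  also have "(\<Sum>j<n. G i j * (if j + 1 < n then y (j + 1) else 0)) = (\<Sum>j<n. (if j = 0 then 0 else G i (j - 1)) * y j)"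
  proof -
    obtain m where m: "n = Suc m" using n by (cases n) auto
    show ?thesis unfolding m by (subst (2) sum.lessThan_Suc_shift) simp
  qed
  finally show ?thesis by (simp add: sum_subtractf sum_distrib_left left_diff_distrib mult.assoc)
qed

text \<open>In matrix form A G + G A^T = -S for the companion matrix A. By \<open>G_adj\<close> the
  shift and the last column of A turn one half into \<open>c\<close>; symmetrizing \<open>c\<close>
  yields \<open>K\<close> minus the products of coefficients of \<open>N\<close> and
  \<open>D\<close>, which is -S.\<close>

lemma W_derivative: "2 * (\<Sum>i<n. \<Sum>j<n. G i j * y i * adj y j) = - (\<Sum>i<n. \<Sum>j<n. S i j * y i * y j)"
proof -
  define c where "c i j = (if j = 0 then 0 else G i (j - 1)) - coeff N i * coeff D j" for i j
  have 1: "(\<Sum>i<n. \<Sum>j<n. G i j * y i * adj y j) = (\<Sum>i<n. \<Sum>j<n. c i j * y i * y j)"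
  proof (rule sum.cong[OF refl])
    fix i assume "i \<in> {..<n}"
    then have "(\<Sum>j<n. G i j * adj y j) = (\<Sum>j<n. c i j * y j)" using G_adj c_def by simp
    then have "y i * (\<Sum>j<n. G i j * adj y j) = y i * (\<Sum>j<n. c i j * y j)" by simp
    then show "(\<Sum>j<n. G i j * y i * adj y j) = (\<Sum>j<n. c i j * y i * y j)"
      by (simp add: sum_distrib_left mult_ac)
  qed
  have 2: "(\<Sum>i<n. \<Sum>j<n. c i j * y i * y j) = (\<Sum>i<n. \<Sum>j<n. c j i * y i * y j)"
    by (subst sum.swap) (simp add: mult_ac)
  have "2 * (\<Sum>i<n. \<Sum>j<n. G i j * y i * adj y j) = (\<Sum>i<n. \<Sum>j<n. (c i j + c j i) * y i * y j)"
    unfolding 1 mult_2 using 2 by (simp add: sum.distrib distrib_right)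
  also have "\<dots> = - (\<Sum>i<n. \<Sum>j<n. S i j * y i * y j)"
    unfolding sum_negf[symmetric]
  proof (intro sum.cong refl)
    fix i j assume ij: "i \<in> {..<n}" "j \<in> {..<n}"
    have "c i j + c j i = K i j - coeff N i * coeff D j - coeff N j * coeff D i"
      using G_lyapunov[of i j] ij G_sym unfolding c_def by auto
    also have "\<dots> = - S i j" by (simp add: K_def)
    finally show "(c i j + c j i) * y i * y j = - (S i j * y i * y j)" by simp
  qed
  finally show ?thesis .
qed

lemma W_bound: "\<bar>W y\<bar> \<le> (\<Sum>i<n. \<Sum>j<n. \<bar>G i j\<bar>) * (\<Sum>i<n. (y i)\<^sup>2)"
proof -
  have le: "\<bar>y i * y j\<bar> \<le> (\<Sum>i<n. (y i)\<^sup>2)" if "i < n" "j < n" for i j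
  proof -
    have "(y i)\<^sup>2 \<le> (\<Sum>i<n. (y i)\<^sup>2)" "(y j)\<^sup>2 \<le> (\<Sum>i<n. (y i)\<^sup>2)"
      using that by (auto intro!: member_le_sum[of _ "{..<n}" "\<lambda>i. (y i)\<^sup>2"])
    moreover have "2 * \<bar>y i * y j\<bar> \<le> (y i)\<^sup>2 + (y j)\<^sup>2"
      using sum_squares_bound[of "\<bar>y i\<bar>" "\<bar>y j\<bar>"] by (simp add: abs_mult)
    ultimately show ?thesis by linarith
  qed
  have "\<bar>W y\<bar> \<le> (\<Sum>i<n. \<Sum>j<n. \<bar>G i j * y i * y j\<bar>)"
    unfolding W_def by (rule order_trans[OF sum_abs sum_mono[OF sum_abs]])
  also have "\<dots> \<le> (\<Sum>i<n. \<Sum>j<n. \<bar>G i j\<bar> * (\<Sum>i<n. (y i)\<^sup>2))"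
    using le by (intro sum_mono) (auto simp: abs_mult mult.assoc intro!: mult_left_mono)
  finally show ?thesis by (simp add: sum_distrib_right)
qed

end

context kyp_kernel begin

lemma S_quadratic_sum_le:
  "2 * (\<Sum>i<n. \<Sum>j<n. G i j * y i * adj y j) \<le> - \<delta> * (\<Sum>i<n. (y i)\<^sup>2)"
  using S_quadratic[of y] W_derivative[of y] by simp

lemma S_quadratic_sum_nonpos: "(\<Sum>i<n. \<Sum>j<n. G i j * y i * adj y j) \<le> 0"
proof -
  have "0 \<le> \<delta> * (\<Sum>i<n. (y i)\<^sup>2)" using \<delta> by (intro mult_nonneg_nonneg sum_nonneg) auto
  then show ?thesis using S_quadratic_sum_le[of y] by linarith
qed

lemma W_has_derivative:
  assumes "\<And>i. i < n \<Longrightarrow> ((\<lambda>t. x t i) has_real_derivative x' i) (at t)"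
  shows "((\<lambda>t. W (x t)) has_real_derivative 2 * (\<Sum>i<n. \<Sum>j<n. G i j * x t i * x' j)) (at t)"
proof -
  have "((\<lambda>t. W (x t)) has_real_derivative (\<Sum>i<n. \<Sum>j<n. G i j * x' i * x t j + G i j * x t i * x' j)) (at t)"
    unfolding W_def by (rule DERIV_sum)+ (auto intro!: derivative_eq_intros assms simp: algebra_simps)
  moreover have "(\<Sum>i<n. \<Sum>j<n. G i j * x' i * x t j) = (\<Sum>i<n. \<Sum>j<n. G i j * x t i * x' j)"
    by (subst sum.swap) (simp add: G_sym mult_ac)
  ultimately show ?thesis by (simp add: sum.distrib)
qed

text \<open>If \<open>W v < 0\<close>, then \<open>W\<close> decreases at least linearly along the adjoint flow started at \<open>v\<close>, which is
  impossible because the flow is bounded.\<close>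

lemma W_nonneg: "W v \<ge> 0"
proof (rule ccontr)
  assume neg: "\<not> W v \<ge> 0"
  define A where "A = transpose_mat (companion n D)"
  have A: "A \<in> carrier_mat n n" by (simp add: A_def)
  have hA: "hurwitz A" unfolding A_def by (rule hurwitz_transpose[OF companion_carrier hurwitz_companion[OF deg(1) monic(2) D0]])
  have adjA: "adj y i = (\<Sum>j<n. A $$ (i, j) * y j)" if "i < n" for y i
    using that by (simp add: adj_def A_def companion_def)
  define L where "L = (\<Sum>i<n. \<Sum>j<n. \<bar>A $$ (i, j)\<bar>)"
  have Lij: "\<bar>A $$ (i, j)\<bar> \<le> L" if "i < n" "j < n" for i j
  proof -
    have "\<bar>A $$ (i, j)\<bar> \<le> (\<Sum>j<n. \<bar>A $$ (i, j)\<bar>)" using that by (intro member_le_sum) auto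
    also have "\<dots> \<le> L" unfolding L_def using that by (intro member_le_sum[of i "{..<n}" "\<lambda>i. \<Sum>j<n. \<bar>A $$ (i, j)\<bar>"] sum_nonneg) auto
    finally show ?thesis .
  qed
  have L: "L \<ge> 0" by (simp add: L_def sum_nonneg)
  obtain x where x: "\<And>i. i \<in> {..<n} \<Longrightarrow> x 0 i = v i" "\<And>i. i \<in> {..<n} \<Longrightarrow> continuous_on {0..} (\<lambda>t. x t i)"
    "\<And>t i. t \<ge> 0 \<Longrightarrow> t \<notin> {} \<Longrightarrow> i \<in> {..<n} \<Longrightarrow> ((\<lambda>t. x t i) has_real_derivative adj (x t) i) (at t within {0..})"
  proof (rule picard_lindeloef_global[of "{..<n}" L "\<lambda>t. adj" v "\<Sum>j<n. L * \<bar>v j\<bar>" "{}"])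
    show "\<bar>adj x i - adj y i\<bar> \<le> L * (\<Sum>j\<in>{..<n}. \<bar>x j - y j\<bar>)" if "i \<in> {..<n}" for x y i
    proof -
      have "adj x i - adj y i = (\<Sum>j<n. A $$ (i, j) * (x j - y j))"
        using that by (simp add: adjA right_diff_distrib sum_subtractf)
      also have "\<bar>\<dots>\<bar> \<le> (\<Sum>j<n. L * \<bar>x j - y j\<bar>)"
        using that Lij by (intro order_trans[OF sum_abs sum_mono]) (auto simp: abs_mult intro!: mult_right_mono)
      finally show ?thesis by (simp add: sum_distrib_left)
    qed
    show "\<bar>adj v i\<bar> \<le> (\<Sum>j<n. L * \<bar>v j\<bar>)" if "i \<in> {..<n}" for i
      using that Lij by (simp add: adjA, intro order_trans[OF sum_abs sum_mono]) (auto simp: abs_mult intro!: mult_right_mono)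
    show "continuous (at t within {0..}) (\<lambda>t. adj (X t) i)"
      if "\<And>j. j \<in> {..<n} \<Longrightarrow> continuous_on {0..} (\<lambda>t. X t j)" "t \<ge> 0" for X i and t :: real
    proof -
      have "continuous_on {0..} (\<lambda>t. adj (X t) i)" unfolding adj_def by (intro continuous_intros that) auto
      then show ?thesis using that(2) by (simp add: continuous_on_eq_continuous_within)
    qed
  qed (use L in auto)
  have deriv: "((\<lambda>t. x t i) has_real_derivative adj (x t) i) (at t)" if "t > 0" "i < n" for t i
    using x(3)[of t i] that at_within_interior[of t "{0::real..}"] by simp
  define M where "M = (\<Sum>i<n. \<bar>v i\<bar>)"
  obtain Q where Q: "Q \<ge> 0 \<and> (\<forall>T M x g. linear_traj (\<lambda>i j. A $$ (i, j)) n T M x g \<longrightarrow>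
    (\<forall>t\<in>{0..T}. \<forall>i<n. \<bar>x t i\<bar> \<le> Q * M))"
    using hurwitz_bounded_input_bounded_state[OF A hA] by (rule exE)
  have xb: "\<bar>x t i\<bar> \<le> Q * M" if "t \<ge> 0" "i < n" for t i
  proof -
    have "linear_traj (\<lambda>i j. A $$ (i, j)) n t M x (\<lambda>_ _. 0)"
      unfolding linear_traj_def
    proof (intro conjI exI[of _ "{}"] ballI allI impI)
      fix s i assume "s \<in> {0<..<t} - {}" "i < n"
      then show "((\<lambda>t. x t i) has_vector_derivative (\<Sum>j<n. A $$ (i, j) * x s j) + 0) (at s)"
        using deriv[of s i] by (simp add: adjA has_real_derivative_iff_has_vector_derivative)
    next
      fix i assume i: "i < n"
      show "continuous_on {0..t} (\<lambda>t. x t i)" using x(2)[of i] i by (auto intro: continuous_on_subset)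
      show "norm (x 0 i) \<le> M"
        using x(1)[of i] i member_le_sum[of i "{..<n}" "\<lambda>i. \<bar>v i\<bar>"] by (simp add: M_def)
    qed (auto simp: M_def sum_nonneg)
    from Q[THEN conjunct2, rule_format, OF this, of t i] that show ?thesis by simp
  qed
  define C where "C = (\<Sum>i<n. \<Sum>j<n. \<bar>G i j\<bar>)"
  define E where "E y = (\<Sum>i<n. (y i)\<^sup>2)" for y :: "nat \<Rightarrow> real"
  have C: "C \<ge> 0" by (simp add: C_def sum_nonneg)
  have WE: "\<bar>W y\<bar> \<le> C * E y" for y using W_bound by (simp add: C_def E_def)
  define R where "R = C * (real n * (Q * M)\<^sup>2)"
  have Wb: "\<bar>W (x t)\<bar> \<le> R" if "t \<ge> 0" for t
  proof -
    have "E (x t) \<le> (\<Sum>i<n. (Q * M)\<^sup>2)" unfolding E_def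
      using xb[OF that] by (intro sum_mono) (auto simp: abs_le_square_iff[symmetric] intro: order_trans[OF _ abs_ge_self])
    then show ?thesis unfolding R_def using C WE[of "x t"] mult_left_mono[of "E (x t)" _ C] by fastforce
  qed
  have W0: "W (x 0) = W v" unfolding W_def using x(1) by (intro sum.cong) auto
  have Wc: "continuous_on {0..t} (\<lambda>t. W (x t))" for t
  proof -
    have "continuous_on {0..t} (\<lambda>t. x t i)" if "i < n" for i
      by (rule continuous_on_subset[OF x(2)]) (use that in auto)
    then show ?thesis unfolding W_def by (intro continuous_intros) auto
  qed
  have Wd: "((\<lambda>t. W (x t)) has_real_derivative 2 * (\<Sum>i<n. \<Sum>j<n. G i j * x t i * adj (x t) j)) (at t)" if "t > 0" for t
    by (rule W_has_derivative) (use deriv that in auto)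
  have mono: "W (x t) \<le> W v" if "t \<ge> 0" for t
  proof -
    have "W (x t) - W (x 0) \<le> 0 - 0"
      by (rule increment_le[of "{}" 0 t, OF _ that Wc Wd, where g = "\<lambda>_. 0" and g' = "\<lambda>_. 0"])
        (use S_quadratic_sum_nonpos in auto)
    then show ?thesis by (simp add: W0)
  qed
  have Cpos: "C > 0" using C WE[of v] neg by (cases "C = 0") auto
  \<comment> \<open>Along the flow \<open>W\<close> stays at most \<open>W v < 0\<close>, so by
    \<open>WE\<close> the squared norm of the state is at least \<open>- W v / C\<close>, and the
    derivative of \<open>W\<close> is at most - \<delta> times it.\<close>
  define c where "c = \<delta> * (- W v / C)"
  have c: "c > 0" using \<delta> neg Cpos by (simp add: c_def divide_neg_pos mult_pos_neg)
  have decr: "W (x t) \<le> W v - c * t" if "t \<ge> 0" for t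
  proof -
    have "W (x t) - W (x 0) \<le> (- c * t) - (- c * 0)"
    proof (rule increment_le[of "{}" 0 t, OF _ that Wc Wd, where g' = "\<lambda>_. - c"])
      show "continuous_on {0..t} ((*) (- c))" by (intro continuous_intros)
      show "((*) (- c) has_real_derivative - c) (at s)" for s by (auto intro!: derivative_eq_intros)
      fix s assume "s \<in> {0<..<t} - {}"
      then have "- W v \<le> C * E (x s)" using mono[of s] WE[of "x s"] by auto
      then have "- W v / C \<le> E (x s)" using Cpos by (simp add: field_simps)
      then have "c \<le> \<delta> * E (x s)" unfolding c_def using \<delta> by (intro mult_left_mono) auto
      then show "2 * (\<Sum>i<n. \<Sum>j<n. G i j * x s i * adj (x s) j) \<le> - c"
        using S_quadratic_sum_le[of "x s"] by (simp add: E_def)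
    qed auto
    then show ?thesis by (simp add: W0)
  qed
  \<comment> \<open>By this time \<open>W\<close> would have dropped to \<open>W v - R - 1\<close>
    or less, which is below the bound \<open>- R\<close> valid along the bounded flow.\<close>
  define t where "t = (R + 1) / c"
  have "R \<ge> 0" using C by (simp add: R_def)
  then have t: "t \<ge> 0" using c by (simp add: t_def)
  have "c * t = R + 1" using c by (simp add: t_def)
  then show False using decr[OF t] Wb[OF t] neg by linarith
qed

text \<open>For a kernel vector the derivative of \<open>W\<close> along the adjoint flow is 0,
  whereas it is at most - \<delta> times the squared norm of \<open>v\<close>.\<close>

lemma G_injective:
  assumes "\<And>i. i < n \<Longrightarrow> (\<Sum>j<n. G i j * v j) = 0" and "k < n"
  shows "v k = 0"
proof -
  have "(\<Sum>i<n. \<Sum>j<n. G i j * v i * adj v j) = (\<Sum>j<n. (\<Sum>i<n. G j i * v i) * adj v j)"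
    by (subst sum.swap) (simp add: sum_distrib_right G_sym)
  also have "\<dots> = 0" using assms(1) by simp
  finally have "\<delta> * (\<Sum>i<n. (v i)\<^sup>2) \<le> 0" using S_quadratic_sum_le[of v] by simp
  then have "(\<Sum>i<n. (v i)\<^sup>2) \<le> 0" using \<delta> by (simp add: mult_le_0_iff)
  then have "(\<Sum>i<n. (v i)\<^sup>2) = 0" using sum_nonneg[of "{..<n}" "\<lambda>i. (v i)\<^sup>2"] by simp
  then show ?thesis using assms(2) by (simp add: sum_nonneg_eq_0_iff)
qed

text \<open>\<open>P\<close> is the inverse of \<open>G\<close>. With \<open>p x\<close> for the
  product of \<open>P\<close> and x, every claim on \<open>P\<close> at x is a claim on
  \<open>G\<close> at \<open>p x\<close>: the Lyapunov inequality is that of \<open>W\<close>, and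
  the input condition is \<open>G_last\<close>.\<close>

lemma kyp_solution:
  obtains P :: "nat \<Rightarrow> nat \<Rightarrow> real" and \<kappa> where "\<kappa> > 0"
    "\<And>i j. i < n \<Longrightarrow> j < n \<Longrightarrow> P i j = P j i"
    "\<And>i. i < n \<Longrightarrow> (\<Sum>j<n. P i j * coeff N j) = (if i = n - 1 then 1 else 0)"
    "\<And>x. (x (n - 1))\<^sup>2 \<le> (\<Sum>i<n. \<Sum>j<n. P i j * x i * x j)"
    "\<And>x. 2 * (\<Sum>i<n. \<Sum>j<n. P i j * x i * (\<Sum>k<n. companion n D $$ (j, k) * x k)) \<le> - \<kappa> * (x (n - 1))\<^sup>2"
proof -
  define M where "M = mat n n (\<lambda>(i, j). G i j)"
  have M: "M \<in> carrier_mat n n" by (simp add: M_def)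
  have "det M \<noteq> 0"
  proof
    assume "det M = 0"
    then obtain v where v: "v \<in> carrier_vec n" "v \<noteq> 0\<^sub>v n" "M *\<^sub>v v = 0\<^sub>v n"
      using det_0_iff_vec_prod_zero_field[OF M] by auto
    have "(\<Sum>j<n. G i j * v $ j) = 0" if "i < n" for i
    proof -
      have "(M *\<^sub>v v) $ i = (\<Sum>j<n. G i j * v $ j)"
        using that v(1) by (auto simp: M_def scalar_prod_def lessThan_atLeast0)
      then show ?thesis using v that by simp
    qed
    from G_injective[OF this] have "v = 0\<^sub>v n" using v(1) by auto
    then show False using v by simp
  qed
  then obtain B where B: "B \<in> carrier_mat n n" "B * M = 1\<^sub>m n" "M * B = 1\<^sub>m n"
    using det_non_zero_imp_unit[OF M, of "()"] by (auto simp: Units_def ring_mat_def)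
  define P where "P i j = B $$ (i, j)" for i j
  have mult: "(X * Y) $$ (i, j) = (\<Sum>l<n. X $$ (i, l) * Y $$ (l, j))"
    if "X \<in> carrier_mat n n" "Y \<in> carrier_mat n n" "i < n" "j < n" for X Y :: "real mat" and i j
    using that by (auto simp: scalar_prod_def lessThan_atLeast0)
  have PG: "(\<Sum>k<n. P i k * G k j) = (if i = j then 1 else 0)" if "i < n" "j < n" for i j
    using mult[OF B(1) M that] that unfolding B(2) by (simp add: P_def M_def)
  have GP: "(\<Sum>k<n. G i k * P k j) = (if i = j then 1 else 0)" if "i < n" "j < n" for i j
    using mult[OF M B(1) that] that unfolding B(3) by (simp add: P_def M_def)
  have sym: "P i j = P j i" if ij: "i < n" "j < n" for i j
  proof -
    have "P j i = (\<Sum>k<n. (\<Sum>l<n. P i l * G l k) * P j k)" using ij by (simp add: PG if_distrib[of "\<lambda>u. u * _"] cong: if_cong)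
    also have "\<dots> = (\<Sum>l<n. P i l * (\<Sum>k<n. P j k * G k l))"
      unfolding sum_distrib_left sum_distrib_right by (subst sum.swap) (simp add: G_sym mult_ac)
    also have "\<dots> = P i j" using ij by (simp add: PG if_distrib[of "(*) _"] cong: if_cong)
    finally show ?thesis ..
  qed
  define p where "p x i = (\<Sum>j<n. P i j * x j)" for x i
  have xp: "x i = (\<Sum>j<n. G i j * p x j)" if i: "i < n" for x i
  proof -
    have "(\<Sum>j<n. G i j * p x j) = (\<Sum>k<n. (\<Sum>j<n. G i j * P j k) * x k)"
      unfolding p_def sum_distrib_left sum_distrib_right by (subst sum.swap) (simp add: mult.assoc)
    also have "\<dots> = x i" using i by (simp add: GP if_distrib[of "\<lambda>u. u * _"] cong: if_cong)
    finally show ?thesis ..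
  qed
  have quad: "(\<Sum>i<n. \<Sum>j<n. P i j * x i * z j) = (\<Sum>j<n. p x j * z j)" for x z
    unfolding p_def sum_distrib_right by (subst sum.swap) (auto simp: sym intro!: sum.cong)
  have last: "x (n - 1) = (\<Sum>j<n. coeff N j * p x j)" for x
  proof -
    have "x (n - 1) = (\<Sum>j<n. G (n - 1) j * p x j)" using n by (intro xp) simp
    also have "\<dots> = (\<Sum>j<n. coeff N j * p x j)"
    proof (rule sum.cong[OF refl])
      fix j assume "j \<in> {..<n}"
      then show "G (n - 1) j * p x j = coeff N j * p x j" using G_sym[of "n - 1" j] G_last[of j] by simp
    qed
    finally show ?thesis .
  qed
  \<comment> \<open>\<open>x (n - 1)\<close> is the inner product of the coefficients of
    \<open>N\<close> with \<open>p x\<close>, so Cauchy-Schwarz bounds its square by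
    \<open>c\<close> times the squared norm of \<open>p x\<close>; hence the constant
    \<open>\<delta> / c\<close>.\<close>
  define c where "c = (\<Sum>j<n. (coeff N j)\<^sup>2)"
  have c: "c > 0"
  proof -
    have "(coeff N (n - 1))\<^sup>2 \<le> c" unfolding c_def using n by (intro member_le_sum) auto
    then show ?thesis using monic(1) dN by simp
  qed
  show thesis
  proof (rule that[of "\<delta> / c" P])
    show "\<delta> / c > 0" using \<delta> c by simp
    show "\<And>i j. i < n \<Longrightarrow> j < n \<Longrightarrow> P i j = P j i" by (rule sym)
    show "(\<Sum>j<n. P i j * coeff N j) = (if i = n - 1 then 1 else 0)" if "i < n" for i
      using PG[OF that, of "n - 1"] n G_last by simp
    fix x :: "nat \<Rightarrow> real"
    define t where "t = x (n - 1)"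
    \<comment> \<open>Nonnegativity of \<open>W\<close> at \<open>p x - e\<close> gives the lower
      bound: the mixed terms contribute -2 t^2, and \<open>e\<close> itself contributes t^2 because
      \<open>N\<close> is monic.\<close>
    define e where "e i = (if i = n - 1 then t else 0)" for i
    have e: "(\<Sum>j<n. f j * e j) = f (n - 1) * t" for f using n by (simp add: e_def if_distrib[of "(*) _"] cong: if_cong)
    have Ge: "(\<Sum>i<n. \<Sum>j<n. G i j * u i * e j) = (\<Sum>i<n. coeff N i * u i) * t" for u
    proof -
      have "(\<Sum>i<n. \<Sum>j<n. G i j * u i * e j) = (\<Sum>i<n. G i (n - 1) * u i * t)" by (simp only: e)
      also have "\<dots> = (\<Sum>i<n. coeff N i * u i * t)"
        by (intro sum.cong refl) (simp only: G_last lessThan_iff)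
      finally show ?thesis by (simp add: sum_distrib_right)
    qed
    have Ge': "(\<Sum>i<n. \<Sum>j<n. G i j * e i * u j) = (\<Sum>i<n. coeff N i * u i) * t" for u
      using Ge[of u] by (subst sum.swap) (simp add: G_sym mult_ac)
    have "W (\<lambda>i. p x i - e i) = W (p x) - (\<Sum>i<n. \<Sum>j<n. G i j * e i * p x j) - (\<Sum>i<n. \<Sum>j<n. G i j * p x i * e j)
       + (\<Sum>i<n. \<Sum>j<n. G i j * e i * e j)"
      unfolding W_def sum_subtractf[symmetric] sum.distrib[symmetric] by (intro sum.cong refl) (simp add: algebra_simps)
    also have "\<dots> = W (p x) - t\<^sup>2"
    proof -
      have "(\<Sum>i<n. coeff N i * p x i) = t" by (simp only: t_def last[of x])
      moreover have "(\<Sum>i<n. coeff N i * e i) = t" using e[of "coeff N"] monic(1) dN by simp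
      ultimately show ?thesis using Ge'[of "p x"] Ge[of "p x"] Ge[of e] by (simp add: power2_eq_square)
    qed
    finally have "W (p x) \<ge> t\<^sup>2" using W_nonneg[of "\<lambda>i. p x i - e i"] by simp
    moreover have "(\<Sum>i<n. \<Sum>j<n. P i j * x i * x j) = W (p x)"
    proof -
      have "(\<Sum>j<n. p x j * x j) = (\<Sum>j<n. p x j * (\<Sum>i<n. G j i * p x i))" by (rule sum.cong) (auto simp: xp[symmetric])
      then show ?thesis unfolding quad W_def by (simp add: sum_distrib_left mult_ac)
    qed
    ultimately show "(x (n - 1))\<^sup>2 \<le> (\<Sum>i<n. \<Sum>j<n. P i j * x i * x j)" by (simp add: t_def)
    have "(\<Sum>i<n. \<Sum>j<n. P i j * x i * (\<Sum>k<n. companion n D $$ (j, k) * x k)) =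
        (\<Sum>j<n. p x j * (\<Sum>k<n. companion n D $$ (j, k) * x k))" by (rule quad)
    also have "\<dots> = (\<Sum>k<n. x k * adj (p x) k)"
      unfolding adj_def sum_distrib_left by (subst sum.swap) (simp add: mult_ac)
    also have "\<dots> = (\<Sum>k<n. (\<Sum>i<n. G k i * p x i) * adj (p x) k)" by (rule sum.cong) (auto simp: xp[symmetric])
    also have "\<dots> = (\<Sum>i<n. \<Sum>j<n. G i j * p x i * adj (p x) j)"
      unfolding sum_distrib_right by (subst sum.swap) (simp add: G_sym)
    finally have "2 * (\<Sum>i<n. \<Sum>j<n. P i j * x i * (\<Sum>k<n. companion n D $$ (j, k) * x k)) \<le> - \<delta> * (\<Sum>i<n. (p x i)\<^sup>2)"
      using S_quadratic_sum_le[of "p x"] by simp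
    moreover have "t\<^sup>2 \<le> c * (\<Sum>i<n. (p x i)\<^sup>2)"
      unfolding t_def last[of x] c_def by (rule Cauchy_Schwarz_ineq_sum)
    then have "\<delta> / c * t\<^sup>2 \<le> \<delta> * (\<Sum>i<n. (p x i)\<^sup>2)" using c \<delta> by (simp add: field_simps)
    ultimately show "2 * (\<Sum>i<n. \<Sum>j<n. P i j * x i * (\<Sum>k<n. companion n D $$ (j, k) * x k)) \<le> - (\<delta> / c) * (x (n - 1))\<^sup>2"
      by (simp add: t_def)
  qed
qed

end

theorem kalman_yakubovich_popov:
  fixes N D :: "real poly"
  assumes monic: "lead_coeff N = 1" "lead_coeff D = 1" and deg: "degree D = degree N + 1" "degree D = n"
    and N0: "\<And>s. poly (cpoly N) s = 0 \<Longrightarrow> Re s < 0" and spr: "strictly_positive_real N D"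
  obtains P :: "nat \<Rightarrow> nat \<Rightarrow> real" and \<kappa> where "\<kappa> > 0"
    "\<And>i j. i < n \<Longrightarrow> j < n \<Longrightarrow> P i j = P j i"
    "\<And>i. i < n \<Longrightarrow> (\<Sum>j<n. P i j * coeff N j) = (if i = n - 1 then 1 else 0)"
    "\<And>x. (x (n - 1))\<^sup>2 \<le> (\<Sum>i<n. \<Sum>j<n. P i j * x i * x j)"
    "\<And>x. 2 * (\<Sum>i<n. \<Sum>j<n. P i j * x i * (\<Sum>k<n. companion n D $$ (j, k) * x k)) \<le> - \<kappa> * (x (n - 1))\<^sup>2"
proof -
  obtain \<delta> a b where ab: "\<delta> > 0" "degree a \<le> degree N" "degree b \<le> degree N"
    "\<And>m. (\<Sum>l\<le>m. (- 1) ^ l * (coeff N (m - l) * coeff D l + coeff D (m - l) * coeff N l - coeff a (m - l) * coeff a l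
        - coeff b (m - l) * coeff b l - (if m - l = l \<and> l \<le> degree N then \<delta> else 0))) = 0"
    using spectral_factorization[OF monic deg(1) N0 spr] by blast
  \<comment> \<open>By \<open>h D = N\<close> a root of \<open>D\<close> in the closed right half
    plane would be a root of \<open>N\<close> there.\<close>
  have D0: "Re s < 0" if s: "poly (cpoly D) s = 0" for s
  proof (rule ccontr)
    assume *: "\<not> Re s < 0"
    obtain \<epsilon> h where "\<epsilon> > 0" "\<And>s. - \<epsilon> < Re s \<Longrightarrow> h s * poly (cpoly D) s = poly (cpoly N) s"
      using strictly_positive_real_extension[OF spr deg(1)] by metis
    then have "poly (cpoly N) s = 0" using s * by (metis add.inverse_neutral linorder_not_less mult_zero_right neg_less_iff_less order_less_le_trans)
    then show False using N0 * by blast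
  qed
  have l: "l \<le> degree N \<longleftrightarrow> l < n" for l using deg by auto
  have dab: "degree a < n" "degree b < n" using ab(2,3) deg by auto
  note antidiag = ab(4)[unfolded l]
  interpret kyp_kernel n N D a b \<delta>
    by unfold_locales (fact monic deg D0 ab(1) dab antidiag)+
  show thesis by (rule kyp_solution) (fact that)
qed


section \<open>Resolvents of state space realizations\<close>

text \<open>The polynomial row vector \<open>M\<close> satisfies \<open>M(s) (s I - A) = d(s) c\<close>.\<close>

definition row_resolvent :: "nat \<Rightarrow> real mat \<Rightarrow> (nat \<Rightarrow> real) \<Rightarrow> real poly \<Rightarrow> (nat \<Rightarrow> real poly) \<Rightarrow> bool" where
  "row_resolvent k A c d M \<longleftrightarrow>
     (\<forall>r<k. pCons 0 (M r) = (\<Sum>l<k. Polynomial.smult (A $$ (l, r)) (M l)) + Polynomial.smult (c r) d)"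

lemma row_resolvent_coeff:
  assumes "row_resolvent k A c d M" "r < k"
  shows "(\<Sum>l<k. A $$ (l, r) * coeff (M l) j) = (if j = 0 then 0 else coeff (M r) (j - 1)) - c r * coeff d j"
proof -
  have "coeff (pCons 0 (M r)) j = (\<Sum>l<k. A $$ (l, r) * coeff (M l) j) + c r * coeff d j"
    using assms by (simp add: row_resolvent_def coeff_sum)
  then show ?thesis by (cases j) auto
qed

text \<open>The recursion expresses coefficient j of the rows by their coefficients of index j + 1,
  so vanishing propagates downwards from an index beyond all degrees. With \<open>d = 0\<close> and
  \<open>m = 0\<close> this forces \<open>M = 0\<close>.\<close>

lemma row_resolvent_coeff_eq_0:
  assumes M: "row_resolvent k A c d M" and r: "r < k" and d: "\<And>j. j > m \<Longrightarrow> coeff d j = 0" and j: "j \<ge> m"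
  shows "coeff (M r) j = 0"
proof -
  define J where "J = Max ((\<lambda>r. degree (M r)) ` {..<k})"
  have J: "degree (M r) \<le> J" if "r < k" for r unfolding J_def using that by (intro Max_ge) auto
  have "coeff (M r) j = 0" if "r < k" "j \<ge> m" "i = Suc J - j" for r i j
    using that
  proof (induction i arbitrary: j r)
    case 0
    then show ?case using J[OF 0(1)] by (intro coeff_eq_0) simp
  next
    case (Suc i)
    have "(\<Sum>l<k. A $$ (l, r) * coeff (M l) (Suc j)) = coeff (M r) j - c r * coeff d (Suc j)"
      using row_resolvent_coeff[OF M Suc.prems(1), of "Suc j"] by simp
    moreover have "(\<Sum>l<k. A $$ (l, r) * coeff (M l) (Suc j)) = 0"
      using Suc.IH[of _ "Suc j"] Suc.prems by (intro sum.neutral) auto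
    ultimately show ?case using d[of "Suc j"] Suc.prems by simp
  qed
  from this[OF r j refl] show ?thesis .
qed

text \<open>Comparison of top coefficients. This is why the last of the coordinates used for the
  plant below is its output.\<close>

lemma row_resolvent_last_coeff:
  assumes M: "row_resolvent k A c d M" and r: "r < k" and d: "degree d = Suc m" "lead_coeff d = 1"
  shows "coeff (M r) m = c r"
proof -
  have "(\<Sum>l<k. A $$ (l, r) * coeff (M l) (Suc m)) = 0"
    using row_resolvent_coeff_eq_0[OF M _ _ order_refl] d by (intro sum.neutral ballI) (simp add: coeff_eq_0)
  then show ?thesis using row_resolvent_coeff[OF M r, of "Suc m"] d by simp
qed

text \<open>The difference of the two sides is a resolvent for the denominator 0, hence 0.\<close>

lemma row_resolvent_unique:
  assumes M: "row_resolvent k A c d M" and M': "row_resolvent k A c d' M'" and r: "r < k"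
  shows "d' * M r = d * M' r"
proof -
  have "row_resolvent k A c 0 (\<lambda>r. d' * M r - d * M' r)"
    unfolding row_resolvent_def
  proof (intro allI impI)
    fix r assume r: "r < k"
    have "pCons 0 (d' * M r - d * M' r) = d' * pCons 0 (M r) - d * pCons 0 (M' r)"
      by simp
    also have "\<dots> = d' * ((\<Sum>l<k. Polynomial.smult (A $$ (l, r)) (M l)) + Polynomial.smult (c r) d)
       - d * ((\<Sum>l<k. Polynomial.smult (A $$ (l, r)) (M' l)) + Polynomial.smult (c r) d')"
      using M M' r by (simp add: row_resolvent_def)
    also have "\<dots> = (\<Sum>l<k. Polynomial.smult (A $$ (l, r)) (d' * M l - d * M' l))"
      by (simp add: distrib_left sum_distrib_left sum_subtractf smult_diff_right mult.commute)
    finally show "pCons 0 (d' * M r - d * M' r) = (\<Sum>l<k. Polynomial.smult (A $$ (l, r)) (d' * M l - d * M' l)) + Polynomial.smult (c r) 0"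
      by simp
  qed
  from row_resolvent_coeff_eq_0[OF this r, of 0] have "d' * M r - d * M' r = 0"
    by (intro poly_eqI) simp
  then show ?thesis by simp
qed

section \<open>The adjugate of s I - A and the numerators of transfer functions\<close>

definition adjugate :: "real mat \<Rightarrow> nat \<Rightarrow> nat \<Rightarrow> real poly" where
  "adjugate A i r = adj_mat (char_poly_matrix A) $$ (i, r)"

text \<open>The products of s I - A with its adjugate, in both orders, are the characteristic
  polynomial times the identity; the two parts read this entry by entry.\<close>

lemma adjugate_resolvent:
  fixes A :: "real mat"
  assumes A: "A \<in> carrier_mat k k"
  shows adjugate_row_resolvent:
      "row_resolvent k A c (char_poly A) (\<lambda>r. \<Sum>i<k. Polynomial.smult (c i) (adjugate A i r))"
    and adjugate_column_resolvent: "i < k \<Longrightarrow> l < k \<Longrightarrow>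
      pCons 0 (adjugate A i l) = (\<Sum>r<k. Polynomial.smult (A $$ (i, r)) (adjugate A r l)) + (if i = l then char_poly A else 0)"
proof -
  let ?C = "char_poly_matrix A"
  have C: "?C \<in> carrier_mat k k" using A by (simp add: char_poly_matrix_def)
  let ?H = "adjugate A"
  note H_def = adjugate_def
  have Cij: "?C $$ (r, l) = (if r = l then [:0, 1:] else 0) - [:A $$ (r, l):]" if "r < k" "l < k" for r l
    using A that by (auto simp: char_poly_matrix_def)
  have mult: "(X * Y) $$ (i, j) = (\<Sum>l<k. X $$ (i, l) * Y $$ (l, j))"
    if "X \<in> carrier_mat k k" "Y \<in> carrier_mat k k" "i < k" "j < k" for X Y :: "real poly mat" and i j
    using that by (auto simp: scalar_prod_def lessThan_atLeast0)
  have 1: "pCons 0 (?H i l) = (\<Sum>r<k. Polynomial.smult (A $$ (r, l)) (?H i r)) + (if i = l then char_poly A else 0)"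
    if il: "i < k" "l < k" for i l
  proof -
    have "(adj_mat ?C * ?C) $$ (i, l) = (\<Sum>r<k. ?H i r * ((if r = l then [:0, 1:] else 0) - [:A $$ (r, l):]))"
      unfolding mult[OF adj_mat(1)[OF C] C il] H_def using il Cij by (intro sum.cong) auto
    also have "\<dots> = (\<Sum>r<k. if r = l then pCons 0 (?H i r) else 0) - (\<Sum>r<k. Polynomial.smult (A $$ (r, l)) (?H i r))"
      unfolding sum_subtractf[symmetric] by (intro sum.cong) (auto simp: right_diff_distrib)
    also have "(\<Sum>r<k. if r = l then pCons 0 (?H i r) else 0) = pCons 0 (?H i l)" using il by simp
    finally have "pCons 0 (?H i l) - (\<Sum>r<k. Polynomial.smult (A $$ (r, l)) (?H i r)) = (if i = l then char_poly A else 0)"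
      unfolding adj_mat(3)[OF C] char_poly_def using il by (cases "i = l") simp_all
    then show ?thesis by (simp add: algebra_simps)
  qed
  have 2: "pCons 0 (?H i l) = (\<Sum>r<k. Polynomial.smult (A $$ (i, r)) (?H r l)) + (if i = l then char_poly A else 0)"
    if il: "i < k" "l < k" for i l
  proof -
    have "(?C * adj_mat ?C) $$ (i, l) = (\<Sum>r<k. ((if i = r then [:0, 1:] else 0) - [:A $$ (i, r):]) * ?H r l)"
      unfolding mult[OF C adj_mat(1)[OF C] il] H_def using il Cij by (intro sum.cong) auto
    also have "\<dots> = (\<Sum>r<k. if i = r then pCons 0 (?H r l) else 0) - (\<Sum>r<k. Polynomial.smult (A $$ (i, r)) (?H r l))"
      unfolding sum_subtractf[symmetric] by (intro sum.cong) (auto simp: left_diff_distrib)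
    also have "(\<Sum>r<k. if i = r then pCons 0 (?H r l) else 0) = pCons 0 (?H i l)" using il by simp
    finally have "pCons 0 (?H i l) - (\<Sum>r<k. Polynomial.smult (A $$ (i, r)) (?H r l)) = (if i = l then char_poly A else 0)"
      unfolding adj_mat(2)[OF C] char_poly_def using il by (cases "i = l") simp_all
    then show ?thesis by (simp add: algebra_simps)
  qed
  show "i < k \<Longrightarrow> l < k \<Longrightarrow>
      pCons 0 (?H i l) = (\<Sum>r<k. Polynomial.smult (A $$ (i, r)) (?H r l)) + (if i = l then char_poly A else 0)"
    by (rule 2)
  show "row_resolvent k A c (char_poly A) (\<lambda>r. \<Sum>i<k. Polynomial.smult (c i) (?H i r))"
    unfolding row_resolvent_def
  proof (intro allI impI)
    fix r assume r: "r < k"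
    have "pCons 0 (\<Sum>i<k. Polynomial.smult (c i) (?H i r)) = (\<Sum>i<k. Polynomial.smult (c i) (pCons 0 (?H i r)))"
      by (rule poly_eqI) (simp add: coeff_pCons coeff_sum split: nat.split)
    also have "\<dots> = (\<Sum>i<k. \<Sum>l<k. Polynomial.smult (A $$ (l, r)) (Polynomial.smult (c i) (?H i l)))
        + (\<Sum>i<k. if i = r then Polynomial.smult (c i) (char_poly A) else 0)"
      unfolding sum.distrib[symmetric] using r
      by (intro sum.cong) (auto simp: 1 smult_add_right smult_sum2 mult.commute)
    also have "(\<Sum>i<k. if i = r then Polynomial.smult (c i) (char_poly A) else 0) = Polynomial.smult (c r) (char_poly A)"
      using r by simp
    also have "(\<Sum>i<k. \<Sum>l<k. Polynomial.smult (A $$ (l, r)) (Polynomial.smult (c i) (?H i l))) =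
        (\<Sum>l<k. Polynomial.smult (A $$ (l, r)) (\<Sum>i<k. Polynomial.smult (c i) (?H i l)))"
      by (subst sum.swap) (simp only: smult_sum2)
    finally show "pCons 0 (\<Sum>i<k. Polynomial.smult (c i) (?H i r)) =
      (\<Sum>l<k. Polynomial.smult (A $$ (l, r)) (\<Sum>i<k. Polynomial.smult (c i) (?H i l))) + Polynomial.smult (c r) (char_poly A)" .
  qed
qed

lemma char_poly_resolvent:
  assumes "A \<in> carrier_mat k k"
  obtains M where "row_resolvent k A c (char_poly A) M"
  by (rule that) (rule adjugate_row_resolvent[OF assms])

lemma poly_cpoly_sum: "poly (cpoly (\<Sum>i<(k::nat). f i)) s = (\<Sum>i<k. poly (cpoly (f i)) s)"
  by (induction k) auto

text \<open>If v solves (s I - A) v = b, then M b = M (s I - A) v = d c v, and c v is the transfer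
  function.\<close>

lemma transfer_eq_resolvent:
  assumes A: "A \<in> carrier_mat k k" and b: "b \<in> carrier_vec k" and c: "c \<in> carrier_vec k"
    and M: "row_resolvent k A (\<lambda>r. c $ r) d M"
    and s: "\<not> eigenvalue (map_mat complex_of_real A) s"
  shows "(\<Sum>r<k. of_real (b $ r) * poly (cpoly (M r)) s) = poly (cpoly d) s * transfer A b c s"
proof -
  let ?A = "map_mat complex_of_real A"
  let ?X = "s \<cdot>\<^sub>m 1\<^sub>m k - ?A"
  let ?b = "map_vec complex_of_real b" and ?c = "map_vec complex_of_real c"
  have A': "?A \<in> carrier_mat k k" and X: "?X \<in> carrier_mat k k" using A by auto
  have Xi: "(?X *\<^sub>v v) $ r = s * v $ r - (\<Sum>l<k. of_real (A $$ (r, l)) * v $ l)"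
    if v: "v \<in> carrier_vec k" and r: "r < k" for v r
  proof -
    have "(?X *\<^sub>v v) $ r = (\<Sum>l<k. (s * (if r = l then 1 else 0) - of_real (A $$ (r, l))) * v $ l)"
      using r v A by (auto simp: scalar_prod_def lessThan_atLeast0 intro!: sum.cong)
    also have "\<dots> = (\<Sum>l<k. if r = l then s * v $ l else 0) - (\<Sum>l<k. of_real (A $$ (r, l)) * v $ l)"
      unfolding sum_subtractf[symmetric] by (intro sum.cong) (auto simp: left_diff_distrib)
    finally show ?thesis using r by simp
  qed
  have "det ?X \<noteq> 0"
  proof
    assume "det ?X = 0"
    then obtain v where v: "v \<in> carrier_vec k" "v \<noteq> 0\<^sub>v k" "?X *\<^sub>v v = 0\<^sub>v k"
      using det_0_iff_vec_prod_zero_field[OF X] by auto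
    have "(?A *\<^sub>v v) $ i = (s \<cdot>\<^sub>v v) $ i" if "i < k" for i
      using Xi[OF v(1) that] v(1,3) A that by (simp add: scalar_prod_def lessThan_atLeast0)
    then have "?A *\<^sub>v v = s \<cdot>\<^sub>v v" using v(1) A' by (intro eq_vecI) auto
    then have "eigenvalue ?A s" using v A' by (auto simp: eigenvalue_def eigenvector_def)
    then show False using s by simp
  qed
  then have "?X \<in> Units (ring_mat TYPE(complex) k ())" by (rule det_non_zero_imp_unit[OF X])
  then obtain B where B0: "mat_inverse ?X = Some B" using mat_inverse(1)[OF X, of "()"] by (cases "mat_inverse ?X") auto
  then have B: "?X * B = 1\<^sub>m k" "B \<in> carrier_mat k k" using mat_inverse(2)[OF X] by auto
  define v where "v = B *\<^sub>v ?b"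
  have v: "v \<in> carrier_vec k" using B b by (simp add: v_def)
  have Xv: "?X *\<^sub>v v = ?b"
  proof -
    have "?X *\<^sub>v v = (?X * B) *\<^sub>v ?b" unfolding v_def using X B b by (intro assoc_mult_mat_vec[symmetric]) auto
    then show ?thesis using B b by simp
  qed
  have tr: "transfer A b c s = (\<Sum>l<k. of_real (c $ l) * v $ l)"
  proof -
    have "transfer A b c s = ?c \<bullet> v" using A by (simp add: transfer_def v_def B0)
    then show ?thesis using c v by (simp add: scalar_prod_def lessThan_atLeast0)
  qed
  have br: "of_real (b $ r) = s * v $ r - (\<Sum>l<k. of_real (A $$ (r, l)) * v $ l)" if r: "r < k" for r
  proof -
    have "of_real (b $ r) = (?X *\<^sub>v v) $ r" unfolding Xv using r b by simp
    also have "\<dots> = s * v $ r - (\<Sum>l<k. of_real (A $$ (r, l)) * v $ l)" by (rule Xi[OF v r])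
    finally show ?thesis .
  qed
  have Ml: "s * poly (cpoly (M l)) s - (\<Sum>r<k. of_real (A $$ (r, l)) * poly (cpoly (M r)) s) = of_real (c $ l) * poly (cpoly d) s"
    if l: "l < k" for l
  proof -
    have "poly (cpoly (pCons 0 (M l))) s = poly (cpoly ((\<Sum>r<k. Polynomial.smult (A $$ (r, l)) (M r)) + Polynomial.smult (c $ l) d)) s"
      using M l by (simp add: row_resolvent_def)
    then show ?thesis by (simp add: poly_cpoly_sum)
  qed
  have "(\<Sum>r<k. of_real (b $ r) * poly (cpoly (M r)) s) =
      (\<Sum>r<k. s * v $ r * poly (cpoly (M r)) s) - (\<Sum>r<k. \<Sum>l<k. of_real (A $$ (r, l)) * v $ l * poly (cpoly (M r)) s)"
    unfolding sum_subtractf[symmetric] by (intro sum.cong) (auto simp: br left_diff_distrib sum_distrib_right)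
  also have "(\<Sum>r<k. \<Sum>l<k. of_real (A $$ (r, l)) * v $ l * poly (cpoly (M r)) s) =
      (\<Sum>l<k. v $ l * (\<Sum>r<k. of_real (A $$ (r, l)) * poly (cpoly (M r)) s))"
    by (subst sum.swap) (simp add: sum_distrib_left mult_ac)
  also have "(\<Sum>r<k. s * v $ r * poly (cpoly (M r)) s) - \<dots> =
      (\<Sum>l<k. v $ l * (s * poly (cpoly (M l)) s - (\<Sum>r<k. of_real (A $$ (r, l)) * poly (cpoly (M r)) s)))"
    by (simp add: right_diff_distrib sum_subtractf mult_ac)
  also have "\<dots> = (\<Sum>l<k. v $ l * (of_real (c $ l) * poly (cpoly d) s))" by (intro sum.cong) (auto simp: Ml)
  also have "\<dots> = poly (cpoly d) s * transfer A b c s" unfolding tr by (simp add: sum_distrib_left mult_ac)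
  finally show ?thesis .
qed

text \<open>Two polynomials that agree off finitely many points are equal; excluded are the
  eigenvalues of \<open>A\<close> and the zeros of \<open>D\<close>, where
  \<open>has_transfer_function\<close> says nothing.\<close>

lemma transfer_function_resolvent:
  assumes A: "A \<in> carrier_mat k k" and b: "b \<in> carrier_vec k" and c: "c \<in> carrier_vec k"
    and M: "row_resolvent k A (\<lambda>r. c $ r) d M"
    and tf: "has_transfer_function A b c N D" and D: "D \<noteq> 0"
  shows "(\<Sum>r<k. Polynomial.smult (b $ r) (M r)) * D = d * N"
proof -
  let ?A = "map_mat complex_of_real A"
  have A': "?A \<in> carrier_mat k k" using A by simp
  define E where "E = (\<Sum>r<k. Polynomial.smult (b $ r) (M r)) * D - d * N"
  have "finite {s. eigenvalue ?A s}"
    unfolding eigenvalue_root_char_poly[OF A'] using degree_monic_char_poly[OF A']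
    by (intro poly_roots_finite) auto
  moreover have "finite {s. poly (cpoly D) s = 0}" using D by (intro poly_roots_finite) auto
  ultimately have "infinite (UNIV - ({s. eigenvalue ?A s} \<union> {s. poly (cpoly D) s = 0}))"
    by (intro Diff_infinite_finite) (auto simp: infinite_UNIV_char_0)
  moreover have "UNIV - ({s. eigenvalue ?A s} \<union> {s. poly (cpoly D) s = 0}) \<subseteq> {s. poly (cpoly E) s = 0}"
  proof (rule subsetI)
    fix s assume "s \<in> UNIV - ({s. eigenvalue ?A s} \<union> {s. poly (cpoly D) s = 0})"
    then have s: "\<not> eigenvalue ?A s" "poly (cpoly D) s \<noteq> 0" by auto
    have "transfer A b c s = poly (cpoly N) s / poly (cpoly D) s"
      using tf s by (simp add: has_transfer_function_def rat_eval_def)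
    then have "poly (cpoly ((\<Sum>r<k. Polynomial.smult (b $ r) (M r)) * D)) s = poly (cpoly (d * N)) s"
      using transfer_eq_resolvent[OF A b c M s(1)] s(2) by (simp add: poly_cpoly_sum)
    then show "s \<in> {s. poly (cpoly E) s = 0}"
      unfolding E_def using poly_cpoly_add[of "(\<Sum>r<k. Polynomial.smult (b $ r) (M r)) * D" "- (d * N)" s]
        poly_cpoly_smult[of "-1" "d * N" s] by simp
  qed
  ultimately have "infinite {s. poly (cpoly E) s = 0}" using infinite_super by blast
  then have "cpoly E = 0" using poly_roots_finite by blast
  then have "E = 0" by (metis coeff_cpoly coeff_0 of_real_eq_0_iff poly_eqI)
  then show ?thesis by (simp add: E_def)
qed

text \<open>Instead of expanding a determinant, two resolvents with the output row \<open>e\<close>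
  are compared: the monomials s^r, with the denominator \<open>q\<close> read off the last column,
  and the one that belongs to the characteristic polynomial. Uniqueness makes \<open>p\<close> a
  multiple of \<open>q\<close>, and both are monic of degree n.\<close>

lemma observer_canonical_eq_companion:
  assumes obs: "observer_canonical n A c" and cp: "char_poly A = p" and deg: "degree p = n" "lead_coeff p = 1" and n: "n > 0"
  shows "A = companion n p" "c = unit_vec n (n - 1)"
proof -
  have A: "A \<in> carrier_mat n n" and Aij: "\<And>i j. i < n \<Longrightarrow> j < n - 1 \<Longrightarrow> A $$ (i, j) = (if i = j + 1 then 1 else 0)"
    using obs by (auto simp: observer_canonical_def)
  show "c = unit_vec n (n - 1)" using obs by (simp add: observer_canonical_def)
  define q where "q = monom 1 n - (\<Sum>i<n. monom (A $$ (i, n - 1)) i)"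
  have cq: "coeff q i = (if i = n then 1 else if i < n then - A $$ (i, n - 1) else 0)" for i
    unfolding q_def by (auto simp: coeff_sum)
  have q: "degree q = n" "lead_coeff q = 1"
  proof -
    show "degree q = n" by (intro antisym degree_le le_degree) (auto simp: cq)
    then show "lead_coeff q = 1" by (simp add: cq)
  qed
  define e where "e r = (if r = n - 1 then 1 else 0 :: real)" for r
  have "row_resolvent n A e q (\<lambda>r. monom 1 r)"
    unfolding row_resolvent_def
  proof (intro allI impI)
    fix r assume r: "r < n"
    have "(\<Sum>l<n. Polynomial.smult (A $$ (l, r)) (monom 1 l)) = (\<Sum>l<n. monom (A $$ (l, r)) l)"
      by (simp add: smult_monom)
    moreover have "(\<Sum>l<n. monom (A $$ (l, r)) l) = monom 1 (Suc r)" if "r < n - 1"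
    proof -
      have "(\<Sum>l<n. monom (A $$ (l, r)) l) = (\<Sum>l<n. if l = Suc r then monom 1 l else 0)"
        using that by (intro sum.cong) (auto simp: Aij)
      then show ?thesis using that by simp
    qed
    moreover have "r = n - 1" if "\<not> r < n - 1" using that r by simp
    ultimately show "pCons 0 (monom 1 r) = (\<Sum>l<n. Polynomial.smult (A $$ (l, r)) (monom 1 l)) + Polynomial.smult (e r) q"
      using n by (cases "r < n - 1") (auto simp: e_def q_def monom_Suc[symmetric])
  qed
  moreover obtain M where "row_resolvent n A e p M"
    using char_poly_resolvent[OF A] unfolding cp .
  ultimately have "p * monom 1 0 = q * M 0" using n by (rule row_resolvent_unique)
  then have pq: "p = q * M 0" by simp
  then have "M 0 \<noteq> 0" "q \<noteq> 0" using deg by auto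
  then have "degree (M 0) = 0" using pq deg q by (simp add: degree_mult_eq)
  then obtain a where a: "M 0 = [:a:]" by (meson degree_eq_zeroE)
  have "lead_coeff p = lead_coeff q * lead_coeff (M 0)" unfolding pq by (rule lead_coeff_mult)
  then have "a = 1" using deg q a by simp
  then have "p = q" using pq a by simp
  show "A = companion n p"
  proof (rule eq_matI)
    fix i j assume "i < dim_row (companion n p)" "j < dim_col (companion n p)"
    then have ij: "i < n" "j < n" by (auto simp: companion_def)
    show "A $$ (i, j) = companion n p $$ (i, j)"
    proof (cases "j = n - 1")
      case True
      then show ?thesis using ij by (simp add: companion_def \<open>p = q\<close> cq)
    next
      case False
      then show ?thesis using ij Aij[of i j] by (auto simp: companion_def)
    qed
  qed (use A in \<open>auto simp: companion_def\<close>)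
qed

lemma companion_resolvent:
  assumes n: "n > 0" and deg: "degree p = n" "lead_coeff p = 1"
  shows "row_resolvent n (companion n p) (\<lambda>r. unit_vec n (n - 1) $ r) p (\<lambda>r. monom 1 r)"
  unfolding row_resolvent_def
proof (intro allI impI poly_eqI)
  fix r j assume r: "r < n"
  have "coeff (\<Sum>l<n. Polynomial.smult (companion n p $$ (l, r)) (monom 1 l)) j =
      (\<Sum>l<n. companion n p $$ (l, r) * (if l = j then 1 else 0))"
    by (simp add: coeff_sum)
  also have "\<dots> = (if j < n then (if j = r + 1 then 1 else 0) - (if r = n - 1 then coeff p j else 0) else 0)"
    unfolding companion_column_sum[OF r] using r by (auto simp: if_distrib[of "(*) _"] cong: if_cong)
  finally show "coeff (pCons 0 (monom 1 r)) j = coeff ((\<Sum>l<n. Polynomial.smult (companion n p $$ (l, r)) (monom 1 l)) +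
      Polynomial.smult (unit_vec n (n - 1) $ r) p) j"
    using r n deg by (auto simp: coeff_pCons coeff_eq_0 split: nat.split)
qed

text \<open>For a coprime transfer function of full degree the resolvent coefficients are an injective
  change of coordinates: a vanishing combination of the rows with weights \<open>\<delta>\<close> would realise \<open>Z/P\<close>
  with the denominator \<open>q\<close> of smaller degree.\<close>

lemma resolvent_observable:
  fixes P Z :: "real poly"
  assumes A: "A \<in> carrier_mat n n" and b: "b \<in> carrier_vec n" and c: "c \<in> carrier_vec n"
    and cop: "coprime Z P" and deg: "degree P = n" "lead_coeff P = 1"
    and M: "row_resolvent n A (\<lambda>r. c $ r) P M"
    and tf: "has_transfer_function A b c (Polynomial.smult kp Z) P" and kp: "kp \<noteq> 0"
  shows "det (mat n n (\<lambda>(j, r). coeff (M r) j)) \<noteq> 0"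
proof
  define T where "T = mat n n (\<lambda>(j, r). coeff (M r) j)"
  assume "det (mat n n (\<lambda>(j, r). coeff (M r) j)) = 0"
  then have "det (transpose_mat T) = 0" using det_transpose[of T n] by (simp add: T_def)
  then obtain v where v: "v \<in> carrier_vec n" "v \<noteq> 0\<^sub>v n" "transpose_mat T *\<^sub>v v = 0\<^sub>v n"
    using det_0_iff_vec_prod_zero_field[of "transpose_mat T" n] by (auto simp: T_def)
  have null: "(\<Sum>j<n. v $ j * coeff (M r) j) = 0" if "r < n" for r
  proof -
    have "(transpose_mat T *\<^sub>v v) $ r = (\<Sum>j<n. v $ j * coeff (M r) j)"
      using that v(1) by (auto simp: T_def scalar_prod_def lessThan_atLeast0 mult.commute)
    then show ?thesis using v that by simp
  qed
  \<comment> \<open>\<open>poly_shift (Suc j)\<close> discards the coefficients up to index j and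
    lowers the others by j + 1. The combination with the weights \<open>v\<close> keeps the
    resolvent relation because the constant term that it would violate is 0 by
    \<open>null\<close>.\<close>
  define q where "q = (\<Sum>j<n. Polynomial.smult (v $ j) (poly_shift (Suc j) P))"
  define Y where "Y r = (\<Sum>j<n. Polynomial.smult (v $ j) (poly_shift (Suc j) (M r)))" for r
  have cq: "coeff q i = (\<Sum>j<n. v $ j * coeff P (i + Suc j))" for i
    by (simp add: q_def coeff_sum coeff_poly_shift)
  have cY: "coeff (Y r) i = (\<Sum>j<n. v $ j * coeff (M r) (i + Suc j))" for r i
    by (simp add: Y_def coeff_sum coeff_poly_shift)
  have "row_resolvent n A (\<lambda>r. c $ r) q Y"
    unfolding row_resolvent_def
  proof (intro allI impI poly_eqI)
    fix r i assume r: "r < n"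
    have "coeff ((\<Sum>l<n. Polynomial.smult (A $$ (l, r)) (Y l)) + Polynomial.smult (c $ r) q) i
      = (\<Sum>j<n. v $ j * (\<Sum>l<n. A $$ (l, r) * coeff (M l) (i + Suc j))) + (\<Sum>j<n. v $ j * (c $ r * coeff P (i + Suc j)))"
      unfolding coeff_add coeff_sum coeff_smult cY cq sum_distrib_left
      by (subst sum.swap) (simp add: mult_ac)
    also have "\<dots> = (\<Sum>j<n. v $ j * coeff (M r) (i + j))"
      unfolding sum.distrib[symmetric] distrib_left[symmetric]
      using row_resolvent_coeff[OF M r] by (intro sum.cong) auto
    also have "\<dots> = coeff (pCons 0 (Y r)) i"
      using null[OF r] by (cases i) (auto simp: cY)
    finally show "coeff (pCons 0 (Y r)) i = coeff ((\<Sum>l<n. Polynomial.smult (A $$ (l, r)) (Y l)) + Polynomial.smult (c $ r) q) i" ..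
  qed
  moreover have "P \<noteq> 0" using deg by auto
  ultimately have "(\<Sum>r<n. Polynomial.smult (b $ r) (Y r)) * P = q * Polynomial.smult kp Z"
    using transfer_function_resolvent[OF A b c _ tf] by blast
  then have "P dvd q * Polynomial.smult kp Z" by (metis dvd_triv_right)
  then have "P dvd q * Z" using kp by (simp add: dvd_smult_iff)
  then have "P dvd q" using cop by (metis coprime_commute coprime_dvd_mult_left_iff)
  moreover have "coeff q i = 0" if "i \<ge> n" for i
    unfolding cq using that deg by (intro sum.neutral) (auto simp: coeff_eq_0)
  then have "q = 0 \<or> degree q < n" by (metis coeff_0 leading_coeff_0_iff linorder_not_less)
  ultimately have "q = 0" using deg dvd_imp_degree_le[of P q] linorder_not_less by blast
  \<comment> \<open>Triangular recovery of \<open>v\<close> from \<open>q = 0\<close>: in the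
    coefficient of index \<open>n - Suc j\<close> the monic \<open>P\<close> leaves
    \<open>v $ j\<close> and multiples of earlier entries only.\<close>
  have "v $ j = 0" if "j < n" for j
    using that
  proof (induction j rule: less_induct)
    case (less j)
    have "0 = coeff q (n - Suc j)" using \<open>q = 0\<close> by simp
    also have "\<dots> = (\<Sum>k<n. if k = j then v $ j else 0)"
      unfolding cq
    proof (rule sum.cong[OF refl])
      fix k assume k: "k \<in> {..<n}"
      consider "k < j" | "k = j" | "k > j" by linarith
      then show "v $ k * coeff P (n - Suc j + Suc k) = (if k = j then v $ j else 0)"
      proof cases
        case 1 then show ?thesis using less k by auto
      next
        case 2 then show ?thesis using deg less.prems by auto
      next
        case 3 then show ?thesis using deg less.prems by (auto simp: coeff_eq_0)
      qed
    qed
    also have "\<dots> = v $ j" using less.prems by simp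
    finally show ?case by simp
  qed
  then show False using v by auto
qed

text \<open>\<open>P\<close> divides the characteristic polynomial because it is coprime to
  \<open>Z\<close>, and both are monic of degree n. So the realization of the plant is
  minimal.\<close>

lemma coprime_transfer_char_poly:
  fixes P Z :: "real poly"
  assumes A: "A \<in> carrier_mat n n" and b: "b \<in> carrier_vec n" and c: "c \<in> carrier_vec n"
    and cop: "coprime Z P" and deg: "degree P = n" "lead_coeff P = 1"
    and tf: "has_transfer_function A b c (Polynomial.smult kp Z) P" and kp: "kp \<noteq> 0"
  shows "char_poly A = P"
proof -
  obtain M where M: "row_resolvent n A (\<lambda>r. c $ r) (char_poly A) M"
    by (rule char_poly_resolvent[OF A])
  have "P \<noteq> 0" using deg by auto
  from transfer_function_resolvent[OF A b c M tf this]
  have "(\<Sum>r<n. Polynomial.smult (b $ r) (M r)) * P = char_poly A * Polynomial.smult kp Z" .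
  then have "P dvd char_poly A * Polynomial.smult kp Z" by (metis dvd_triv_right)
  then have "P dvd char_poly A * Z" using kp by (simp add: dvd_smult_iff)
  then have "P dvd char_poly A" using cop by (metis coprime_commute coprime_dvd_mult_left_iff)
  then obtain u where u: "char_poly A = P * u" by auto
  have cp: "degree (char_poly A) = n" "lead_coeff (char_poly A) = 1"
    using degree_monic_char_poly[OF A] by auto
  have "u \<noteq> 0" "P \<noteq> 0" using u cp deg by auto
  then have "degree u = 0" using u cp deg by (simp add: degree_mult_eq)
  then obtain a where a: "u = [:a:]" by (meson degree_eq_zeroE)
  have "lead_coeff (char_poly A) = lead_coeff P * lead_coeff u" unfolding u by (rule lead_coeff_mult)
  then have "a = 1" using cp deg a by simp
  then show ?thesis using u a by simp
qed

text \<open>The span of the coefficient columns of \<open>adj(s I - A) b\<close> is \<open>A\<close>-invariant and contains \<open>b\<close>, so by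
  controllability it is everything.\<close>

lemma controllable_resolvent_surj:
  fixes A :: "real mat" and g :: "real poly"
  assumes A: "A \<in> carrier_mat k k" and b: "b \<in> carrier_vec k" and ctr: "controllable A b"
    and g: "\<And>j. j \<ge> k \<Longrightarrow> coeff g j = 0"
  obtains c M where "row_resolvent k A c (char_poly A) M" "(\<Sum>r<k. Polynomial.smult (b $ r) (M r)) = g"
proof -
  define H where "H = adjugate A"
  note H = adjugate_resolvent[OF A, folded H_def]
  have cp: "degree (char_poly A) = k" "lead_coeff (char_poly A) = 1"
    using degree_monic_char_poly[OF A] by auto
  \<comment> \<open>The polynomial vector adj(s I - A) b; weighting its entries by \<open>c\<close>
    gives the numerator of the transfer function from the input \<open>b\<close> to the output
    \<open>c\<close>.\<close>
  define B where "B i = (\<Sum>r<k. Polynomial.smult (b $ r) (H i r))" for i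
  have Brec: "pCons 0 (B i) = (\<Sum>r<k. Polynomial.smult (A $$ (i, r)) (B r)) + Polynomial.smult (b $ i) (char_poly A)"
    if i: "i < k" for i
  proof -
    have "pCons 0 (B i) = (\<Sum>l<k. Polynomial.smult (b $ l) (pCons 0 (H i l)))"
      unfolding B_def by (rule poly_eqI) (simp add: coeff_pCons coeff_sum split: nat.split)
    also have "\<dots> = (\<Sum>l<k. \<Sum>r<k. Polynomial.smult (A $$ (i, r)) (Polynomial.smult (b $ l) (H r l)))
        + (\<Sum>l<k. if i = l then Polynomial.smult (b $ l) (char_poly A) else 0)"
      unfolding sum.distrib[symmetric] using i
      by (intro sum.cong) (auto simp: H(2) smult_add_right smult_sum2 mult.commute)
    also have "(\<Sum>l<k. if i = l then Polynomial.smult (b $ l) (char_poly A) else 0) = Polynomial.smult (b $ i) (char_poly A)"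
      using i by simp
    also have "(\<Sum>l<k. \<Sum>r<k. Polynomial.smult (A $$ (i, r)) (Polynomial.smult (b $ l) (H r l))) =
        (\<Sum>r<k. Polynomial.smult (A $$ (i, r)) (B r))"
      unfolding B_def by (subst sum.swap) (simp only: smult_sum2)
    finally show ?thesis .
  qed
  have Bc: "(\<Sum>r<k. A $$ (i, r) * coeff (B r) j) = (if j = 0 then 0 else coeff (B i) (j - 1)) - b $ i * coeff (char_poly A) j"
    if "i < k" for i j
  proof -
    have "coeff (pCons 0 (B i)) j = (\<Sum>r<k. A $$ (i, r) * coeff (B r) j) + b $ i * coeff (char_poly A) j"
      unfolding Brec[OF that] by (simp add: coeff_sum)
    then show ?thesis by (cases j) auto
  qed
  have Hdeg: "coeff (H i r) j = 0" if "i < k" "r < k" "j \<ge> k" for i r j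
  proof -
    have "coeff (\<Sum>l<k. Polynomial.smult (if l = i then 1 else 0) (H l r)) j = 0"
      by (rule row_resolvent_coeff_eq_0[OF H(1) that(2) _ that(3)]) (use cp in \<open>auto simp: coeff_eq_0\<close>)
    then show ?thesis using that by (simp add: coeff_sum if_distrib[of "\<lambda>u. u * _"] cong: if_cong)
  qed
  \<comment> \<open>The leading coefficient of the adjugate is the identity, so the last coefficient
    column is \<open>b\<close>.\<close>
  have Blast: "coeff (B i) (k - 1) = b $ i" if "i < k" for i
  proof -
    have "(\<Sum>r<k. A $$ (i, r) * coeff (B r) k) = 0"
      by (intro sum.neutral) (auto simp: B_def coeff_sum Hdeg)
    then show ?thesis using Bc[OF that, of k] that cp by simp
  qed
  define Bm where "Bm = mat k k (\<lambda>(j, i). coeff (B i) j)"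
  have Bm: "Bm \<in> carrier_mat k k" by (simp add: Bm_def)
  have "det Bm \<noteq> 0"
  proof
    assume "det Bm = 0"
    then obtain v where v: "v \<in> carrier_vec k" "v \<noteq> 0\<^sub>v k" "Bm *\<^sub>v v = 0\<^sub>v k"
      using det_0_iff_vec_prod_zero_field[OF Bm] by auto
    have null: "(\<Sum>i<k. v $ i * coeff (B i) j) = 0" if "j < k" for j
    proof -
      have "(Bm *\<^sub>v v) $ j = (\<Sum>i<k. v $ i * coeff (B i) j)"
        using that v(1) by (auto simp: Bm_def scalar_prod_def lessThan_atLeast0 mult.commute)
      then show ?thesis using v that by simp
    qed
    define Bv where "Bv j = vec k (\<lambda>i. coeff (B i) j)" for j
    have Bv: "Bv j \<in> carrier_vec k" for j by (simp add: Bv_def)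
    have pow: "A ^\<^sub>m i \<in> carrier_mat k k" for i using A by simp
    have ABv: "A *\<^sub>v Bv j = (if j = 0 then 0\<^sub>v k else Bv (j - 1)) - coeff (char_poly A) j \<cdot>\<^sub>v Bv (k - 1)" for j
      using A Bc Blast by (intro eq_vecI) (auto simp: Bv_def scalar_prod_def lessThan_atLeast0 mult.commute)
    \<comment> \<open>\<open>A\<close> maps column j to column j - 1 minus a multiple of the last
      column (\<open>ABv\<close>), so orthogonality of \<open>v\<close> to all columns survives
      another power of \<open>A\<close>. Since the last column is \<open>b\<close>, \<open>v\<close>
      ends up orthogonal to the whole controllability matrix.\<close>
    have inv: "v \<bullet> ((A ^\<^sub>m i) *\<^sub>v Bv j) = 0" if "j < k" for i j
      using that
    proof (induction i arbitrary: j)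
      case 0
      then show ?case using null[of j] v(1) A by (simp add: Bv_def scalar_prod_def lessThan_atLeast0)
    next
      case (Suc i)
      have "(A ^\<^sub>m Suc i) *\<^sub>v Bv j = (A ^\<^sub>m i) *\<^sub>v (A *\<^sub>v Bv j)"
        using pow A Bv by (simp add: assoc_mult_mat_vec[of _ k k _ k])
      also have "\<dots> = (A ^\<^sub>m i) *\<^sub>v (if j = 0 then 0\<^sub>v k else Bv (j - 1)) - coeff (char_poly A) j \<cdot>\<^sub>v ((A ^\<^sub>m i) *\<^sub>v Bv (k - 1))"
        unfolding ABv using pow[of i] Bv by (auto simp: mult_minus_distrib_mat_vec[of _ k k] mult_mat_vec[of _ k k])
      finally have "v \<bullet> ((A ^\<^sub>m Suc i) *\<^sub>v Bv j) = v \<bullet> ((A ^\<^sub>m i) *\<^sub>v (if j = 0 then 0\<^sub>v k else Bv (j - 1)))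
          - coeff (char_poly A) j * (v \<bullet> ((A ^\<^sub>m i) *\<^sub>v Bv (k - 1)))"
        using v(1) pow[of i] Bv by (auto simp: scalar_prod_minus_distrib[of _ k])
      moreover have "(A ^\<^sub>m i) *\<^sub>v 0\<^sub>v k = 0\<^sub>v k"
        using pow[of i] by (intro eq_vecI) (auto simp: scalar_prod_def)
      ultimately show ?case using Suc.IH[of "j - 1"] Suc.IH[of "k - 1"] Suc.prems v(1) pow[of i] by auto
    qed
    have kpos: "k > 0" using v by (cases k) auto
    have "Bv (k - 1) = b" using b Blast by (intro eq_vecI) (auto simp: Bv_def)
    then have orth: "v \<bullet> ((A ^\<^sub>m j) *\<^sub>v b) = 0" for j using inv[of "k - 1" j] kpos by simp
    define C where "C = mat k k (\<lambda>(i, j). ((A ^\<^sub>m j) *\<^sub>v b) $ i)"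
    have C: "C \<in> carrier_mat k k" by (simp add: C_def)
    obtain D where D: "C * D = 1\<^sub>m k" "D * C = 1\<^sub>m (dim_row D)"
      using ctr A by (auto simp: controllable_def invertible_mat_def inverts_mat_def C_def)
    have "dim_col D = k" using D(1) by (metis index_mult_mat(3) index_one_mat(3))
    moreover have "dim_row D = k" using D(2) C by (metis carrier_matD(2) index_mult_mat(3) index_one_mat(3))
    ultimately have D': "D \<in> carrier_mat k k" by auto
    have "transpose_mat C *\<^sub>v v = 0\<^sub>v k"
    proof (rule eq_vecI)
      fix j assume "j < dim_vec (0\<^sub>v k)"
      then have j: "j < k" by simp
      have "(transpose_mat C *\<^sub>v v) $ j = v \<bullet> ((A ^\<^sub>m j) *\<^sub>v b)"
        using j v(1) pow[of j] by (auto simp: C_def scalar_prod_def mult.commute)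
      then show "(transpose_mat C *\<^sub>v v) $ j = 0\<^sub>v k $ j" using orth j by simp
    qed (simp add: C_def)
    then have "transpose_mat D *\<^sub>v (transpose_mat C *\<^sub>v v) = 0\<^sub>v k" using D' by auto
    moreover have "transpose_mat D *\<^sub>v (transpose_mat C *\<^sub>v v) = (transpose_mat D * transpose_mat C) *\<^sub>v v"
      using C D' v(1) by (intro assoc_mult_mat_vec[symmetric, of _ k k _ k]) auto
    moreover have "transpose_mat D * transpose_mat C = 1\<^sub>m k"
      using transpose_mult[OF C D'] D(1) by (simp add: transpose_one)
    ultimately show False using v by simp
  qed
  then obtain X where X: "X \<in> carrier_mat k k" "Bm * X = 1\<^sub>m k"
    using det_non_zero_imp_unit[OF Bm, of "()"] by (auto simp: Units_def ring_mat_def)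
  define gv where "gv = vec k (\<lambda>j. coeff g j)"
  define c where "c = X *\<^sub>v gv"
  have c: "c \<in> carrier_vec k" unfolding c_def by (rule mult_mat_vec_carrier[OF X(1)]) (simp add: gv_def)
  have "Bm *\<^sub>v c = gv"
  proof -
    have "Bm *\<^sub>v c = (Bm * X) *\<^sub>v gv"
      unfolding c_def using Bm X by (intro assoc_mult_mat_vec[symmetric, of _ k k _ k]) (auto simp: gv_def)
    then show ?thesis using X by (simp add: gv_def)
  qed
  then have sol: "(\<Sum>i<k. c $ i * coeff (B i) j) = coeff g j" if "j < k" for j
  proof -
    have "(Bm *\<^sub>v c) $ j = (\<Sum>i<k. c $ i * coeff (B i) j)"
      using that c by (auto simp: Bm_def scalar_prod_def lessThan_atLeast0 mult.commute)
    then show ?thesis using \<open>Bm *\<^sub>v c = gv\<close> that by (simp add: gv_def)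
  qed
  show thesis
  proof (rule that[OF H(1)[of "\<lambda>i. c $ i"]])
    have "(\<Sum>r<k. Polynomial.smult (b $ r) (\<Sum>i<k. Polynomial.smult (c $ i) (H i r))) = (\<Sum>i<k. Polynomial.smult (c $ i) (B i))"
      unfolding B_def smult_sum2 by (subst sum.swap) (simp add: mult.commute)
    also have "\<dots> = g"
    proof (rule poly_eqI)
      fix j
      show "coeff (\<Sum>i<k. Polynomial.smult (c $ i) (B i)) j = coeff g j"
      proof (cases "j < k")
        case True then show ?thesis using sol by (simp add: coeff_sum)
      next
        case False
        then have "coeff (B i) j = 0" if "i < k" for i using that by (simp add: B_def coeff_sum Hdeg)
        then show ?thesis using False g by (simp add: coeff_sum)
      qed
    qed
    finally show "(\<Sum>r<k. Polynomial.smult (b $ r) (\<Sum>i<k. Polynomial.smult (c $ i) (H i r))) = g" .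
  qed
qed


section \<open>The adaptive loop\<close>

lemma sum_lessThan_add:
  fixes f :: "nat \<Rightarrow> 'a::comm_monoid_add"
  shows "(\<Sum>i<a+b. f i) = (\<Sum>i<a. f i) + (\<Sum>i<b. f (a + i))"
  by (induction b) (simp_all add: add.assoc)

lemma sum_double_split:
  fixes f :: "nat \<Rightarrow> 'a::comm_monoid_add"
  assumes "n > 0"
  shows "(\<Sum>i<2 * n. f i) = f 0 + (\<Sum>i<n-1. f (Suc i)) + (f n + (\<Sum>i<n-1. f (n + Suc i)))"
proof -
  obtain k where k: "n = Suc k" using assms by (cases n) auto
  have "(\<Sum>i<n+n. f i) = (\<Sum>i<n. f i) + (\<Sum>i<n. f (n + i))" by (rule sum_lessThan_add)
  then show ?thesis
    unfolding mult_2 using sum.lessThan_Suc_shift[of f k] sum.lessThan_Suc_shift[of "\<lambda>i. f (n + i)" k]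
    by (simp only: k diff_Suc_1 Nat.add_0_right)
qed

text \<open>In the coordinates given by the coefficients of \<open>M(s) x\<close> the realization
  takes observer form: a shift, injection of the output through the coefficients of
  \<open>d\<close>, and the input through those of the numerator. It is the relation
  \<open>M(s) (s I - A) = d(s) c\<close> compared at s^j.\<close>

lemma row_resolvent_flow:
  assumes "row_resolvent k A c d M"
  shows "(\<Sum>r<k. coeff (M r) j * ((\<Sum>l<k. A $$ (r, l) * x l) + v * b r)) =
    (if j = 0 then 0 else (\<Sum>r<k. coeff (M r) (j - 1) * x r)) - coeff d j * (\<Sum>r<k. c r * x r)
      + v * coeff (\<Sum>r<k. Polynomial.smult (b r) (M r)) j"
proof -
  have "(\<Sum>r<k. coeff (M r) j * (\<Sum>l<k. A $$ (r, l) * x l)) = (\<Sum>l<k. (\<Sum>r<k. A $$ (r, l) * coeff (M r) j) * x l)"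
    unfolding sum_distrib_left sum_distrib_right by (subst sum.swap) (simp add: mult_ac)
  also have "\<dots> = (\<Sum>l<k. ((if j = 0 then 0 else coeff (M l) (j - 1)) - c l * coeff d j) * x l)"
    by (intro sum.cong) (auto simp: row_resolvent_coeff[OF assms])
  also have "\<dots> = (if j = 0 then 0 else (\<Sum>r<k. coeff (M r) (j - 1) * x r)) - coeff d j * (\<Sum>r<k. c r * x r)"
    by (cases "j = 0") (simp_all add: left_diff_distrib right_diff_distrib sum_subtractf sum_negf sum_distrib_left mult_ac)
  finally show ?thesis
    by (simp add: distrib_left sum.distrib coeff_sum sum_distrib_left mult_ac)
qed

type_synonym state = "nat \<times> nat \<Rightarrow> real"

text \<open>\<open>c\<close> includes the factor \<open>kp\<close>, and \<open>Q\<close> is the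
  denominator of the error transfer function. The filter with output gain \<open>th1\<close> has
  transfer function (Zm - Z) / Zm, that with \<open>th2\<close> has g2 / Zm; with the equation for
  \<open>g2\<close> these are the matching conditions that determine the ideal gains.
  \<open>W\<close> is now the KYP matrix itself.\<close>

locale adaptive_loop =
  fixes n :: nat and Ap \<Lambda> :: "real mat" and bp c bl bm lm :: "nat \<Rightarrow> real"
    and kp km \<gamma> :: real and r :: "real \<Rightarrow> real" and Z P Zm Pm Q g2 :: "real poly"
    and M M1 M2 :: "nat \<Rightarrow> real poly" and th1 th2 :: "nat \<Rightarrow> real" and th0 :: real
    and W :: "nat \<Rightarrow> nat \<Rightarrow> real" and \<kappa> Rb :: real and X0 :: "state"
  assumes n: "n > 0" and kp: "kp \<noteq> 0" and \<gamma>: "\<gamma> > 0"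
    and carrier: "\<Lambda> \<in> carrier_mat (n - 1) (n - 1)"
    and deg: "degree P = n" "lead_coeff P = 1" "degree Zm = n - 1" "lead_coeff Zm = 1" "degree Z = n - 1" "lead_coeff Z = 1"
    and M: "row_resolvent n Ap c P M" "(\<Sum>i<n. Polynomial.smult (bp i) (M i)) = Polynomial.smult kp Z"
      "det (mat n n (\<lambda>(j, i). coeff (M i) j)) \<noteq> 0"
    and M1: "row_resolvent (n - 1) \<Lambda> th1 Zm M1" "(\<Sum>i<n-1. Polynomial.smult (bl i) (M1 i)) = Zm - Z"
    and M2: "row_resolvent (n - 1) \<Lambda> th2 Zm M2" "(\<Sum>i<n-1. Polynomial.smult (bl i) (M2 i)) = g2"
    and g2: "Polynomial.smult kp g2 + Polynomial.smult (kp * th0) Zm = P - Pm"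
    and model: "\<And>j. j < n \<Longrightarrow> bm j = coeff Zm j" "\<And>j. j < n \<Longrightarrow> lm j = coeff Q j - coeff Pm j"
    and kyp: "\<kappa> > 0" "\<And>i j. i < n \<Longrightarrow> j < n \<Longrightarrow> W i j = W j i"
      "\<And>i. i < n \<Longrightarrow> (\<Sum>j<n. W i j * coeff Zm j) = (if i = n - 1 then 1 else 0)"
      "\<And>x. (x (n - 1))\<^sup>2 \<le> (\<Sum>i<n. \<Sum>j<n. W i j * x i * x j)"
      "\<And>x. 2 * (\<Sum>i<n. \<Sum>j<n. W i j * x i * (\<Sum>k<n. companion n Q $$ (j, k) * x k)) \<le> - \<kappa> * (x (n - 1))\<^sup>2"
    and hurwitz: "hurwitz (companion n Pm)" "hurwitz \<Lambda>" "hurwitz (companion (n - 1) Z)"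
    and Rb: "\<And>t. t \<ge> 0 \<Longrightarrow> \<bar>r t\<bar> \<le> Rb"
begin

text \<open>The state of the loop is a function on the index set \<open>idx\<close>; the first component of an index selects
  the plant, the model, the two filters, or the adaptive gain.\<close>

definition idx :: "(nat \<times> nat) set" where
  "idx = {0} \<times> {..<n} \<union> {1} \<times> {..<n} \<union> {2} \<times> {..<n-1} \<union> {3} \<times> {..<n-1} \<union> {4} \<times> {..<2 * n}"

lemma finite_idx [simp]: "finite idx" by (simp add: idx_def)

lemma idx_simps [simp]:
  "(0, i) \<in> idx \<longleftrightarrow> i < n" "(Suc 0, i) \<in> idx \<longleftrightarrow> i < n" "(2, i) \<in> idx \<longleftrightarrow> i < n - 1" "(3, i) \<in> idx \<longleftrightarrow> i < n - 1"
  "(4, i) \<in> idx \<longleftrightarrow> i < 2 * n"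
  by (auto simp: idx_def)

definition outp :: "state \<Rightarrow> real" where
  "outp x = (\<Sum>i<n. c i * x (0, i))"

definition err :: "state \<Rightarrow> real" where
  "err x = outp x - x (1, n - 1)"

definition omega :: "real \<Rightarrow> state \<Rightarrow> nat \<Rightarrow> real" where
  "omega t x i = (if i = 0 then r t else if i < n then x (2, i - 1) else if i = n then outp x else x (3, i - n - 1))"

definition ctrl :: "real \<Rightarrow> state \<Rightarrow> real" where
  "ctrl t x = (\<Sum>i<2 * n. x (4, i) * omega t x i)"

definition field :: "real \<Rightarrow> state \<Rightarrow> state" where
  "field t x p = (case p of (b, i) \<Rightarrow>
     if b = 0 then (\<Sum>j<n. Ap $$ (i, j) * x (0, j)) + ctrl t x * bp i
     else if b = 1 then (\<Sum>j<n. companion n Pm $$ (i, j) * x (1, j)) + (km * r t * bm i + err x * lm i)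
     else if b = 2 then (\<Sum>j<n-1. \<Lambda> $$ (i, j) * x (2, j)) + ctrl t x * bl i
     else if b = 3 then (\<Sum>j<n-1. \<Lambda> $$ (i, j) * x (3, j)) + outp x * bl i
     else - \<gamma> * sgn kp * err x * omega t x i)"

lemma field_component:
  "field t x (0, i) = (\<Sum>j<n. Ap $$ (i, j) * x (0, j)) + ctrl t x * bp i"
  "field t x (Suc 0, i) = (\<Sum>j<n. companion n Pm $$ (i, j) * x (1, j)) + (km * r t * bm i + err x * lm i)"
  "field t x (2, i) = (\<Sum>j<n-1. \<Lambda> $$ (i, j) * x (2, j)) + ctrl t x * bl i"
  "field t x (3, i) = (\<Sum>j<n-1. \<Lambda> $$ (i, j) * x (3, j)) + outp x * bl i"
  "field t x (4, i) = - \<gamma> * sgn kp * err x * omega t x i"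
  by (simp_all add: field_def)

text \<open>The coefficient of s^j in \<open>M(s) x\<close>, and likewise for the filters below:
  coordinates in which the plant, and the filters seen through the ideal gains, are in observer
  form.\<close>

definition obs :: "nat \<Rightarrow> state \<Rightarrow> real" where
  "obs j x = (\<Sum>i<n. coeff (M i) j * x (0, i))"

definition fil1 :: "nat \<Rightarrow> state \<Rightarrow> real" where
  "fil1 j x = (\<Sum>i<n-1. coeff (M1 i) j * x (2, i))"

definition fil2 :: "nat \<Rightarrow> state \<Rightarrow> real" where
  "fil2 j x = (\<Sum>i<n-1. coeff (M2 i) j * x (3, i))"

text \<open>\<open>eps\<close> is the error \<open>\<epsilon>\<close> of the introduction and \<open>th\<close> the ideal gain \<open>\<theta>\<^sup>*\<close>.\<close>

definition eps :: "nat \<Rightarrow> state \<Rightarrow> real" where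
  "eps j x = obs j x + kp * fil1 j x + kp * fil2 j x - x (1, j)"

definition th :: "nat \<Rightarrow> real" where
  "th i = (if i = 0 then km / kp else if i < n then th1 (i - 1) else if i = n then th0 else th2 (i - n - 1))"

lemma obs_field: "obs j (field t x) = (if j = 0 then 0 else obs (j - 1) x) - coeff P j * outp x + ctrl t x * (kp * coeff Z j)"
  unfolding obs_def field_component row_resolvent_flow[OF M(1), of j "\<lambda>i. x (0, i)"] M(2) outp_def by simp

lemma fil1_field: "fil1 j (field t x) = (if j = 0 then 0 else fil1 (j - 1) x)
    - coeff Zm j * (\<Sum>i<n-1. th1 i * x (2, i)) + ctrl t x * (coeff Zm j - coeff Z j)"
  unfolding fil1_def field_component row_resolvent_flow[OF M1(1), of j "\<lambda>i. x (2, i)"] M1(2) by simp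

lemma fil2_field: "fil2 j (field t x) = (if j = 0 then 0 else fil2 (j - 1) x)
    - coeff Zm j * (\<Sum>i<n-1. th2 i * x (3, i)) + outp x * coeff g2 j"
  unfolding fil2_def field_component row_resolvent_flow[OF M2(1), of j "\<lambda>i. x (3, i)"] M2(2) by simp

lemma obs_last: "obs (n - 1) x = outp x"
  unfolding obs_def outp_def
  using row_resolvent_last_coeff[OF M(1), of _ "n - 1"] deg n by (intro sum.cong) auto

text \<open>The resolvent rows of filters of order n - 1 have degree below n - 1. Hence the filters
  leave the last coordinate of \<open>eps\<close> alone, and the output error is exactly that
  coordinate.\<close>

lemma fil_last: "fil1 (n - 1) x = 0" "fil2 (n - 1) x = 0"
proof -
  have "coeff Zm j = 0" if "j > n - 1" for j using that deg by (simp add: coeff_eq_0)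
  then show "fil1 (n - 1) x = 0" "fil2 (n - 1) x = 0"
    unfolding fil1_def fil2_def
    using row_resolvent_coeff_eq_0[OF M1(1), of _ "n - 1" "n - 1"] row_resolvent_coeff_eq_0[OF M2(1), of _ "n - 1" "n - 1"]
    by (auto intro!: sum.neutral)
qed

lemma eps_last: "eps (n - 1) x = err x"
  by (simp only: eps_def obs_last fil_last err_def mult_zero_right add_0_right)

lemma gain_split: "(\<Sum>i<2 * n. g i * omega t x i) = g 0 * r t + (\<Sum>i<n-1. g (Suc i) * x (2, i))
    + (g n * outp x + (\<Sum>i<n-1. g (n + Suc i) * x (3, i)))"
proof -
  have "(\<Sum>i<n-1. g (Suc i) * omega t x (Suc i)) = (\<Sum>i<n-1. g (Suc i) * x (2, i))"
    by (intro sum.cong) (auto simp: omega_def)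
  moreover have "(\<Sum>i<n-1. g (n + Suc i) * omega t x (n + Suc i)) = (\<Sum>i<n-1. g (n + Suc i) * x (3, i))"
    by (intro sum.cong) (auto simp: omega_def)
  ultimately show ?thesis unfolding sum_double_split[OF n] using n by (simp add: omega_def)
qed

text \<open>In coordinate j the input enters through \<open>kp * coeff Z j\<close> and
  \<open>kp * (coeff Zm j - coeff Z j)\<close>, in sum \<open>kp * coeff Zm j\<close>, and
  \<open>g2\<close> trades \<open>coeff P j\<close> for \<open>coeff Pm j\<close> at the price of
  another multiple of \<open>coeff Zm j\<close>. What multiplies \<open>coeff Zm j\<close> is then
  the gain error applied to the regressor.\<close>

lemma eps_field:
  assumes j: "j < n"
  shows "eps j (field t x) = (\<Sum>k<n. companion n Q $$ (j, k) * eps k x)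
    + coeff Zm j * (kp * (\<Sum>i<2 * n. (x (4, i) - th i) * omega t x i))"
proof -
  have th: "kp * (\<Sum>i<2 * n. th i * omega t x i) =
      km * r t + kp * (\<Sum>i<n-1. th1 i * x (2, i)) + kp * th0 * outp x + kp * (\<Sum>i<n-1. th2 i * x (3, i))"
  proof -
    have "(\<Sum>i<n-1. th (Suc i) * x (2, i)) = (\<Sum>i<n-1. th1 i * x (2, i))"
      "(\<Sum>i<n-1. th (n + Suc i) * x (3, i)) = (\<Sum>i<n-1. th2 i * x (3, i))"
      by (auto intro!: sum.cong simp: th_def)
    moreover have "th 0 = km / kp" "th n = th0" using n by (auto simp: th_def)
    ultimately show ?thesis unfolding gain_split using kp by (simp add: distrib_left)
  qed
  have "coeff (Polynomial.smult kp g2 + Polynomial.smult (kp * th0) Zm) j = coeff (P - Pm) j" by (simp only: g2)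
  then have g2j: "kp * coeff g2 j = coeff P j - coeff Pm j - kp * th0 * coeff Zm j" by (simp add: algebra_simps)
  have comp: "(\<Sum>k<n. companion n p $$ (j, k) * v k) = (if j = 0 then 0 else v (j - 1)) - coeff p j * v (n - 1)" for p v
    using companion_row_sum[OF j, of "\<lambda>x. x" p v] by simp
  \<comment> \<open>With the model output written as \<open>outp x - err x\<close>, the output terms
    with \<open>coeff Pm j\<close> cancel and the feedback gain \<open>lm\<close> leaves
    \<open>coeff Q j\<close> times the error.\<close>
  have ymod: "x (1, n - 1) = outp x - err x" by (simp add: err_def)
  have "field t x (1, j) = (if j = 0 then 0 else x (1, j - 1)) - coeff Pm j * (outp x - err x)
        + (km * r t * coeff Zm j + err x * (coeff Q j - coeff Pm j))"
    using model[OF j] comp[of Pm "\<lambda>k. x (1, k)"] ymod by (simp add: field_component)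
  then have "eps j (field t x) = (if j = 0 then 0 else obs (j - 1) x) - coeff P j * outp x + ctrl t x * (kp * coeff Z j)
     + kp * ((if j = 0 then 0 else fil1 (j - 1) x) - coeff Zm j * (\<Sum>i<n-1. th1 i * x (2, i)) + ctrl t x * (coeff Zm j - coeff Z j))
     + kp * ((if j = 0 then 0 else fil2 (j - 1) x) - coeff Zm j * (\<Sum>i<n-1. th2 i * x (3, i)))
     + outp x * (kp * coeff g2 j)
     - ((if j = 0 then 0 else x (1, j - 1)) - coeff Pm j * (outp x - err x)
        + (km * r t * coeff Zm j + err x * (coeff Q j - coeff Pm j)))"
    unfolding eps_def obs_field fil1_field fil2_field by (simp add: algebra_simps)
  also have "\<dots> = (if j = 0 then 0 else eps (j - 1) x) - coeff Q j * err x
     + coeff Zm j * (kp * ctrl t x - (km * r t + kp * (\<Sum>i<n-1. th1 i * x (2, i)) + kp * th0 * outp x + kp * (\<Sum>i<n-1. th2 i * x (3, i))))"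
    unfolding g2j by (simp add: eps_def algebra_simps)
  also have "\<dots> = (\<Sum>k<n. companion n Q $$ (j, k) * eps k x) + coeff Zm j * (kp * ctrl t x - kp * (\<Sum>i<2 * n. th i * omega t x i))"
    unfolding th comp eps_last ..
  also have "kp * ctrl t x - kp * (\<Sum>i<2 * n. th i * omega t x i) = kp * (\<Sum>i<2 * n. (x (4, i) - th i) * omega t x i)"
    unfolding ctrl_def by (simp add: left_diff_distrib sum_subtractf right_diff_distrib)
  finally show ?thesis .
qed

section \<open>Trajectories on finite horizons and bounds uniform in the horizon\<close>

definition traj :: "real \<Rightarrow> (real \<Rightarrow> state) \<Rightarrow> bool" where
  "traj T X \<longleftrightarrow> 0 \<le> T \<and> (\<forall>p\<in>idx. X 0 p = X0 p) \<and> (\<forall>p\<in>idx. continuous_on {0..T} (\<lambda>t. X t p)) \<and>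
     (\<exists>S. finite S \<and> (\<forall>t\<in>{0<..<T} - S. \<forall>p\<in>idx. ((\<lambda>t. X t p) has_real_derivative field t (X t) p) (at t)))"

lemma trajD:
  assumes "traj T X"
  shows "0 \<le> T" "p \<in> idx \<Longrightarrow> X 0 p = X0 p" "p \<in> idx \<Longrightarrow> continuous_on {0..T} (\<lambda>t. X t p)"
  using assms by (auto simp: traj_def)

lemma traj_derivative:
  assumes "traj T X"
  obtains S where "finite S"
    "\<And>t p. t \<in> {0<..<T} - S \<Longrightarrow> p \<in> idx \<Longrightarrow> ((\<lambda>t. X t p) has_real_derivative field t (X t) p) (at t)"
proof -
  from assms have "\<exists>S. finite S \<and> (\<forall>t\<in>{0<..<T} - S. \<forall>p\<in>idx. ((\<lambda>t. X t p) has_real_derivative field t (X t) p) (at t))"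
    unfolding traj_def by (elim conjE)
  then obtain S where S: "finite S \<and> (\<forall>t\<in>{0<..<T} - S. \<forall>p\<in>idx. ((\<lambda>t. X t p) has_real_derivative field t (X t) p) (at t))"
    by (rule exE)
  show thesis by (rule that[of S]) (use S in auto)
qed

lemma traj_restrict:
  assumes "traj T X" "0 \<le> s" "s \<le> T"
  shows "traj s X"
proof -
  obtain S where S: "finite S"
    "\<And>t p. t \<in> {0<..<T} - S \<Longrightarrow> p \<in> idx \<Longrightarrow> ((\<lambda>t. X t p) has_real_derivative field t (X t) p) (at t)"
    using traj_derivative[OF assms(1)] by metis
  show ?thesis unfolding traj_def
  proof (intro conjI exI[of _ S])
    show "\<forall>p\<in>idx. continuous_on {0..s} (\<lambda>t. X t p)"
      using trajD(3)[OF assms(1)] assms(3) by (meson atLeastatMost_subset_iff continuous_on_subset order_refl)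
    show "\<forall>t\<in>{0<..<s} - S. \<forall>p\<in>idx. ((\<lambda>t. X t p) has_real_derivative field t (X t) p) (at t)"
      using S(2) assms(3) by auto
  qed (use S assms trajD[OF assms(1)] in auto)
qed

text \<open>The bound is uniform in the horizon \<open>T\<close>; this is what makes the truncation at \<open>clip\<close> below
  invisible to the solution.\<close>

definition ubdd :: "(real \<Rightarrow> state \<Rightarrow> real) \<Rightarrow> bool" where
  "ubdd f \<longleftrightarrow> (\<exists>B. \<forall>T X. traj T X \<longrightarrow> (\<forall>t\<in>{0..T}. \<bar>f t (X t)\<bar> \<le> B))"

lemma ubddI: "(\<And>T X t. traj T X \<Longrightarrow> t \<in> {0..T} \<Longrightarrow> \<bar>f t (X t)\<bar> \<le> B) \<Longrightarrow> ubdd f"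
  unfolding ubdd_def by blast

lemma ubddE:
  assumes "ubdd f"
  obtains B where "B \<ge> 0" "\<And>T X t. traj T X \<Longrightarrow> t \<in> {0..T} \<Longrightarrow> \<bar>f t (X t)\<bar> \<le> B"
proof -
  from assms obtain B where B: "\<forall>T X. traj T X \<longrightarrow> (\<forall>t\<in>{0..T}. \<bar>f t (X t)\<bar> \<le> B)" unfolding ubdd_def by (rule exE)
  show thesis
    by (rule that[of "\<bar>B\<bar>"]) (use B in \<open>auto intro: order_trans[OF _ abs_ge_self]\<close>)
qed

lemma ubdd_const: "ubdd (\<lambda>_ _. a)"
  by (rule ubddI[of _ "\<bar>a\<bar>"]) simp

lemma ubdd_time: "(\<And>t. t \<ge> 0 \<Longrightarrow> \<bar>f t\<bar> \<le> B) \<Longrightarrow> ubdd (\<lambda>t _. f t)"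
  by (rule ubddI[of _ B]) simp

lemma ubdd_add:
  assumes "ubdd f" "ubdd g"
  shows "ubdd (\<lambda>t x. f t x + g t x)"
proof (rule ubddE[OF assms(1)], rule ubddE[OF assms(2)])
  fix A B assume "\<And>T X t. traj T X \<Longrightarrow> t \<in> {0..T} \<Longrightarrow> \<bar>f t (X t)\<bar> \<le> A" "\<And>T X t. traj T X \<Longrightarrow> t \<in> {0..T} \<Longrightarrow> \<bar>g t (X t)\<bar> \<le> B"
  then show ?thesis by (intro ubddI[of _ "A + B"] order_trans[OF abs_triangle_ineq] add_mono) auto
qed

lemma ubdd_mult:
  assumes "ubdd f" "ubdd g"
  shows "ubdd (\<lambda>t x. f t x * g t x)"
proof (rule ubddE[OF assms(1)], rule ubddE[OF assms(2)])
  fix A B assume "\<And>T X t. traj T X \<Longrightarrow> t \<in> {0..T} \<Longrightarrow> \<bar>f t (X t)\<bar> \<le> A" "\<And>T X t. traj T X \<Longrightarrow> t \<in> {0..T} \<Longrightarrow> \<bar>g t (X t)\<bar> \<le> B"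
    and "A \<ge> 0"
  then show ?thesis by (intro ubddI[of _ "A * B"]) (simp add: abs_mult mult_mono)
qed

lemma ubdd_cmult: "ubdd f \<Longrightarrow> ubdd (\<lambda>t x. a * f t x)"
  by (intro ubdd_mult ubdd_const)

lemma ubdd_diff: "ubdd f \<Longrightarrow> ubdd g \<Longrightarrow> ubdd (\<lambda>t x. f t x - g t x)"
  using ubdd_add[of f "\<lambda>t x. - 1 * g t x"] ubdd_cmult[of g "- 1"] by simp

lemma ubdd_sum:
  assumes "finite A" "\<And>i. i \<in> A \<Longrightarrow> ubdd (f i)"
  shows "ubdd (\<lambda>t x. \<Sum>i\<in>A. f i t x)"
  using assms by (induction A) (auto intro: ubdd_const[of 0] ubdd_add)

lemma ubdd_if: "(b \<Longrightarrow> ubdd f) \<Longrightarrow> (\<not> b \<Longrightarrow> ubdd g) \<Longrightarrow> ubdd (\<lambda>t x. if b then f t x else g t x)"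
  by (cases b) auto

lemmas ubdd_intros = ubdd_const ubdd_add ubdd_diff ubdd_mult ubdd_sum ubdd_if

section \<open>Linear functionals of the state\<close>

definition lin :: "(state \<Rightarrow> real) \<Rightarrow> bool" where
  "lin g \<longleftrightarrow> (\<exists>a. \<forall>x. g x = (\<Sum>p\<in>idx. a p * x p))"

lemma lin_coord: "p \<in> idx \<Longrightarrow> lin (\<lambda>x. x p)"
  unfolding lin_def by (rule exI[of _ "\<lambda>q. if q = p then 1 else 0"]) (simp add: if_distrib[of "\<lambda>u. u * _"] cong: if_cong)

lemma lin_cmult: assumes "lin g" shows "lin (\<lambda>x. a * g x)"
proof -
  obtain b where "\<And>x. g x = (\<Sum>p\<in>idx. b p * x p)" using assms unfolding lin_def by blast
  then show ?thesis unfolding lin_def by (intro exI[of _ "\<lambda>p. a * b p"]) (simp add: sum_distrib_left mult.assoc)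
qed

lemma lin_add: assumes "lin f" "lin g" shows "lin (\<lambda>x. f x + g x)"
proof -
  obtain a b where "\<And>x. f x = (\<Sum>p\<in>idx. a p * x p)" "\<And>x. g x = (\<Sum>p\<in>idx. b p * x p)"
    using assms unfolding lin_def by blast
  then show ?thesis unfolding lin_def by (intro exI[of _ "\<lambda>p. a p + b p"]) (simp add: sum.distrib distrib_right)
qed

lemma lin_diff: "lin f \<Longrightarrow> lin g \<Longrightarrow> lin (\<lambda>x. f x - g x)"
  using lin_add[of f "\<lambda>x. - 1 * g x"] lin_cmult[of g "- 1"] by simp

lemma lin_sum: "finite A \<Longrightarrow> (\<And>i. i \<in> A \<Longrightarrow> lin (f i)) \<Longrightarrow> lin (\<lambda>x. \<Sum>i\<in>A. f i x)"
proof (induction A rule: finite_induct)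
  case empty
  show ?case unfolding lin_def by (rule exI[of _ "\<lambda>_. 0"]) simp
qed (auto intro: lin_add)

lemma lin_outp: "lin outp"
  unfolding outp_def[abs_def] by (intro lin_sum lin_cmult lin_coord) auto

lemma lin_obs: "lin (obs j)"
  unfolding obs_def[abs_def] by (intro lin_sum lin_cmult lin_coord) auto

lemma lin_eps: "j < n \<Longrightarrow> lin (eps j)"
  unfolding eps_def[abs_def] obs_def fil1_def fil2_def
  by (intro lin_sum lin_cmult lin_coord lin_add lin_diff) auto

lemma lin_traj:
  assumes "lin g" "traj T X"
  shows "continuous_on {0..T} (\<lambda>t. g (X t))" "g (X 0) = g X0"
proof -
  obtain a where a: "\<And>x. g x = (\<Sum>p\<in>idx. a p * x p)" using assms unfolding lin_def by blast
  show "continuous_on {0..T} (\<lambda>t. g (X t))" unfolding a using trajD[OF assms(2)] by (intro continuous_intros) auto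
  show "g (X 0) = g X0" unfolding a using trajD[OF assms(2)] by (intro sum.cong) auto
qed

lemma lin_derivative:
  assumes "lin g" "\<And>p. p \<in> idx \<Longrightarrow> ((\<lambda>t. X t p) has_real_derivative field t (X t) p) (at t)"
  shows "((\<lambda>t. g (X t)) has_real_derivative g (field t (X t))) (at t)"
proof -
  obtain a where a: "\<And>x. g x = (\<Sum>p\<in>idx. a p * x p)" using assms unfolding lin_def by blast
  show ?thesis unfolding a by (intro DERIV_sum DERIV_cmult assms(2))
qed

text \<open>Brings the bounded-input bounded-state property to any linear functionals
  \<open>g i\<close> that satisfy a closed linear equation with a bounded remainder
  \<open>h\<close>, whether they are coordinates or combinations chosen to eliminate the
  input.\<close>

lemma ubdd_hurwitz:
  assumes A: "A \<in> carrier_mat k k" "hurwitz A" and g: "\<And>i. i < k \<Longrightarrow> lin (g i)"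
    and eq: "\<And>i t x. i < k \<Longrightarrow> g i (field t x) = (\<Sum>j<k. A $$ (i, j) * g j x) + h i t x"
    and h: "\<And>i. i < k \<Longrightarrow> ubdd (h i)" and i: "i < k"
  shows "ubdd (\<lambda>_ x. g i x)"
proof -
  obtain K where K: "K \<ge> 0 \<and> (\<forall>T M x g. linear_traj (\<lambda>i j. A $$ (i, j)) k T M x g \<longrightarrow>
    (\<forall>t\<in>{0..T}. \<forall>i<k. \<bar>x t i\<bar> \<le> K * M))"
    using hurwitz_bounded_input_bounded_state[OF A] by (rule exE)
  have "\<exists>B. B \<ge> 0 \<and> (\<forall>T X t. traj T X \<longrightarrow> t \<in> {0..T} \<longrightarrow> \<bar>h i t (X t)\<bar> \<le> B)" if "i < k" for i
    by (rule ubddE[OF h[OF that]]) blast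
  then obtain B where B: "\<And>i. i < k \<Longrightarrow> B i \<ge> 0" "\<And>i T X t. i < k \<Longrightarrow> traj T X \<Longrightarrow> t \<in> {0..T} \<Longrightarrow> \<bar>h i t (X t)\<bar> \<le> B i"
    by metis
  \<comment> \<open>One constant above all inputs and all initial values; it depends on
    \<open>X0\<close> but not on the trajectory or the horizon.\<close>
  define M where "M = (\<Sum>i<k. B i + \<bar>g i X0\<bar>)"
  have M: "B i \<le> M" "\<bar>g i X0\<bar> \<le> M" if "i < k" for i
  proof -
    have "B i + \<bar>g i X0\<bar> \<le> M" unfolding M_def using that B(1)
      by (intro member_le_sum) (auto intro: add_nonneg_nonneg)
    then show "B i \<le> M" "\<bar>g i X0\<bar> \<le> M" using B(1)[OF that] by auto
  qed
  show ?thesis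
  proof (rule ubddI)
    fix T X t assume tr: "traj T X" and t: "t \<in> {0..T}"
    have "linear_traj (\<lambda>i j. A $$ (i, j)) k T M (\<lambda>t i. g i (X t)) (\<lambda>t i. h i t (X t))"
      unfolding linear_traj_def
    proof (intro conjI allI impI ballI)
      obtain S where S: "finite S"
        "\<And>t p. t \<in> {0<..<T} - S \<Longrightarrow> p \<in> idx \<Longrightarrow> ((\<lambda>t. X t p) has_real_derivative field t (X t) p) (at t)"
        using traj_derivative[OF tr] by metis
      have "((\<lambda>t. g i (X t)) has_vector_derivative (\<Sum>j<k. A $$ (i, j) * g j (X t)) + h i t (X t)) (at t)"
        if "t \<in> {0<..<T} - S" "i < k" for t i
        using lin_derivative[OF g[OF that(2)] S(2)[OF that(1)]]
        unfolding has_real_derivative_iff_has_vector_derivative eq[OF that(2)] .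
      then show "\<exists>S. finite S \<and> (\<forall>t\<in>{0<..<T} - S. \<forall>i<k.
         ((\<lambda>t. g i (X t)) has_vector_derivative (\<Sum>j<k. A $$ (i, j) * g j (X t)) + h i t (X t)) (at t))"
        using S(1) by (intro exI[of _ S]) auto
      show "continuous_on {0..T} (\<lambda>t. g i (X t))" if "i < k" for i using lin_traj(1)[OF g[OF that] tr] .
      show "norm (g i (X 0)) \<le> M" if "i < k" for i using lin_traj(2)[OF g[OF that] tr] M(2)[OF that] by simp
      show "norm (h i t (X t)) \<le> M" if "t \<in> {0..T}" "i < k" for t i
        using B(2)[OF that(2) tr that(1)] M(1)[OF that(2)] by simp
    qed
    from K[THEN conjunct2, rule_format, OF this t i] show "\<bar>g i (X t)\<bar> \<le> K * M" .
  qed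
qed

section \<open>The Lyapunov function and its decrease\<close>

definition V :: "state \<Rightarrow> real" where
  "V x = (\<Sum>i<n. \<Sum>j<n. W i j * eps i x * eps j x) + \<bar>kp\<bar> / \<gamma> * (\<Sum>i<2 * n. (x (4, i) - th i)\<^sup>2)"

lemma V_lower: "(err x)\<^sup>2 + \<bar>kp\<bar> / \<gamma> * (\<Sum>i<2 * n. (x (4, i) - th i)\<^sup>2) \<le> V x"
  using kyp(4)[of "\<lambda>i. eps i x"] by (simp only: V_def eps_last)

lemma V_traj:
  assumes "traj T X"
  shows "continuous_on {0..T} (\<lambda>t. V (X t))" "V (X 0) = V X0"
proof -
  have e: "continuous_on {0..T} (\<lambda>t. eps i (X t))" "eps i (X 0) = eps i X0" if "i < n" for i
    using lin_traj[OF lin_eps[OF that] assms] .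
  show "continuous_on {0..T} (\<lambda>t. V (X t))"
    unfolding V_def using e trajD[OF assms] by (intro continuous_intros) auto
  show "V (X 0) = V X0" unfolding V_def using e trajD(2)[OF assms] by simp
qed

text \<open>The gain error \<open>v\<close> contributes twice its product with the output error, and
  the adaptation law contributes the opposite, because \<open>|kp|\<close> times the sign of
  \<open>kp\<close> is \<open>kp\<close>. The weight \<open>|kp| / \<gamma>\<close> in
  \<open>V\<close> is fixed by this cancellation.\<close>

lemma V_derivative:
  assumes X: "\<And>p. p \<in> idx \<Longrightarrow> ((\<lambda>t. X t p) has_real_derivative field t (X t) p) (at t)"
  shows "\<exists>D. ((\<lambda>t. V (X t)) has_real_derivative D) (at t) \<and> D \<le> - \<kappa> * (err (X t))\<^sup>2"
proof -
  let ?x = "X t"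
  define e where "e i = eps i ?x" for i
  define v where "v = kp * (\<Sum>i<2 * n. (?x (4, i) - th i) * omega t ?x i)"
  define e' where "e' j = (\<Sum>k<n. companion n Q $$ (j, k) * e k) + coeff Zm j * v" for j
  have ed: "((\<lambda>t. eps i (X t)) has_real_derivative e' i) (at t)" if "i < n" for i
    using lin_derivative[OF lin_eps[OF that] X] eps_field[OF that, of t ?x] by (simp add: e'_def e_def v_def)
  have td: "((\<lambda>t. X t (4, i)) has_real_derivative - \<gamma> * sgn kp * err ?x * omega t ?x i) (at t)" if "i < 2 * n" for i
    using X[of "(4, i)"] that by (simp add: field_component)
  define D1 where "D1 = (\<Sum>i<n. \<Sum>j<n. W i j * e' i * e j + W i j * e i * e' j)"
  define D2 where "D2 = \<bar>kp\<bar> / \<gamma> * (\<Sum>i<2 * n. 2 * (?x (4, i) - th i) * (- \<gamma> * sgn kp * err ?x * omega t ?x i))"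
  have "((\<lambda>t. V (X t)) has_real_derivative D1 + D2) (at t)"
    unfolding V_def D1_def D2_def
  proof (intro DERIV_add DERIV_cmult DERIV_sum)
    fix i j assume "i \<in> {..<n}" "j \<in> {..<n}"
    then show "((\<lambda>t. W i j * eps i (X t) * eps j (X t)) has_real_derivative W i j * e' i * e j + W i j * e i * e' j) (at t)"
      unfolding e_def by (auto intro!: derivative_eq_intros ed)
  next
    fix i assume "i \<in> {..<2 * n}"
    then show "((\<lambda>t. (X t (4, i) - th i)\<^sup>2) has_real_derivative 2 * (?x (4, i) - th i) * (- \<gamma> * sgn kp * err ?x * omega t ?x i)) (at t)"
      by (auto intro!: derivative_eq_intros td)
  qed
  moreover have "D1 + D2 \<le> - \<kappa> * (err ?x)\<^sup>2"
  proof -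
    have "(\<Sum>i<n. \<Sum>j<n. W i j * e' i * e j) = (\<Sum>i<n. \<Sum>j<n. W i j * e i * e' j)"
      by (subst sum.swap) (auto intro!: sum.cong simp: kyp(2))
    then have "D1 = 2 * (\<Sum>i<n. \<Sum>j<n. W i j * e i * e' j)" by (simp add: D1_def sum.distrib)
    also have "(\<Sum>i<n. \<Sum>j<n. W i j * e i * e' j) =
        (\<Sum>i<n. \<Sum>j<n. W i j * e i * (\<Sum>k<n. companion n Q $$ (j, k) * e k)) + (\<Sum>i<n. (\<Sum>j<n. W i j * coeff Zm j) * e i) * v"
      unfolding e'_def by (simp add: distrib_left sum.distrib sum_distrib_left sum_distrib_right mult_ac)
    \<comment> \<open>\<open>kyp(3)\<close> says that \<open>W\<close> maps the input vector to the
      output vector, so the mixed term sees only the last coordinate, the measured error.\<close>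
    also have "(\<Sum>i<n. (\<Sum>j<n. W i j * coeff Zm j) * e i) = (\<Sum>i<n. if i = n - 1 then e i else 0)"
      by (intro sum.cong) (auto simp: kyp(3))
    also have "\<dots> = err ?x" using n eps_last[of ?x] by (simp add: e_def)
    finally have "D1 \<le> - \<kappa> * (err ?x)\<^sup>2 + 2 * (err ?x * v)" using kyp(5)[of e] eps_last[of ?x] by (simp add: e_def)
    moreover have "D2 = - 2 * (err ?x * v)"
    proof -
      have "D2 = \<bar>kp\<bar> / \<gamma> * (- 2 * \<gamma> * sgn kp * err ?x * (\<Sum>i<2 * n. (?x (4, i) - th i) * omega t ?x i))"
        unfolding D2_def sum_distrib_left by (intro sum.cong refl) (simp add: algebra_simps)
      also have "\<dots> = - 2 * (err ?x * ((\<bar>kp\<bar> * sgn kp) * (\<Sum>i<2 * n. (?x (4, i) - th i) * omega t ?x i)))"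
        using \<gamma> by simp
      finally show ?thesis by (simp add: v_def abs_mult_sgn)
    qed
    ultimately show ?thesis by linarith
  qed
  ultimately show ?thesis by blast
qed

lemma lin_err: "lin err"
  using lin_eps[of "n - 1"] n eps_last by (simp add: lin_def)

lemma V_decrease:
  assumes tr: "traj T X"
  shows "V (X T) + \<kappa> * integral {0..T} (\<lambda>t. (err (X t))\<^sup>2) \<le> V X0"
proof -
  obtain S where S: "finite S"
    "\<And>t p. t \<in> {0<..<T} - S \<Longrightarrow> p \<in> idx \<Longrightarrow> ((\<lambda>t. X t p) has_real_derivative field t (X t) p) (at t)"
    using traj_derivative[OF tr] by metis
  have "\<exists>D. \<forall>t\<in>{0<..<T} - S. ((\<lambda>t. V (X t)) has_real_derivative D t) (at t) \<and> D t \<le> - \<kappa> * (err (X t))\<^sup>2"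
    using V_derivative[OF S(2)] by (intro bchoice) blast
  then obtain D where D: "\<And>t. t \<in> {0<..<T} - S \<Longrightarrow> ((\<lambda>t. V (X t)) has_real_derivative D t) (at t)"
    "\<And>t. t \<in> {0<..<T} - S \<Longrightarrow> D t \<le> - \<kappa> * (err (X t))\<^sup>2" by blast
  have "V (X T) - V (X 0) \<le> integral {0..T} (\<lambda>t. - \<kappa> * (err (X t))\<^sup>2)"
    by (rule increment_le_integral[OF S(1) trajD(1)[OF tr] V_traj(1)[OF tr], where f' = D])
      (use D in \<open>auto intro!: continuous_intros lin_traj(1)[OF lin_err tr]\<close>)
  then show ?thesis using V_traj(2)[OF tr] by simp
qed

lemma V_bound:
  assumes tr: "traj T X" and t: "t \<in> {0..T}"
  shows "V (X t) \<le> V X0"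
proof -
  have tr': "traj t X" using traj_restrict[OF tr] t by auto
  have "0 \<le> integral {0..t} (\<lambda>t. (err (X t))\<^sup>2)"
    by (intro integral_nonneg integrable_continuous_real continuous_intros lin_traj(1)[OF lin_err tr']) auto
  then show ?thesis using V_decrease[OF tr'] kyp(1) by (smt (verit) mult_nonneg_nonneg)
qed

section \<open>Boundedness of all signals\<close>

lemma ubdd_err: "ubdd (\<lambda>_. err)"
proof (rule ubddI)
  fix T X t assume "traj T X" "t \<in> {0..T}"
  from V_bound[OF this] have "V (X t) \<le> V X0" .
  moreover have "0 \<le> \<bar>kp\<bar> / \<gamma> * (\<Sum>i<2 * n. (X t (4, i) - th i)\<^sup>2)"
    using \<gamma> by (intro mult_nonneg_nonneg sum_nonneg divide_nonneg_nonneg) auto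
  ultimately have "(err (X t))\<^sup>2 \<le> V X0" using V_lower[of "X t"] by linarith
  then show "\<bar>err (X t)\<bar> \<le> sqrt (V X0)" by (rule real_le_rsqrt[of "\<bar>err (X t)\<bar>", simplified])
qed

lemma ubdd_gain: assumes i: "i < 2 * n" shows "ubdd (\<lambda>_ x. x (4, i))"
proof -
  have "ubdd (\<lambda>_ x. x (4, i) - th i)"
  proof (rule ubddI)
    fix T X t assume "traj T X" "t \<in> {0..T}"
    from V_bound[OF this] have "V (X t) \<le> V X0" .
    then have "\<bar>kp\<bar> / \<gamma> * (\<Sum>i<2 * n. (X t (4, i) - th i)\<^sup>2) \<le> V X0"
      using V_lower[of "X t"] zero_le_power2[of "err (X t)"] by linarith
    then have "(\<Sum>i<2 * n. (X t (4, i) - th i)\<^sup>2) \<le> V X0 * \<gamma> / \<bar>kp\<bar>" using kp \<gamma> by (simp add: field_simps)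
    moreover have "(X t (4, i) - th i)\<^sup>2 \<le> (\<Sum>i<2 * n. (X t (4, i) - th i)\<^sup>2)"
      using i by (intro member_le_sum) auto
    ultimately have "(X t (4, i) - th i)\<^sup>2 \<le> V X0 * \<gamma> / \<bar>kp\<bar>" by linarith
    then show "\<bar>X t (4, i) - th i\<bar> \<le> sqrt (V X0 * \<gamma> / \<bar>kp\<bar>)" by (rule real_le_rsqrt[of "\<bar>X t (4, i) - th i\<bar>", simplified])
  qed
  from ubdd_add[OF this ubdd_const[of "th i"]] show ?thesis by simp
qed

lemma ubdd_model: assumes i: "i < n" shows "ubdd (\<lambda>_ x. x (1, i))"
proof (rule ubdd_hurwitz[OF companion_carrier hurwitz(1), of "\<lambda>i x. x (1, i)" "\<lambda>i t x. km * r t * bm i + err x * lm i"])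
  show "ubdd (\<lambda>t x. km * r t * bm i + err x * lm i)" for i
    by (intro ubdd_intros ubdd_err ubdd_time[OF Rb])
qed (auto simp: field_component i intro!: lin_coord)

lemma ubdd_outp: "ubdd (\<lambda>_. outp)"
  using ubdd_add[OF ubdd_err ubdd_model[of "n - 1"]] n by (simp add: err_def)

lemma ubdd_filter2: assumes i: "i < n - 1" shows "ubdd (\<lambda>_ x. x (3, i))"
proof (rule ubdd_hurwitz[OF carrier hurwitz(2), of "\<lambda>i x. x (3, i)" "\<lambda>i t x. outp x * bl i"])
  show "ubdd (\<lambda>t x. outp x * bl i)" for i by (intro ubdd_intros ubdd_outp)
qed (use i in \<open>auto simp: field_component intro!: lin_coord\<close>)

lemma outp_field: "outp (field t x) = (if n = 1 then 0 else obs (n - 2) x) - coeff P (n - 1) * outp x + ctrl t x * kp"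
proof -
  have "outp (field t x) = obs (n - 1) (field t x)" by (rule obs_last[symmetric])
  moreover have "n - 1 - 1 = n - 2" "n - 1 = 0 \<longleftrightarrow> n = 1" using n by auto
  ultimately show ?thesis using deg unfolding obs_field by simp
qed

text \<open>Eliminating the input between \<open>obs j\<close> and the output leaves the zero dynamics of the plant.\<close>

lemma ubdd_obs: assumes j: "j < n" shows "ubdd (\<lambda>_. obs j)"
proof (cases "j = n - 1")
  case True
  have "obs (n - 1) = outp" by (rule ext) (rule obs_last)
  then show ?thesis using ubdd_outp True by simp
next
  case False
  then have j': "j < n - 1" using j by simp
  define g where "g j x = obs j x - coeff Z j * outp x" for j x
  \<comment> \<open>What remains after \<open>obs\<close> is written as \<open>g\<close> plus
    \<open>coeff Z\<close> times the output: the shifts become the companion matrix of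
    \<open>Z\<close>, which is Hurwitz, and all other terms are multiples of the bounded
    output.\<close>
  define h where "h j x = ((if j = 0 then 0 else coeff Z (j - 1)) - coeff Z j * coeff Z (n - 2)
    + coeff Z j * coeff P (n - 1) - coeff P j) * outp x" for j x
  have "ubdd (\<lambda>_. g j)"
  proof (rule ubdd_hurwitz[OF companion_carrier hurwitz(3), of g "\<lambda>j _. h j"])
    show "lin (g j)" for j unfolding g_def[abs_def] by (intro lin_diff lin_obs lin_cmult lin_outp)
    show "ubdd (\<lambda>_. h j)" for j unfolding h_def[abs_def] by (intro ubdd_cmult ubdd_outp)
    fix i t x assume i: "i < n - 1"
    then have n2: "n - 1 - 1 = n - 2" "n \<noteq> 1" by auto
    show "g i (field t x) = (\<Sum>j<n-1. companion (n - 1) Z $$ (i, j) * g j x) + h i x"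
      using companion_row_sum[OF i, of "\<lambda>x. x" Z "\<lambda>j. g j x"] n2
      by (cases "i = 0") (simp_all add: g_def h_def obs_field outp_field algebra_simps)
  qed (fact j')
  from ubdd_add[OF this ubdd_cmult[OF ubdd_outp, of "coeff Z j"]] show ?thesis by (simp add: g_def)
qed

text \<open>The input drives this filter and is not yet known to be bounded. Because it enters the
  derivative of the output with the factor \<open>kp\<close>, subtracting \<open>bl i / kp\<close>
  times the output removes it and leaves a stable filter with bounded input.\<close>

lemma ubdd_filter1: assumes i: "i < n - 1" shows "ubdd (\<lambda>_ x. x (2, i))"
proof -
  define g where "g i x = x (2, i) - bl i / kp * outp x" for i and x :: "state"
  define h where "h i x = (\<Sum>j<n-1. \<Lambda> $$ (i, j) * (bl j / kp)) * outp x
    - bl i / kp * (obs (n - 2) x - coeff P (n - 1) * outp x)" for i x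
  have "ubdd (\<lambda>_. g i)"
  proof (rule ubdd_hurwitz[OF carrier hurwitz(2), of g "\<lambda>i _. h i"])
    show "lin (g i)" if "i < n - 1" for i unfolding g_def[abs_def] using that by (intro lin_diff lin_coord lin_cmult lin_outp) simp
    show "ubdd (\<lambda>_. h i)" for i unfolding h_def[abs_def] using n by (intro ubdd_diff ubdd_cmult ubdd_outp ubdd_obs) auto
    fix i t x assume i: "i < n - 1"
    then have "n \<noteq> 1" by auto
    moreover have "(\<Sum>j<n-1. \<Lambda> $$ (i, j) * g j x) = (\<Sum>j<n-1. \<Lambda> $$ (i, j) * x (2, j)) - (\<Sum>j<n-1. \<Lambda> $$ (i, j) * (bl j / kp)) * outp x"
      unfolding g_def by (simp add: right_diff_distrib sum_subtractf sum_distrib_right mult.assoc)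
    moreover have "bl i / kp * (ctrl t x * kp) = ctrl t x * bl i" using kp by simp
    ultimately show "g i (field t x) = (\<Sum>j<n-1. \<Lambda> $$ (i, j) * g j x) + h i x"
      by (simp add: g_def h_def field_component outp_field distrib_left right_diff_distrib)
  qed (fact i)
  from ubdd_add[OF this ubdd_cmult[OF ubdd_outp, of "bl i / kp"]] show ?thesis by (simp add: g_def)
qed

text \<open>The map from the plant state to the coordinates \<open>obs j\<close> is invertible, by
  the determinant condition in \<open>M\<close>.\<close>

lemma ubdd_plant: assumes i: "i < n" shows "ubdd (\<lambda>_ x. x (0, i))"
proof -
  let ?T = "mat n n (\<lambda>(j, i). coeff (M i) j)"
  have T: "?T \<in> carrier_mat n n" by simp
  obtain B where B: "B \<in> carrier_mat n n" "B * ?T = 1\<^sub>m n"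
    using det_non_zero_imp_unit[OF T M(3), of "()"] by (auto simp: Units_def ring_mat_def)
  have BT: "(\<Sum>j<n. B $$ (i, j) * coeff (M l) j) = (if i = l then 1 else 0)" if l: "l < n" for l
  proof -
    have "(B * ?T) $$ (i, l) = (\<Sum>j<n. B $$ (i, j) * coeff (M l) j)"
      using B(1) i l by (auto simp: scalar_prod_def lessThan_atLeast0)
    then show ?thesis using B(2) i l by simp
  qed
  have "x (0, i) = (\<Sum>j<n. B $$ (i, j) * obs j x)" for x
  proof -
    have "(\<Sum>j<n. B $$ (i, j) * obs j x) = (\<Sum>l<n. (\<Sum>j<n. B $$ (i, j) * coeff (M l) j) * x (0, l))"
      unfolding obs_def sum_distrib_left sum_distrib_right by (subst sum.swap) (simp add: mult.assoc)
    also have "\<dots> = (\<Sum>l<n. if i = l then x (0, l) else 0)" by (intro sum.cong) (auto simp: BT)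
    finally show ?thesis using i by simp
  qed
  then show ?thesis using ubdd_sum[of "{..<n}" "\<lambda>j _ x. B $$ (i, j) * obs j x"] ubdd_cmult[OF ubdd_obs] by simp
qed

theorem ubdd_state: assumes "p \<in> idx" shows "ubdd (\<lambda>_ x. x p)"
  using assms ubdd_plant ubdd_model ubdd_filter1 ubdd_filter2 ubdd_gain by (auto simp: idx_def)

lemma ubdd_omega: assumes "i < 2 * n" shows "ubdd (\<lambda>t x. omega t x i)"
  unfolding omega_def using assms
  by (intro ubdd_if ubdd_time[OF Rb] ubdd_filter1 ubdd_filter2 ubdd_outp) auto

lemma ubdd_ctrl: "ubdd ctrl"
  unfolding ctrl_def[abs_def] by (intro ubdd_sum ubdd_mult ubdd_gain ubdd_omega) auto

lemma state_bound: "\<exists>R. \<forall>T X t p. traj T X \<longrightarrow> t \<in> {0..T} \<longrightarrow> p \<in> idx \<longrightarrow> \<bar>X t p\<bar> \<le> R"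
proof -
  have "\<exists>B. B \<ge> 0 \<and> (\<forall>T X t. traj T X \<longrightarrow> t \<in> {0..T} \<longrightarrow> \<bar>X t p\<bar> \<le> B)" if "p \<in> idx" for p
    by (rule ubddE[OF ubdd_state[OF that]]) blast
  then obtain B where B: "\<And>p. p \<in> idx \<Longrightarrow> B p \<ge> 0" "\<And>p T X t. p \<in> idx \<Longrightarrow> traj T X \<Longrightarrow> t \<in> {0..T} \<Longrightarrow> \<bar>X t p\<bar> \<le> B p"
    by metis
  show ?thesis
  proof (intro exI[of _ "sum B idx"] allI impI)
    fix T X t p assume "traj T X" "t \<in> {0..T}" "p \<in> idx"
    then show "\<bar>X t p\<bar> \<le> sum B idx"
      using B(2) member_le_sum[of p idx B] B(1) by (meson DiffD1 finite_idx order_trans)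
  qed
qed

lemma err_square_integral:
  assumes tr: "traj T X"
  shows "integral {0..T} (\<lambda>t. (err (X t))\<^sup>2) \<le> V X0 / \<kappa>"
proof -
  have "0 \<le> (err (X T))\<^sup>2 + \<bar>kp\<bar> / \<gamma> * (\<Sum>i<2 * n. (X T (4, i) - th i)\<^sup>2)"
    using \<gamma> by (intro add_nonneg_nonneg mult_nonneg_nonneg sum_nonneg divide_nonneg_nonneg) auto
  then have "\<kappa> * integral {0..T} (\<lambda>t. (err (X t))\<^sup>2) \<le> V X0"
    using V_decrease[OF tr] V_lower[of "X T"] by linarith
  then show ?thesis using kyp(1) by (simp add: field_simps)
qed

text \<open>By now the control is bounded, hence also the derivative of the error. A Lipschitz
  constant survives the jumps of \<open>r\<close>, where the error need not be
  differentiable.\<close>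

lemma err_lipschitz:
  "\<exists>L. \<forall>T X s t. traj T X \<longrightarrow> 0 \<le> s \<longrightarrow> s \<le> t \<longrightarrow> t \<le> T \<longrightarrow> \<bar>err (X t) - err (X s)\<bar> \<le> L * (t - s)"
proof -
  have "ubdd (\<lambda>t x. err (field t x))"
    unfolding err_def outp_field using n
    by (intro ubdd_intros ubdd_outp ubdd_obs ubdd_ctrl) (auto simp: field_component intro!: ubdd_intros ubdd_model[unfolded One_nat_def] ubdd_err ubdd_time[OF Rb])
  then obtain L where L: "\<forall>T X. traj T X \<longrightarrow> (\<forall>t\<in>{0..T}. \<bar>err (field t (X t))\<bar> \<le> L)"
    unfolding ubdd_def by (rule exE)
  show ?thesis
  proof (intro exI[of _ L] allI impI)
    fix T X s t assume tr: "traj T X" and st: "0 \<le> s" "s \<le> t" "t \<le> T"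
    obtain S where S: "finite S"
      "\<And>t p. t \<in> {0<..<T} - S \<Longrightarrow> p \<in> idx \<Longrightarrow> ((\<lambda>t. X t p) has_real_derivative field t (X t) p) (at t)"
      using traj_derivative[OF tr] by metis
    have "norm (err (X t) - err (X s)) \<le> L * t - L * s"
    proof (rule norm_increment_le[OF S(1) st(2), where g' = "\<lambda>_. L"])
      show "continuous_on {s..t} (\<lambda>t. err (X t))"
        by (rule continuous_on_subset[OF lin_traj(1)[OF lin_err tr]]) (use st in auto)
      show "((\<lambda>t. err (X t)) has_vector_derivative err (field u (X u))) (at u)" if "u \<in> {s<..<t} - S" for u
        unfolding has_real_derivative_iff_has_vector_derivative[symmetric]
        by (rule lin_derivative[OF lin_err S(2)]) (use that st in auto)
      show "norm (err (field u (X u))) \<le> L" if "u \<in> {s<..<t} - S" for u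
        using L[rule_format, OF tr, of u] that st by simp
    qed (auto intro!: continuous_intros derivative_eq_intros)
    then show "\<bar>err (X t) - err (X s)\<bar> \<le> L * (t - s)" by (simp add: right_diff_distrib)
  qed
qed

section \<open>Global existence by truncation of the vector field\<close>

definition clip :: "real \<Rightarrow> state \<Rightarrow> state" where
  "clip R x p = (if p \<in> idx then max (- R) (min R (x p)) else 0)"

text \<open>Boundedness is part of the notion because the field contains products of states, and
  products of Lipschitz functions stay Lipschitz when the factors are bounded. The last clause is
  the continuity that \<open>picard_lindeloef_global\<close> asks for.\<close>

definition nice :: "real set \<Rightarrow> (real \<Rightarrow> state \<Rightarrow> real) \<Rightarrow> bool" where
  "nice E f \<longleftrightarrow>
     (\<exists>B L. 0 \<le> B \<and> 0 \<le> L \<and> (\<forall>t\<ge>0. \<forall>x y. \<bar>f t x\<bar> \<le> B \<and> \<bar>f t x - f t y\<bar> \<le> L * (\<Sum>p\<in>idx. \<bar>x p - y p\<bar>))) \<and>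
     (\<forall>X. \<forall>t\<ge>0. t \<notin> E \<longrightarrow> (\<forall>p\<in>idx. continuous_on {0..} (\<lambda>t. X t p)) \<longrightarrow>
        continuous (at t within {0..}) (\<lambda>t. f t (X t)))"

lemma niceI:
  assumes "0 \<le> B" "0 \<le> L" "\<And>t x. t \<ge> 0 \<Longrightarrow> \<bar>f t x\<bar> \<le> B"
    "\<And>t x y. t \<ge> 0 \<Longrightarrow> \<bar>f t x - f t y\<bar> \<le> L * (\<Sum>p\<in>idx. \<bar>x p - y p\<bar>)"
    "\<And>X t. t \<ge> 0 \<Longrightarrow> t \<notin> E \<Longrightarrow> (\<And>p. p \<in> idx \<Longrightarrow> continuous_on {0..} (\<lambda>t. X t p)) \<Longrightarrow>
       continuous (at t within {0..}) (\<lambda>t. f t (X t))"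
  shows "nice E f"
  unfolding nice_def
proof (rule conjI, rule exI[of _ B], rule exI[of _ L], intro conjI allI impI)
  show "\<forall>X. \<forall>t\<ge>0. t \<notin> E \<longrightarrow> (\<forall>p\<in>idx. continuous_on {0..} (\<lambda>t. X t p)) \<longrightarrow> continuous (at t within {0..}) (\<lambda>t. f t (X t))"
    using assms(5) by simp
qed (use assms in auto)

lemma niceE:
  assumes "nice E f"
  obtains B L where "0 \<le> B" "0 \<le> L" "\<And>t x. t \<ge> 0 \<Longrightarrow> \<bar>f t x\<bar> \<le> B"
    "\<And>t x y. t \<ge> 0 \<Longrightarrow> \<bar>f t x - f t y\<bar> \<le> L * (\<Sum>p\<in>idx. \<bar>x p - y p\<bar>)"
proof -
  from assms obtain B L where "0 \<le> B \<and> 0 \<le> L \<and> (\<forall>t\<ge>0. \<forall>x y. \<bar>f t x\<bar> \<le> B \<and> \<bar>f t x - f t y\<bar> \<le> L * (\<Sum>p\<in>idx. \<bar>x p - y p\<bar>))"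
    unfolding nice_def by (elim conjE exE) (rule that, intro conjI)
  then show thesis by (intro that[of B L]) auto
qed

lemma nice_continuous:
  assumes "nice E f" "t \<ge> 0" "t \<notin> E" "\<And>p. p \<in> idx \<Longrightarrow> continuous_on {0..} (\<lambda>t. X t p)"
  shows "continuous (at t within {0..}) (\<lambda>t. f t (X t))"
  using assms(1)[unfolded nice_def, THEN conjunct2, rule_format, OF assms(2,3)] assms(4) by simp

lemma nice_const: "nice E (\<lambda>_ _. a)"
  by (rule niceI[of "\<bar>a\<bar>" 0]) auto

lemma nice_time:
  assumes "\<And>t. t \<ge> 0 \<Longrightarrow> \<bar>f t\<bar> \<le> B" "\<And>t. t \<ge> 0 \<Longrightarrow> t \<notin> E \<Longrightarrow> continuous (at t within {0..}) f"
  shows "nice E (\<lambda>t _. f t)"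
  by (rule niceI[of "\<bar>B\<bar>" 0]) (use assms in \<open>auto intro: order_trans[OF _ abs_ge_self]\<close>)

lemma nice_clip:
  assumes R: "R \<ge> 0"
  shows "nice E (\<lambda>_ x. clip R x q)"
proof (cases "q \<in> idx")
  case False
  then show ?thesis using nice_const[of E 0] by (simp add: clip_def)
next
  case True
  show ?thesis
  proof (rule niceI[of R 1])
    fix t and x y :: "state"
    have "\<bar>clip R x q - clip R y q\<bar> \<le> \<bar>x q - y q\<bar>" using True by (auto simp: clip_def max_def min_def)
    also have "\<dots> \<le> (\<Sum>p\<in>idx. \<bar>x p - y p\<bar>)" using True by (intro member_le_sum) auto
    finally show "\<bar>clip R x q - clip R y q\<bar> \<le> 1 * (\<Sum>p\<in>idx. \<bar>x p - y p\<bar>)" by simp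
  next
    fix X :: "real \<Rightarrow> state" and t :: real
    assume "t \<ge> 0" "\<And>p. p \<in> idx \<Longrightarrow> continuous_on {0..} (\<lambda>t. X t p)"
    then have "continuous_on {0..} (\<lambda>t. clip R (X t) q)"
      using True by (simp add: clip_def) (intro continuous_intros)
    then show "continuous (at t within {0..}) (\<lambda>t. clip R (X t) q)"
      using \<open>t \<ge> 0\<close> by (simp add: continuous_on_eq_continuous_within)
  qed (use R in \<open>auto simp: clip_def\<close>)
qed

lemma nice_add:
  assumes f: "nice E f" and g: "nice E g"
  shows "nice E (\<lambda>t x. f t x + g t x)"
proof (rule niceE[OF f], rule niceE[OF g])
  fix A K B L
  assume *: "0 \<le> A" "0 \<le> K" "\<And>t x. t \<ge> 0 \<Longrightarrow> \<bar>f t x\<bar> \<le> A"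
    "\<And>t x y. t \<ge> 0 \<Longrightarrow> \<bar>f t x - f t y\<bar> \<le> K * (\<Sum>p\<in>idx. \<bar>x p - y p\<bar>)"
    "0 \<le> B" "0 \<le> L" "\<And>t x. t \<ge> 0 \<Longrightarrow> \<bar>g t x\<bar> \<le> B"
    "\<And>t x y. t \<ge> 0 \<Longrightarrow> \<bar>g t x - g t y\<bar> \<le> L * (\<Sum>p\<in>idx. \<bar>x p - y p\<bar>)"
  show ?thesis
  proof (rule niceI[of "A + B" "K + L"])
    fix t :: real and x y :: "state" assume t: "t \<ge> 0"
    show "\<bar>f t x + g t x\<bar> \<le> A + B" using *(3,7)[OF t, of x] by linarith
    show "\<bar>f t x + g t x - (f t y + g t y)\<bar> \<le> (K + L) * (\<Sum>p\<in>idx. \<bar>x p - y p\<bar>)"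
      unfolding distrib_right using *(4,8)[OF t, of x y] by linarith
  qed (use * in \<open>auto intro!: continuous_add nice_continuous[OF f] nice_continuous[OF g]\<close>)
qed

lemma nice_mult:
  assumes f: "nice E f" and g: "nice E g"
  shows "nice E (\<lambda>t x. f t x * g t x)"
proof (rule niceE[OF f], rule niceE[OF g])
  fix A K B L
  assume *: "0 \<le> A" "0 \<le> K" "\<And>t x. t \<ge> 0 \<Longrightarrow> \<bar>f t x\<bar> \<le> A"
    "\<And>t x y. t \<ge> 0 \<Longrightarrow> \<bar>f t x - f t y\<bar> \<le> K * (\<Sum>p\<in>idx. \<bar>x p - y p\<bar>)"
    "0 \<le> B" "0 \<le> L" "\<And>t x. t \<ge> 0 \<Longrightarrow> \<bar>g t x\<bar> \<le> B"
    "\<And>t x y. t \<ge> 0 \<Longrightarrow> \<bar>g t x - g t y\<bar> \<le> L * (\<Sum>p\<in>idx. \<bar>x p - y p\<bar>)"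
  show ?thesis
  proof (rule niceI[of "A * B" "A * L + B * K"])
    fix t :: real and x y :: "state" assume t: "t \<ge> 0"
    let ?s = "\<Sum>p\<in>idx. \<bar>x p - y p\<bar>"
    show "\<bar>f t x * g t x\<bar> \<le> A * B" using *(1,3,5,7) t by (simp add: abs_mult mult_mono)
    have "f t x * g t x - f t y * g t y = f t x * (g t x - g t y) + g t y * (f t x - f t y)" by (simp add: algebra_simps)
    also have "\<bar>\<dots>\<bar> \<le> A * (L * ?s) + B * (K * ?s)"
      using *(1-8) t by (intro order_trans[OF abs_triangle_ineq] add_mono) (auto simp: abs_mult intro!: mult_mono)
    finally show "\<bar>f t x * g t x - f t y * g t y\<bar> \<le> (A * L + B * K) * ?s" by (simp add: algebra_simps)
  qed (use * in \<open>auto intro!: continuous_mult nice_continuous[OF f] nice_continuous[OF g]\<close>)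
qed

lemma nice_diff: "nice E f \<Longrightarrow> nice E g \<Longrightarrow> nice E (\<lambda>t x. f t x - g t x)"
  using nice_add[of E f "\<lambda>t x. - 1 * g t x"] nice_mult[OF nice_const[of E "- 1"], of g] by simp

lemma nice_sum: "finite A \<Longrightarrow> (\<And>i. i \<in> A \<Longrightarrow> nice E (f i)) \<Longrightarrow> nice E (\<lambda>t x. \<Sum>i\<in>A. f i t x)"
  by (induction A rule: finite_induct) (auto intro: nice_const[of _ 0] nice_add)

lemma nice_if: "(b \<Longrightarrow> nice E f) \<Longrightarrow> (\<not> b \<Longrightarrow> nice E g) \<Longrightarrow> nice E (\<lambda>t x. if b then f t x else g t x)"
  by (cases b) auto

lemmas nice_intros = nice_if nice_const nice_add nice_diff nice_mult nice_sum

lemma nice_field: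
  assumes R: "R \<ge> 0" and r: "\<And>t. t \<ge> 0 \<Longrightarrow> t \<notin> E \<Longrightarrow> continuous (at t within {0..}) r"
  shows "nice E (\<lambda>t x. field t (clip R x) p)"
proof -
  note clip = nice_clip[OF R, of E]
  have outp: "nice E (\<lambda>t x. outp (clip R x))" unfolding outp_def by (intro nice_intros clip) auto
  have err: "nice E (\<lambda>t x. err (clip R x))" unfolding err_def by (intro nice_diff outp clip)
  have omega: "nice E (\<lambda>t x. omega t (clip R x) i)" for i
    unfolding omega_def by (intro nice_if nice_time[OF Rb r] outp clip)
  have ctrl: "nice E (\<lambda>t x. ctrl t (clip R x))" unfolding ctrl_def by (intro nice_sum nice_mult clip omega) auto
  show ?thesis
    unfolding field_def case_prod_beta
    by (intro nice_intros clip outp err omega ctrl nice_time[OF Rb r]) auto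
qed

text \<open>The truncated field has a global solution. If that left the region where the truncation
  is inactive, then up to the first time it reaches the level \<open>R\<close> it would be a genuine
  trajectory and so stay within \<open>R0 < R\<close>.\<close>

theorem global_solution:
  assumes E: "\<And>T. finite (E \<inter> {0..T})" and r: "\<And>t. t \<ge> 0 \<Longrightarrow> t \<notin> E \<Longrightarrow> continuous (at t within {0..}) r"
  obtains X where "\<And>p. p \<in> idx \<Longrightarrow> X 0 p = X0 p" "\<And>p. p \<in> idx \<Longrightarrow> continuous_on {0..} (\<lambda>t. X t p)"
    "\<And>t p. t \<ge> 0 \<Longrightarrow> t \<notin> E \<Longrightarrow> p \<in> idx \<Longrightarrow> ((\<lambda>t. X t p) has_real_derivative field t (X t) p) (at t within {0..})"
proof -
  obtain R0 where R0: "\<forall>T X t p. traj T X \<longrightarrow> t \<in> {0..T} \<longrightarrow> p \<in> idx \<longrightarrow> \<bar>X t p\<bar> \<le> R0"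
    using state_bound by (rule exE)
  \<comment> \<open>Strictly above the a priori bound, so that reaching the level \<open>R\<close>
    contradicts it.\<close>
  define R where "R = \<bar>R0\<bar> + 1"
  have R: "R \<ge> 0" "R > R0" by (auto simp: R_def)
  have nice: "nice E (\<lambda>t x. field t (clip R x) p)" for p by (rule nice_field[OF R(1) r])
  have "\<exists>B L. 0 \<le> B \<and> 0 \<le> L \<and> (\<forall>t\<ge>0. \<forall>x y. \<bar>field t (clip R x) p\<bar> \<le> B \<and>
      \<bar>field t (clip R x) p - field t (clip R y) p\<bar> \<le> L * (\<Sum>p\<in>idx. \<bar>x p - y p\<bar>))" for p
    using nice[of p] unfolding nice_def by (rule conjunct1)
  then have "\<forall>p. \<exists>B L. 0 \<le> B \<and> 0 \<le> L \<and> (\<forall>t\<ge>0. \<forall>x y. \<bar>field t (clip R x) p\<bar> \<le> B \<and>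
      \<bar>field t (clip R x) p - field t (clip R y) p\<bar> \<le> L * (\<Sum>p\<in>idx. \<bar>x p - y p\<bar>))" by (rule allI)
  from choice[OF this] obtain B where
    "\<forall>p. \<exists>L. 0 \<le> B p \<and> 0 \<le> L \<and> (\<forall>t\<ge>0. \<forall>x y. \<bar>field t (clip R x) p\<bar> \<le> B p \<and>
      \<bar>field t (clip R x) p - field t (clip R y) p\<bar> \<le> L * (\<Sum>p\<in>idx. \<bar>x p - y p\<bar>))" by (rule exE)
  from choice[OF this] obtain L where
    BL': "\<forall>p. 0 \<le> B p \<and> 0 \<le> L p \<and> (\<forall>t\<ge>0. \<forall>x y. \<bar>field t (clip R x) p\<bar> \<le> B p \<and>
      \<bar>field t (clip R x) p - field t (clip R y) p\<bar> \<le> L p * (\<Sum>p\<in>idx. \<bar>x p - y p\<bar>))" by (rule exE)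
  have BL: "0 \<le> B p" "0 \<le> L p" "t \<ge> 0 \<Longrightarrow> \<bar>field t (clip R x) p\<bar> \<le> B p"
    "t \<ge> 0 \<Longrightarrow> \<bar>field t (clip R x) p - field t (clip R y) p\<bar> \<le> L p * (\<Sum>p\<in>idx. \<bar>x p - y p\<bar>)" for t x y p
    using BL' by blast+
  obtain X where X: "\<And>p. p \<in> idx \<Longrightarrow> X 0 p = X0 p" "\<And>p. p \<in> idx \<Longrightarrow> continuous_on {0..} (\<lambda>t. X t p)"
    "\<And>t p. t \<ge> 0 \<Longrightarrow> t \<notin> E \<Longrightarrow> p \<in> idx \<Longrightarrow> ((\<lambda>t. X t p) has_real_derivative field t (clip R (X t)) p) (at t within {0..})"
  proof (rule picard_lindeloef_global[of idx "sum L idx" "\<lambda>t x. field t (clip R x)" X0 "sum B idx" E])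
    show "0 \<le> sum L idx" using BL(2) by (simp add: sum_nonneg)
    show "\<bar>field t (clip R x) p - field t (clip R y) p\<bar> \<le> sum L idx * (\<Sum>p\<in>idx. \<bar>x p - y p\<bar>)"
      if "t \<ge> 0" "p \<in> idx" for t x y p
      using that BL(2) by (intro order_trans[OF BL(4)] mult_right_mono member_le_sum sum_nonneg) auto
    show "\<bar>field t (clip R X0) p\<bar> \<le> sum B idx" if "t \<ge> 0" "p \<in> idx" for t p
      using that BL(1) by (intro order_trans[OF BL(3)] member_le_sum) auto
    show "continuous (at t within {0..}) (\<lambda>t. field t (clip R (X t)) p)"
      if "\<And>q. q \<in> idx \<Longrightarrow> continuous_on {0..} (\<lambda>t. X t q)" "t \<ge> 0" "t \<notin> E" for X p t
      using nice_continuous[OF nice that(2,3,1)] .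
  qed (use E in auto)
  have dep: "field t (clip R x) p = field t x p" if "\<And>q. q \<in> idx \<Longrightarrow> \<bar>x q\<bar> \<le> R" "p \<in> idx" for t x p
  proof -
    have c: "clip R x q = x q" if "q \<in> idx" for q using \<open>\<And>q. q \<in> idx \<Longrightarrow> \<bar>x q\<bar> \<le> R\<close>[OF that] that by (auto simp: clip_def)
    have o: "outp (clip R x) = outp x" unfolding outp_def by (intro sum.cong) (auto simp: c)
    have e: "err (clip R x) = err x" unfolding err_def o using n by (simp add: c)
    have w: "omega t (clip R x) i = omega t x i" if "i < 2 * n" for i unfolding omega_def o using that by (auto simp: c)
    have u: "ctrl t (clip R x) = ctrl t x" unfolding ctrl_def by (intro sum.cong) (auto simp: c w)
    from that(2) show ?thesis
      unfolding idx_def by (auto simp: field_component o e w u c)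
  qed
  have bound: "\<bar>X t p\<bar> \<le> R" if "t \<ge> 0" "p \<in> idx" for t p
  proof (rule ccontr)
    assume *: "\<not> \<bar>X t p\<bar> \<le> R"
    \<comment> \<open>All times up to \<open>t\<close> at which some component reaches the level;
      the set is compact, so it has a first element.\<close>
    define C where "C = (\<Union>q\<in>idx. {s \<in> {0..t}. R \<le> \<bar>X s q\<bar>})"
    have "closed {s \<in> {0..t}. R \<le> \<bar>X s q\<bar>}" if "q \<in> idx" for q
      by (rule continuous_on_closed_Collect_le) (auto intro!: continuous_intros continuous_on_subset[OF X(2)[OF that]])
    then have "closed C" unfolding C_def by (intro closed_UN) auto
    moreover have "bounded C" by (rule bounded_subset[of "{0..t}"]) (auto simp: C_def)
    ultimately have "compact C" by (simp add: compact_eq_bounded_closed)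
    moreover have "t \<in> C" using * that by (auto simp: C_def intro!: bexI[of _ p])
    ultimately obtain s where s: "s \<in> C" "\<And>s'. s' \<in> C \<Longrightarrow> s \<le> s'" using compact_attains_inf[of C] by blast
    then obtain q where q: "q \<in> idx" "R \<le> \<bar>X s q\<bar>" "0 \<le> s" "s \<le> t" by (auto simp: C_def)
    have small: "\<bar>X u q\<bar> \<le> R" if "q \<in> idx" "0 \<le> u" "u < s" for u q
      using s(2)[of u] that q(4) by (force simp: C_def)
    \<comment> \<open>Before the time \<open>s\<close> the truncation is inactive, and continuity
      takes care of the end point, where the a priori bound is then applied.\<close>
    have "traj s X"
      unfolding traj_def
    proof (intro conjI exI[of _ "E \<inter> {0..s}"] ballI)
      fix u p assume u: "u \<in> {0<..<s} - E \<inter> {0..s}" and p: "p \<in> idx"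
      have "((\<lambda>t. X t p) has_real_derivative field u (clip R (X u)) p) (at u within {0..})"
        using X(3)[of u p] u p by auto
      moreover have "at u within {0..} = at u" using u by (intro at_within_interior) auto
      ultimately show "((\<lambda>t. X t p) has_real_derivative field u (X u) p) (at u)"
        using dep[of "X u" p u] small u p by auto
    next
      fix p assume p: "p \<in> idx"
      show "continuous_on {0..s} (\<lambda>t. X t p)" by (rule continuous_on_subset[OF X(2)[OF p]]) auto
    qed (use q X(1) E in auto)
    from R0[rule_format, OF this, of s q] q R(2) show False by simp
  qed
  show thesis
  proof (rule that[OF X(1,2)])
    fix t p assume t: "t \<ge> 0" "t \<notin> E" and p: "p \<in> idx"
    show "((\<lambda>t. X t p) has_real_derivative field t (X t) p) (at t within {0..})"
      using X(3)[OF t p] dep[of "X t" p t] bound[OF t(1)] p by simp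
  qed
qed

theorem err_tendsto_0:
  assumes X: "\<And>T. T \<ge> 0 \<Longrightarrow> traj T X"
  shows "((\<lambda>t. err (X t)) \<longlongrightarrow> 0) at_top"
proof -
  obtain L where L: "\<forall>T X s t. traj T X \<longrightarrow> 0 \<le> s \<longrightarrow> s \<le> t \<longrightarrow> t \<le> T \<longrightarrow> \<bar>err (X t) - err (X s)\<bar> \<le> L * (t - s)"
    using err_lipschitz by (rule exE)
  show ?thesis
  proof (rule lipschitz_square_integrable_tendsto_0)
    show "continuous_on {0..} (\<lambda>t. err (X t))"
      by (rule continuous_on_atLeastI) (rule lin_traj(1)[OF lin_err X])
    show "\<bar>err (X t) - err (X s)\<bar> \<le> L * (t - s)" if "0 \<le> s" "s \<le> t" for s t
      using L[rule_format, OF X[of t] that order_refl] that by simp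
    show "integral {0..T} (\<lambda>t. (err (X t))\<^sup>2) \<le> V X0 / \<kappa>" if "0 \<le> T" for T
      using err_square_integral[OF X[OF that]] .
  qed
qed

end


section \<open>Global stability\<close>

lemma regressor_index:
  assumes w1: "w1 \<in> carrier_vec (n - 1)" and w2: "w2 \<in> carrier_vec (n - 1)" and n: "n > 0" and i: "i < 2 * n"
  shows "regressor a w1 y w2 $ i = (if i = 0 then a else if i < n then w1 $ (i - 1) else if i = n then y else w2 $ (i - n - 1))"
  using assms by (auto simp: regressor_def append_vec_def Let_def)

lemma regressor_carrier:
  assumes "w1 \<in> carrier_vec (n - 1)" "w2 \<in> carrier_vec (n - 1)" "n > 0"
  shows "regressor a w1 y w2 \<in> carrier_vec (2 * n)"
  using assms unfolding carrier_vec_def by (simp add: regressor_def)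

lemma mult_mat_vec_index_sum:
  assumes "A \<in> carrier_mat k k" "v \<in> carrier_vec k" "i < k"
  shows "(A *\<^sub>v v) $ i = (\<Sum>j<k. A $$ (i, j) * v $ j)"
  using assms by (auto simp: scalar_prod_def lessThan_atLeast0)

lemma solves_derivative:
  assumes "solves r k x x0 f" "t \<ge> 0" "continuous (at t within {0..}) r" "i < k"
  shows "((\<lambda>t. x t $ i) has_real_derivative f t $ i) (at t within {0..})"
  using assms by (simp add: solves_def)

context adaptive_loop begin

text \<open>Link between the vector signals of the statement and states as functions on
  \<open>idx\<close>.\<close>

definition represents ::
  "real vec \<Rightarrow> real vec \<Rightarrow> real vec \<Rightarrow> real vec \<Rightarrow> real vec \<Rightarrow> state \<Rightarrow> bool" where
  "represents vp vm v1 v2 vt x \<longleftrightarrow>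
     vp = vec n (\<lambda>i. x (0, i)) \<and> vm = vec n (\<lambda>i. x (1, i)) \<and> v1 = vec (n - 1) (\<lambda>i. x (2, i)) \<and>
     v2 = vec (n - 1) (\<lambda>i. x (3, i)) \<and> vt = vec (2 * n) (\<lambda>i. x (4, i))"

definition E where "E = {t. \<not> continuous (at t within {0..}) r}"

context
  fixes bpv cpv blv bmv lmv :: "real vec"
  assumes Ap: "Ap \<in> carrier_mat n n"
    and bpv: "bpv \<in> carrier_vec n" "\<And>i. i < n \<Longrightarrow> bp i = bpv $ i" and cpv: "cpv \<in> carrier_vec n" "\<And>i. i < n \<Longrightarrow> c i = kp * cpv $ i"
    and blv: "blv \<in> carrier_vec (n - 1)" "\<And>i. i < n - 1 \<Longrightarrow> bl i = blv $ i"
    and bmv: "bmv \<in> carrier_vec n" "\<And>i. i < n \<Longrightarrow> bm i = bmv $ i" and lmv: "lmv \<in> carrier_vec n" "\<And>i. i < n \<Longrightarrow> lm i = lmv $ i"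
begin

lemma represents_signals:
  assumes "represents vp vm v1 v2 vt x"
  shows "kp * (cpv \<bullet> vp) = outp x" "unit_vec n (n - 1) \<bullet> vm = x (1, n - 1)"
    "regressor (r t) v1 (outp x) v2 = vec (2 * n) (omega t x)"
    "vt \<bullet> vec (2 * n) (omega t x) = ctrl t x"
proof -
  show "kp * (cpv \<bullet> vp) = outp x"
    using assms cpv by (simp add: represents_def outp_def scalar_prod_def lessThan_atLeast0 sum_distrib_left mult.assoc)
  have "unit_vec n (n - 1) \<bullet> vm = vm $ (n - 1)"
    using assms n by (intro scalar_prod_left_unit) (auto simp: represents_def)
  then show "unit_vec n (n - 1) \<bullet> vm = x (1, n - 1)" using assms n by (simp add: represents_def)
  have v: "v1 \<in> carrier_vec (n - 1)" "v2 \<in> carrier_vec (n - 1)" using assms by (auto simp: represents_def)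
  show "regressor (r t) v1 (outp x) v2 = vec (2 * n) (omega t x)"
  proof (rule eq_vecI)
    fix i assume "i < dim_vec (vec (2 * n) (omega t x))"
    then have i: "i < 2 * n" by simp
    show "regressor (r t) v1 (outp x) v2 $ i = vec (2 * n) (omega t x) $ i"
      unfolding regressor_index[OF v n i] using assms i by (auto simp: represents_def omega_def)
  qed (use regressor_carrier[OF v n] in auto)
  show "vt \<bullet> vec (2 * n) (omega t x) = ctrl t x"
    using assms by (simp add: represents_def ctrl_def scalar_prod_def lessThan_atLeast0)
qed

lemma represents_field:
  assumes "represents vp vm v1 v2 vt x"
  shows "i < n \<Longrightarrow> (Ap *\<^sub>v vp + ctrl t x \<cdot>\<^sub>v bpv) $ i = field t x (0, i)"
    "i < n \<Longrightarrow> (companion n Pm *\<^sub>v vm + (km * r t) \<cdot>\<^sub>v bmv + err x \<cdot>\<^sub>v lmv) $ i = field t x (1, i)"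
    "i < n - 1 \<Longrightarrow> (\<Lambda> *\<^sub>v v1 + ctrl t x \<cdot>\<^sub>v blv) $ i = field t x (2, i)"
    "i < n - 1 \<Longrightarrow> (\<Lambda> *\<^sub>v v2 + outp x \<cdot>\<^sub>v blv) $ i = field t x (3, i)"
    "i < 2 * n \<Longrightarrow> ((- \<gamma> * sgn kp * err x) \<cdot>\<^sub>v vec (2 * n) (omega t x)) $ i = field t x (4, i)"
proof -
  have v: "vp \<in> carrier_vec n" "vm \<in> carrier_vec n" "v1 \<in> carrier_vec (n - 1)" "v2 \<in> carrier_vec (n - 1)"
    using assms by (auto simp: represents_def)
  have i: "i < n \<Longrightarrow> vp $ i = x (0, i)" "i < n \<Longrightarrow> vm $ i = x (1, i)" "i < n - 1 \<Longrightarrow> v1 $ i = x (2, i)" "i < n - 1 \<Longrightarrow> v2 $ i = x (3, i)" for i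
    using assms by (auto simp: represents_def)
  show "i < n \<Longrightarrow> (Ap *\<^sub>v vp + ctrl t x \<cdot>\<^sub>v bpv) $ i = field t x (0, i)"
    using bpv Ap v(1) mult_mat_vec_index_sum[OF Ap v(1), of i] i(1) by (simp add: field_component)
  show "i < n \<Longrightarrow> (companion n Pm *\<^sub>v vm + (km * r t) \<cdot>\<^sub>v bmv + err x \<cdot>\<^sub>v lmv) $ i = field t x (1, i)"
    using bmv lmv v(2) mult_mat_vec_index_sum[OF companion_carrier v(2), of i] i(2) by (simp add: field_component)
  show "i < n - 1 \<Longrightarrow> (\<Lambda> *\<^sub>v v1 + ctrl t x \<cdot>\<^sub>v blv) $ i = field t x (2, i)"
    using blv carrier v(3) mult_mat_vec_index_sum[OF carrier v(3), of i] i(3) by (simp add: field_component)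
  show "i < n - 1 \<Longrightarrow> (\<Lambda> *\<^sub>v v2 + outp x \<cdot>\<^sub>v blv) $ i = field t x (3, i)"
    using blv carrier v(4) mult_mat_vec_index_sum[OF carrier v(4), of i] i(4) by (simp add: field_component)
  show "i < 2 * n \<Longrightarrow> ((- \<gamma> * sgn kp * err x) \<cdot>\<^sub>v vec (2 * n) (omega t x)) $ i = field t x (4, i)"
    by (simp add: field_component)
qed

context
  fixes xp0 xm0 w10 w20 \<theta>0 :: "real vec"
  assumes init: "represents xp0 xm0 w10 w20 \<theta>0 X0"
    and pc: "piecewise_continuous r"
begin

abbreviation "system \<equiv> adaptive_system n Ap bpv cpv kp n (companion n Pm) bmv (unit_vec n (n - 1)) km lmv \<Lambda> blv \<gamma> r xp0 xm0 w10 w20 \<theta>0"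

lemma E_finite: "finite (E \<inter> {0..T})"
proof -
  have "E \<inter> {0..T} = {t \<in> {0..T}. \<not> continuous (at t within {0..}) r}" by (auto simp: E_def)
  then show ?thesis using pc by (simp add: piecewise_continuous_def)
qed

lemma system_exists: "\<exists>xp xm w1 w2 \<theta> \<omega> u y ym ey. system xp xm w1 w2 \<theta> \<omega> u y ym ey"
proof (rule global_solution[OF E_finite])
  show "continuous (at t within {0..}) r" if "t \<notin> E" for t using that by (simp add: E_def)
next
  fix X assume X: "\<And>p. p \<in> idx \<Longrightarrow> X 0 p = X0 p" "\<And>p. p \<in> idx \<Longrightarrow> continuous_on {0..} (\<lambda>t. X t p)"
    "\<And>t p. t \<ge> 0 \<Longrightarrow> t \<notin> E \<Longrightarrow> p \<in> idx \<Longrightarrow> ((\<lambda>t. X t p) has_real_derivative field t (X t) p) (at t within {0..})"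
  define xp where "xp t = vec n (\<lambda>i. X t (0, i))" for t
  define xm where "xm t = vec n (\<lambda>i. X t (1, i))" for t
  define w1 where "w1 t = vec (n - 1) (\<lambda>i. X t (2, i))" for t
  define w2 where "w2 t = vec (n - 1) (\<lambda>i. X t (3, i))" for t
  define \<theta> where "\<theta> t = vec (2 * n) (\<lambda>i. X t (4, i))" for t
  have rep: "represents (xp t) (xm t) (w1 t) (w2 t) (\<theta> t) (X t)" for t
    by (simp add: represents_def xp_def xm_def w1_def w2_def \<theta>_def)
  note sig = represents_signals[OF rep]
  have fld: "((\<lambda>t. X t p) has_real_derivative field t (X t) p) (at t within {0..})"
    if "t \<ge> 0" "continuous (at t within {0..}) r" "p \<in> idx" for t p
    using X(3) that by (simp add: E_def)
  have sol: "solves r k (\<lambda>t. vec k (\<lambda>i. X t (b, i))) v0 f"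
    if v0: "v0 = vec k (\<lambda>i. X0 (b, i))" and b: "\<And>i. i < k \<Longrightarrow> (b, i) \<in> idx"
      and f: "\<And>t i. i < k \<Longrightarrow> f t $ i = field t (X t) (b, i)" for k b v0 f
    unfolding solves_def using X(1,2) fld b f by (auto simp: v0 intro!: eq_vecI)
  have "system xp xm w1 w2 \<theta> (\<lambda>t. vec (2 * n) (omega t (X t))) (\<lambda>t. ctrl t (X t)) (\<lambda>t. outp (X t))
      (\<lambda>t. X t (1, n - 1)) (\<lambda>t. err (X t))"
    unfolding adaptive_system_def
  proof (intro conjI allI impI)
    show "solves r n xp xp0 (\<lambda>t. Ap *\<^sub>v xp t + ctrl t (X t) \<cdot>\<^sub>v bpv)"
      unfolding xp_def[abs_def] by (rule sol[OF _ _ represents_field(1)[OF rep, unfolded xp_def]]) (use init in \<open>auto simp: represents_def\<close>)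
    show "solves r n xm xm0 (\<lambda>t. companion n Pm *\<^sub>v xm t + (km * r t) \<cdot>\<^sub>v bmv + err (X t) \<cdot>\<^sub>v lmv)"
      unfolding xm_def[abs_def] by (rule sol[OF _ _ represents_field(2)[OF rep, unfolded xm_def]]) (use init in \<open>auto simp: represents_def\<close>)
    show "solves r (n - 1) w1 w10 (\<lambda>t. \<Lambda> *\<^sub>v w1 t + ctrl t (X t) \<cdot>\<^sub>v blv)"
      unfolding w1_def[abs_def] by (rule sol[OF _ _ represents_field(3)[OF rep, unfolded w1_def]]) (use init in \<open>auto simp: represents_def\<close>)
    show "solves r (n - 1) w2 w20 (\<lambda>t. \<Lambda> *\<^sub>v w2 t + outp (X t) \<cdot>\<^sub>v blv)"
      unfolding w2_def[abs_def] by (rule sol[OF _ _ represents_field(4)[OF rep, unfolded w2_def]]) (use init in \<open>auto simp: represents_def\<close>)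
    show "solves r (2 * n) \<theta> \<theta>0 (\<lambda>t. (- \<gamma> * sgn kp * err (X t)) \<cdot>\<^sub>v vec (2 * n) (omega t (X t)))"
      unfolding \<theta>_def[abs_def] by (rule sol[OF _ _ represents_field(5)[OF rep]]) (use init in \<open>auto simp: represents_def\<close>)
  qed (use sig in \<open>simp_all add: err_def\<close>)
  then show ?thesis by blast
qed

text \<open>Any solution on the half line, and not only the one constructed, restricts to a
  \<open>traj\<close> on every finite horizon, so the bounds uniform in the horizon apply to it for
  all times.\<close>

lemma system_bounded:
  assumes sys: "system xp xm w1 w2 \<theta> \<omega> u y ym ey"
  shows "bounded_vec_signal xp \<and> bounded_vec_signal xm \<and> bounded_vec_signal w1 \<and> bounded_vec_signal w2 \<and>
    bounded_vec_signal \<theta> \<and> bounded_vec_signal \<omega> \<and>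
    bounded_signal u \<and> bounded_signal y \<and> bounded_signal ym \<and> bounded_signal ey \<and> (ey \<longlongrightarrow> 0) at_top"
proof -
  define X where "X t p = (case p of (k, i) \<Rightarrow> (if k = 0 then xp t $ i else if k = (1::nat) then xm t $ i
    else if k = 2 then w1 t $ i else if k = 3 then w2 t $ i else \<theta> t $ i))" for t :: real and p :: "nat \<times> nat"
  note sysD = sys[unfolded adaptive_system_def]
  have solp: "solves r n xp xp0 (\<lambda>t. Ap *\<^sub>v xp t + u t \<cdot>\<^sub>v bpv)"
    and solm: "solves r n xm xm0 (\<lambda>t. companion n Pm *\<^sub>v xm t + (km * r t) \<cdot>\<^sub>v bmv + ey t \<cdot>\<^sub>v lmv)"
    and sol1: "solves r (n - 1) w1 w10 (\<lambda>t. \<Lambda> *\<^sub>v w1 t + u t \<cdot>\<^sub>v blv)"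
    and sol2: "solves r (n - 1) w2 w20 (\<lambda>t. \<Lambda> *\<^sub>v w2 t + y t \<cdot>\<^sub>v blv)"
    and solt: "solves r (2 * n) \<theta> \<theta>0 (\<lambda>t. (- \<gamma> * sgn kp * ey t) \<cdot>\<^sub>v \<omega> t)"
    using sysD by blast+
  have car: "xp t \<in> carrier_vec n" "xm t \<in> carrier_vec n" "w1 t \<in> carrier_vec (n - 1)" "w2 t \<in> carrier_vec (n - 1)"
    "\<theta> t \<in> carrier_vec (2 * n)" if "t \<ge> 0" for t
    using solp solm sol1 sol2 solt that by (simp_all add: solves_def)
  have rep: "represents (xp t) (xm t) (w1 t) (w2 t) (\<theta> t) (X t)" if "t \<ge> 0" for t
    using car[OF that] by (auto simp: represents_def X_def intro!: eq_vecI)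
  have y: "y t = outp (X t)" if "t \<ge> 0" for t
    using sysD that represents_signals(1)[OF rep[OF that]] by simp
  have ym: "ym t = X t (1, n - 1)" if "t \<ge> 0" for t
    using sysD that represents_signals(2)[OF rep[OF that]] by simp
  have ey: "ey t = err (X t)" if "t \<ge> 0" for t
    using sysD that y[OF that] ym[OF that] by (simp add: err_def)
  have \<omega>: "\<omega> t = vec (2 * n) (omega t (X t))" if "t \<ge> 0" for t
    using sysD that y[OF that] represents_signals(3)[OF rep[OF that]] by simp
  have u: "u t = ctrl t (X t)" if "t \<ge> 0" for t
    using sysD that \<omega>[OF that] represents_signals(4)[OF rep[OF that]] by simp
  have X0: "X 0 p = X0 p" if "p \<in> idx" for p
  proof -
    have "xp 0 = xp0" "xm 0 = xm0" "w1 0 = w10" "w2 0 = w20" "\<theta> 0 = \<theta>0"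
      using solp solm sol1 sol2 solt by (simp_all add: solves_def)
    then show ?thesis using that init by (auto simp: idx_def X_def represents_def)
  qed
  have Xc: "continuous_on {0..} (\<lambda>t. X t p)" if "p \<in> idx" for p
    using that solp solm sol1 sol2 solt by (auto simp: idx_def X_def solves_def)
  have Xd: "((\<lambda>t. X t p) has_real_derivative field t (X t) p) (at t within {0..})"
    if t: "t \<ge> 0" "t \<notin> E" and p: "p \<in> idx" for t p
  proof -
    have rc: "continuous (at t within {0..}) r" using t by (simp add: E_def)
    note f = represents_field[OF rep[OF t(1)], where t = t, folded u[OF t(1)] y[OF t(1)] ey[OF t(1)] \<omega>[OF t(1)]]
    have d0: "((\<lambda>t. xp t $ i) has_real_derivative field t (X t) (0, i)) (at t within {0..})" if "i < n" for i
      using solves_derivative[OF solp t(1) rc that] unfolding f(1)[OF that] .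
    have d1: "((\<lambda>t. xm t $ i) has_real_derivative field t (X t) (1, i)) (at t within {0..})" if "i < n" for i
      using solves_derivative[OF solm t(1) rc that] unfolding f(2)[OF that] .
    have d2: "((\<lambda>t. w1 t $ i) has_real_derivative field t (X t) (2, i)) (at t within {0..})" if "i < n - 1" for i
      using solves_derivative[OF sol1 t(1) rc that] unfolding f(3)[OF that] .
    have d3: "((\<lambda>t. w2 t $ i) has_real_derivative field t (X t) (3, i)) (at t within {0..})" if "i < n - 1" for i
      using solves_derivative[OF sol2 t(1) rc that] unfolding f(4)[OF that] .
    have d4: "((\<lambda>t. \<theta> t $ i) has_real_derivative field t (X t) (4, i)) (at t within {0..})" if "i < 2 * n" for i
      using solves_derivative[OF solt t(1) rc that] unfolding f(5)[OF that] .
    have X_simps: "X t (0, i) = xp t $ i" "X t (1, i) = xm t $ i" "X t (2, i) = w1 t $ i" "X t (3, i) = w2 t $ i"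
      "X t (4, i) = \<theta> t $ i" for t i by (simp_all add: X_def)
    from p consider i where "p = (0, i)" "i < n" | i where "p = (1, i)" "i < n" | i where "p = (2, i)" "i < n - 1"
      | i where "p = (3, i)" "i < n - 1" | i where "p = (4, i)" "i < 2 * n"
      by (auto simp: idx_def)
    then show ?thesis by cases (simp_all only: X_simps d0 d1 d2 d3 d4)
  qed
  have tr: "traj T X" if "T \<ge> 0" for T
    unfolding traj_def
  proof (intro conjI ballI exI[of _ "E \<inter> {0..T}"])
    fix t p assume t: "t \<in> {0<..<T} - E \<inter> {0..T}" and p: "p \<in> idx"
    have "at t within {0..} = at t" using t by (intro at_within_interior) auto
    then show "((\<lambda>t. X t p) has_real_derivative field t (X t) p) (at t)" using Xd[of t p] t p by auto
  next
    fix p assume p: "p \<in> idx"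
    show "continuous_on {0..T} (\<lambda>t. X t p)" by (rule continuous_on_subset[OF Xc[OF p]]) auto
  qed (use that X0 E_finite in auto)
  have bs: "bounded_signal f" if f: "\<And>t. t \<ge> 0 \<Longrightarrow> f t = g t (X t)" and g: "ubdd g" for f g
  proof -
    obtain B where B: "\<forall>T X. traj T X \<longrightarrow> (\<forall>t\<in>{0..T}. \<bar>g t (X t)\<bar> \<le> B)"
      using g unfolding ubdd_def by (rule exE)
    have "\<bar>f t\<bar> \<le> B" if "t \<ge> 0" for t
      using B[rule_format, OF tr[OF that], of t] that by (simp add: f)
    then show ?thesis unfolding bounded_signal_def by blast
  qed
  have bv: "bounded_vec_signal f"
    if f: "\<And>t. t \<ge> 0 \<Longrightarrow> dim_vec (f t) = k" "\<And>t i. t \<ge> 0 \<Longrightarrow> i < k \<Longrightarrow> f t $ i = g i t (X t)"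
      and g: "\<And>i. i < k \<Longrightarrow> ubdd (g i)" for f g k
  proof -
    have "\<exists>B. \<forall>t\<ge>0. \<bar>f t $ i\<bar> \<le> B" if "i < k" for i
      using bs[of "\<lambda>t. f t $ i", OF f(2) g] that by (simp add: bounded_signal_def)
    then obtain B where B: "\<And>i t. i < k \<Longrightarrow> t \<ge> 0 \<Longrightarrow> \<bar>f t $ i\<bar> \<le> B i" by metis
    show ?thesis unfolding bounded_vec_signal_def
    proof (intro exI[of _ "\<Sum>i<k. \<bar>B i\<bar>"] allI impI)
      fix t i assume t: "0 \<le> (t::real)" and "i < dim_vec (f t)"
      then have i: "i < k" using f(1) by simp
      have "\<bar>f t $ i\<bar> \<le> \<bar>B i\<bar>" using B[OF i t] by simp
      also have "\<dots> \<le> (\<Sum>i<k. \<bar>B i\<bar>)" using i by (intro member_le_sum) auto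
      finally show "\<bar>f t $ i\<bar> \<le> (\<Sum>i<k. \<bar>B i\<bar>)" .
    qed
  qed
  show ?thesis
  proof (intro conjI)
    show "bounded_vec_signal xp" by (rule bv[of _ n "\<lambda>i _ x. x (0, i)"]) (use car ubdd_plant in \<open>auto simp: X_def\<close>)
    show "bounded_vec_signal xm" by (rule bv[of _ n "\<lambda>i _ x. x (1, i)"]) (use car ubdd_model in \<open>auto simp: X_def\<close>)
    show "bounded_vec_signal w1" by (rule bv[of _ "n - 1" "\<lambda>i _ x. x (2, i)"]) (use car ubdd_filter1 in \<open>auto simp: X_def\<close>)
    show "bounded_vec_signal w2" by (rule bv[of _ "n - 1" "\<lambda>i _ x. x (3, i)"]) (use car ubdd_filter2 in \<open>auto simp: X_def\<close>)
    show "bounded_vec_signal \<theta>" by (rule bv[of _ "2 * n" "\<lambda>i _ x. x (4, i)"]) (use car ubdd_gain in \<open>auto simp: X_def\<close>)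
    show "bounded_vec_signal \<omega>" by (rule bv[of _ "2 * n" "\<lambda>i t x. omega t x i"]) (use \<omega> ubdd_omega in auto)
    show "bounded_signal u" by (rule bs[OF u ubdd_ctrl])
    show "bounded_signal y" by (rule bs[OF y ubdd_outp])
    show "bounded_signal ym" using n by (intro bs[OF ym ubdd_model]) auto
    show "bounded_signal ey" by (rule bs[OF ey ubdd_err])
    have "((\<lambda>t. err (X t)) \<longlongrightarrow> 0) at_top" by (rule err_tendsto_0[OF tr])
    moreover have "eventually (\<lambda>t. err (X t) = ey t) at_top"
      using eventually_ge_at_top[of 0] by eventually_elim (simp add: ey)
    ultimately show "(ey \<longlongrightarrow> 0) at_top" by (rule Lim_transform_eventually)
  qed
qed

end

end

end

text \<open>By the Bezout identity \<open>Z\<close> and \<open>P\<close> have no common complex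
  root, so every root of \<open>Z\<close> is an uncancelled zero of the transfer function.\<close>

lemma coprime_minimum_phase_roots:
  fixes Z P :: "real poly"
  assumes cop: "coprime Z P" and mp: "minimum_phase (Polynomial.smult k Z) P" and k: "k \<noteq> 0" and Z: "Z \<noteq> 0"
    and s: "poly (cpoly Z) s = 0"
  shows "Re s < 0"
proof -
  obtain u v where "u * Z + v * P = 1"
    using bezout_coefficients_fst_snd[of Z P] cop by (metis coprime_iff_gcd_eq_1)
  then have "poly (cpoly (u * Z + v * P)) s = poly (cpoly 1) s" by simp
  then have "poly (cpoly P) s \<noteq> 0" using s by auto
  then have "Polynomial.order s (cpoly P) = 0" by (rule order_0I)
  moreover have "cpoly (Polynomial.smult k Z) \<noteq> 0" using k Z by simp
  then have "Polynomial.order s (cpoly (Polynomial.smult k Z)) \<noteq> 0"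
    using s order_root[of "cpoly (Polynomial.smult k Z)" s] by simp
  ultimately have "rat_zero (Polynomial.smult k Z) P s" by (simp add: rat_zero_def)
  then show ?thesis using mp by (simp add: minimum_phase_def)
qed

lemma hurwitz_char_poly_roots:
  assumes A: "A \<in> carrier_mat k k" and hur: "hurwitz A" and s: "poly (cpoly (char_poly A)) s = 0"
  shows "Re s < 0"
proof -
  have A': "map_mat complex_of_real A \<in> carrier_mat k k" using A by simp
  have "eigenvalue (map_mat complex_of_real A) s"
    using s unfolding eigenvalue_root_char_poly[OF A'] of_real_hom.char_poly_hom[OF A] .
  then show ?thesis using hur by (simp add: hurwitz_def)
qed

text \<open>The resolvent of a companion matrix consists of monomials, so the numerator has the
  entries of the input vector as its coefficients.\<close>

lemma companion_transfer_coeff: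
  assumes n: "n > 0" and p: "degree p = n" "lead_coeff p = 1" and b: "b \<in> carrier_vec n"
    and tf: "has_transfer_function (companion n p) b (unit_vec n (n - 1)) N p"
  shows "coeff N j = (if j < n then b $ j else 0)"
proof -
  have "p \<noteq> 0" using p by auto
  then have "(\<Sum>r<n. Polynomial.smult (b $ r) (monom 1 r)) * p = p * N"
    by (intro transfer_function_resolvent[OF companion_carrier b _ companion_resolvent[OF n p] tf]) auto
  then have "N = (\<Sum>r<n. Polynomial.smult (b $ r) (monom 1 r))" using \<open>p \<noteq> 0\<close> by simp
  then show ?thesis by (simp add: coeff_sum if_distrib[of "(*) _"] cong: if_cong)
qed

theorem theorem3:
  fixes n m :: nat
    and Z P Zm Pm Zl :: "real poly"
    and Ap Am \<Lambda> :: "real mat"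
    and bp cp bm cm lm bl :: "real vec"
    and kp km kl \<gamma> :: real
    and r :: "real \<Rightarrow> real"
  assumes plant_poly: "lead_coeff Z = 1" "lead_coeff P = 1" "coprime Z P"
    and plant_degree: "degree P = n" "degree P = degree Z + 1"
    and plant_gain: "kp \<noteq> 0"
    and plant_minimum_phase: "minimum_phase (Polynomial.smult kp Z) P"
    and plant_carrier: "Ap \<in> carrier_mat n n" "bp \<in> carrier_vec n" "cp \<in> carrier_vec n"
    and plant_transfer: "has_transfer_function Ap bp (kp \<cdot>\<^sub>v cp) (Polynomial.smult kp Z) P"
    and model_poly: "lead_coeff Zm = 1" "lead_coeff Pm = 1"
    and model_degree: "degree Pm = m" "degree Pm = degree Zm + 1"
    and model_gain: "km \<noteq> 0"
    and model_form: "observer_canonical m Am cm" "char_poly Am = Pm"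
    and model_carrier: "bm \<in> carrier_vec m" "lm \<in> carrier_vec m"
    and model_transfer: "has_transfer_function Am (km \<cdot>\<^sub>v bm) cm (Polynomial.smult km Zm) Pm"
    and model_minimum_phase: "minimum_phase Zm Pm"
    and model_stable: "hurwitz Am"
    and feedback_transfer: "has_transfer_function Am lm cm (Polynomial.smult kl Zl) Pm"
    and feedback_spr: "strictly_positive_real Zm (Pm + Polynomial.smult kl Zl)"
    and filter_carrier: "\<Lambda> \<in> carrier_mat (n - 1) (n - 1)" "bl \<in> carrier_vec (n - 1)"
    and filter_stable: "hurwitz \<Lambda>"
    and filter_controllable: "controllable \<Lambda> bl"
    and filter_poly: "char_poly \<Lambda> = Zm"
    and adaptation_gain: "\<gamma> > 0"
    and reference: "bounded_signal r" "piecewise_continuous r"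
  shows "\<forall>xp0 \<in> carrier_vec n. \<forall>xm0 \<in> carrier_vec m. \<forall>w10 \<in> carrier_vec (n - 1).
         \<forall>w20 \<in> carrier_vec (n - 1). \<forall>\<theta>0 \<in> carrier_vec (2 * n).
           (\<exists>xp xm w1 w2 \<theta> \<omega> u y ym ey.
              adaptive_system n Ap bp cp kp m Am bm cm km lm \<Lambda> bl \<gamma> r xp0 xm0 w10 w20 \<theta>0
                xp xm w1 w2 \<theta> \<omega> u y ym ey) \<and>
           (\<forall>xp xm w1 w2 \<theta> \<omega> u y ym ey.
              adaptive_system n Ap bp cp kp m Am bm cm km lm \<Lambda> bl \<gamma> r xp0 xm0 w10 w20 \<theta>0
                xp xm w1 w2 \<theta> \<omega> u y ym ey \<longrightarrow>
              bounded_vec_signal xp \<and> bounded_vec_signal xm \<and>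
              bounded_vec_signal w1 \<and> bounded_vec_signal w2 \<and>
              bounded_vec_signal \<theta> \<and> bounded_vec_signal \<omega> \<and>
              bounded_signal u \<and> bounded_signal y \<and> bounded_signal ym \<and> bounded_signal ey \<and>
              (ey \<longlongrightarrow> 0) at_top)"
proof (intro ballI)
  fix xp0 xm0 w10 w20 \<theta>0 :: "real vec"
  assume init: "xp0 \<in> carrier_vec n" "xm0 \<in> carrier_vec m" "w10 \<in> carrier_vec (n - 1)" "w20 \<in> carrier_vec (n - 1)"
    "\<theta>0 \<in> carrier_vec (2 * n)"
  have n: "n > 0" using plant_degree by simp
  \<comment> \<open>The filter polynomial is the model numerator, which fixes its degree to
    \<open>n - 1\<close> and thereby the order of the model to \<open>n\<close>.\<close>
  have degZm: "degree Zm = n - 1" using degree_monic_char_poly[OF filter_carrier(1)] filter_poly by simp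
  have m: "m = n" using model_degree degZm n by simp
  have degPm: "degree Pm = n" using model_degree m by simp
  have degZ: "degree Z = n - 1" using plant_degree by simp
  have nz: "P \<noteq> 0" "Pm \<noteq> 0" "Z \<noteq> 0" using plant_poly model_poly by auto
  have cpv: "kp \<cdot>\<^sub>v cp \<in> carrier_vec n" using plant_carrier(3) by simp

  have "char_poly Ap = P"
    by (rule coprime_transfer_char_poly[OF plant_carrier(1,2) cpv plant_poly(3) plant_degree(1) plant_poly(2)
      plant_transfer plant_gain])
  then obtain M where M: "row_resolvent n Ap (\<lambda>r. (kp \<cdot>\<^sub>v cp) $ r) P M"
    using char_poly_resolvent[OF plant_carrier(1)] by metis
  have "(\<Sum>r<n. Polynomial.smult (bp $ r) (M r)) * P = P * Polynomial.smult kp Z"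
    by (rule transfer_function_resolvent[OF plant_carrier(1,2) cpv M plant_transfer nz(1)])
  then have Mb: "(\<Sum>r<n. Polynomial.smult (bp $ r) (M r)) = Polynomial.smult kp Z"
    using nz(1) by (metis mult.commute mult_right_cancel)
  have Mdet: "det (mat n n (\<lambda>(j, i). coeff (M i) j)) \<noteq> 0"
    by (rule resolvent_observable[OF plant_carrier(1,2) cpv plant_poly(3) plant_degree(1) plant_poly(2) M
      plant_transfer plant_gain])

  have Am: "Am = companion n Pm" and cm: "cm = unit_vec n (n - 1)"
    using observer_canonical_eq_companion[OF _ model_form(2) degPm model_poly(2) n] model_form(1) m by auto
  define Q where "Q = Pm + Polynomial.smult kl Zl"
  have bm: "bm $ j = coeff Zm j" if "j < n" for j
    using companion_transfer_coeff[OF n degPm model_poly(2), of "km \<cdot>\<^sub>v bm" "Polynomial.smult km Zm" j]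
      model_transfer[unfolded Am cm] model_carrier(1) m that model_gain by simp
  have lm: "coeff (Polynomial.smult kl Zl) j = (if j < n then lm $ j else 0)" for j
    by (rule companion_transfer_coeff[OF n degPm model_poly(2) _ feedback_transfer[unfolded Am cm]])
      (use model_carrier(2) m in simp)
  have cQ: "coeff Q j = coeff Pm j + (if j < n then lm $ j else 0)" for j by (simp add: Q_def lm[unfolded coeff_smult])
  \<comment> \<open>The feedback \<open>lm\<close> changes only coefficients below the leading
    one.\<close>
  have degQ: "degree Q = n"
    using degPm model_poly(2) by (intro antisym degree_le le_degree) (auto simp: cQ coeff_eq_0)
  have monQ: "lead_coeff Q = 1" using degPm model_poly(2) by (simp add: degQ cQ)

  \<comment> \<open>\<open>Zm\<close> is the characteristic polynomial of the Hurwitz matrix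
    \<Lambda>.\<close>
  have Zm0: "Re s < 0" if "poly (cpoly Zm) s = 0" for s
    using hurwitz_char_poly_roots[OF filter_carrier(1) filter_stable] that by (simp add: filter_poly)
  have Z0: "Re s < 0" if "poly (cpoly Z) s = 0" for s
    by (rule coprime_minimum_phase_roots[OF plant_poly(3) plant_minimum_phase plant_gain nz(3) that])

  \<comment> \<open>The direct gain removes the coefficient of index \<open>n - 1\<close> from
    \<open>P - Pm\<close>; what is left, up to the factor \<open>kp\<close>, is \<open>g2\<close>,
    whose coefficients from index \<open>n - 1\<close> on vanish, so that the second filter, which
    has no feedthrough, can produce it.\<close>
  define th0 where "th0 = coeff (P - Pm) (n - 1) / kp"
  define g2 where "g2 = Polynomial.smult (1 / kp) (P - Pm - Polynomial.smult (kp * th0) Zm)"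
  have lead: "coeff P n = 1" "coeff Pm n = 1" "coeff Zm (n - 1) = 1" "coeff Z (n - 1) = 1"
    using plant_poly model_poly plant_degree degPm degZm degZ by auto
  have g2_deg: "coeff g2 j = 0" if j: "j \<ge> n - 1" for j
  proof -
    consider "j = n - 1" | "j = n" | "j > n" using j n by linarith
    then show ?thesis
      using plant_gain lead plant_degree(1) degPm degZm n
      by cases (simp_all add: g2_def th0_def coeff_eq_0)
  qed
  have g2_eq: "Polynomial.smult kp g2 + Polynomial.smult (kp * th0) Zm = P - Pm"
    using plant_gain by (simp add: g2_def)
  \<comment> \<open>Both polynomials are monic of degree \<open>n - 1\<close>, so the difference is
    within reach of the first filter.\<close>
  have g1_deg: "coeff (Zm - Z) j = 0" if "j \<ge> n - 1" for j
    using that lead degZm degZ by (cases "j = n - 1") (simp_all add: coeff_eq_0)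
  obtain th1 M1 where M1: "row_resolvent (n - 1) \<Lambda> th1 Zm M1" "(\<Sum>i<n-1. Polynomial.smult (bl $ i) (M1 i)) = Zm - Z"
    using controllable_resolvent_surj[OF filter_carrier filter_controllable g1_deg] unfolding filter_poly by metis
  obtain th2 M2 where M2: "row_resolvent (n - 1) \<Lambda> th2 Zm M2" "(\<Sum>i<n-1. Polynomial.smult (bl $ i) (M2 i)) = g2"
    using controllable_resolvent_surj[OF filter_carrier filter_controllable g2_deg] unfolding filter_poly by metis
  obtain Rb where Rb: "\<And>t. t \<ge> 0 \<Longrightarrow> \<bar>r t\<bar> \<le> Rb" using reference(1) by (auto simp: bounded_signal_def)
  define X0 where "X0 p = (case p of (k, i) \<Rightarrow> (if k = 0 then xp0 $ i else if k = (1::nat) then xm0 $ i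
    else if k = 2 then w10 $ i else if k = 3 then w20 $ i else \<theta>0 $ i))" for p :: "nat \<times> nat"
  have degQ': "degree Q = degree Zm + 1" using degQ degZm n by simp
  show "(\<exists>xp xm w1 w2 \<theta> \<omega> u y ym ey.
      adaptive_system n Ap bp cp kp m Am bm cm km lm \<Lambda> bl \<gamma> r xp0 xm0 w10 w20 \<theta>0 xp xm w1 w2 \<theta> \<omega> u y ym ey) \<and>
    (\<forall>xp xm w1 w2 \<theta> \<omega> u y ym ey.
      adaptive_system n Ap bp cp kp m Am bm cm km lm \<Lambda> bl \<gamma> r xp0 xm0 w10 w20 \<theta>0 xp xm w1 w2 \<theta> \<omega> u y ym ey \<longrightarrow>
      bounded_vec_signal xp \<and> bounded_vec_signal xm \<and> bounded_vec_signal w1 \<and> bounded_vec_signal w2 \<and>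
      bounded_vec_signal \<theta> \<and> bounded_vec_signal \<omega> \<and>
      bounded_signal u \<and> bounded_signal y \<and> bounded_signal ym \<and> bounded_signal ey \<and> (ey \<longlongrightarrow> 0) at_top)"
  proof (rule kalman_yakubovich_popov[OF model_poly(1) monQ degQ' degQ Zm0 feedback_spr[folded Q_def]])
    fix W \<kappa>
    assume kyp: "0 < \<kappa>" "\<And>i j. i < n \<Longrightarrow> j < n \<Longrightarrow> W i j = W j i"
      "\<And>i. i < n \<Longrightarrow> (\<Sum>j<n. W i j * coeff Zm j) = (if i = n - 1 then 1 else 0)"
      "\<And>x. (x (n - 1))\<^sup>2 \<le> (\<Sum>i<n. \<Sum>j<n. W i j * x i * x j)"
      "\<And>x. 2 * (\<Sum>i<n. \<Sum>j<n. W i j * x i * (\<Sum>k<n. companion n Q $$ (j, k) * x k)) \<le> - \<kappa> * (x (n - 1))\<^sup>2"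
    have hur: "hurwitz (companion n Pm)" using model_stable Am by simp
    have hurZ: "hurwitz (companion (n - 1) Z)" by (rule hurwitz_companion[OF degZ plant_poly(1) Z0])
    have lmQ: "lm $ j = coeff Q j - coeff Pm j" if "j < n" for j using that by (simp add: cQ)
    interpret adaptive_loop n Ap \<Lambda> "\<lambda>i. bp $ i" "\<lambda>i. (kp \<cdot>\<^sub>v cp) $ i" "\<lambda>i. bl $ i" "\<lambda>i. bm $ i" "\<lambda>i. lm $ i"
      kp km \<gamma> r Z P Zm Pm Q g2 M M1 M2 th1 th2 th0 W \<kappa> Rb X0
      by unfold_locales
        (fact n plant_gain adaptation_gain filter_carrier(1) plant_degree(1) plant_poly(2) degZm model_poly(1) degZ plant_poly(1)
          M Mb Mdet M1 M2 g2_eq bm lmQ kyp hur filter_stable hurZ Rb)+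
    have cpi: "(kp \<cdot>\<^sub>v cp) $ i = kp * cp $ i" if "i < n" for i using that plant_carrier(3) by simp
    note carriers = plant_carrier(1,2) refl plant_carrier(3) cpi filter_carrier(2) refl
      model_carrier(1)[unfolded m] refl model_carrier(2)[unfolded m] refl
    have rep: "represents xp0 xm0 w10 w20 \<theta>0 X0"
      unfolding represents_def using init m by (auto simp: X0_def intro!: eq_vecI)
    show ?thesis
      unfolding m Am cm
      using system_exists[OF carriers rep reference(2)] system_bounded[OF carriers rep reference(2)] by blast
  qed
qed

end
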